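(* Let $F$ be a reversible Finsler metric on the $2$-torus $\mathbb{T}^2=\mathbb{R}^2/\mathbb{Z}^2$, and let $\|\cdot\|^F_{st}$ denote its stable norm, viewed as a flat Finsler metric on $\mathbb{T}^2$. Then $$\operatorname{area}_{BH}(\mathbb{T}^2,F)\;\geq\;\operatorname{area}_{BH}(\mathbb{T}^2,\|\cdot\|^F_{st}).$$
   Context: A (continuous) Finsler metric on $\mathbb{T}^2=\mathbb{R}^2/\mathbb{Z}^2$ is a continuous function $F:T\mathbb{T}^2\to[0,\infty)$ whose restriction to each tangent space $T_x\mathbb{T}^2$ is a possibly non-symmetric norm, i.e. a function that is positive outside the origin, convex and positively homogeneous. It is reversible if each of these norms is symmetric, i.e. $F(x,-v)=F(x,v)$ for all $x,v$. Let $\pi:\mathbb{R}^2\to\mathbb{T}^2$ be the quotient map and $\tilde F(\tilde x,\tilde v)=F(\pi(\tilde x),d_{\tilde x}\pi(\tilde v))$ the induced $\mathbb{Z}^2$-periodic Finsler metric on $\mathbb{R}^2$. Identifying $T_{\tilde x}\mathbb{R}^2$ with $\mathbb{R}^2$, put $\widetilde K_{\tilde x}=\{v\in\mathbb{R}^2 : \tilde F(\tilde x,v)\le 1\}$. The Busemann-Hausdorff area is $$\operatorname{area}_{BH}(\mathbb{T}^2,F)=\int_{[0,1]^2}\frac{\pi}{|\widetilde K_{\tilde x}|}\,d\tilde x_1\,d\tilde x_2,$$ where $|\cdot|$ is Lebesgue measure on $\mathbb{R}^2$ and, in the integrand, $\pi$ is the number $3.14\ldots$ Let $d_{\tilde F}(\tilde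 x,\tilde y)$ be the infimum of the lengths $\int_a^b\tilde F(\gamma(t),\dot\gamma(t))\,dt$ over piecewise smooth curves $\gamma:[a,b]\to\mathbb{R}^2$ from $\tilde x$ to $\tilde y$. The stable norm $\|\cdot\|^F_{st}$ is the norm on $\mathbb{R}^2$ extending the function defined for $z\in\mathbb{Z}^2$ by $$\|z\|^F_{st}=\lim_{k\to\infty}\frac{d_{\tilde F}(\tilde x_0,\tilde x_0+kz)}{k},$$ where $\tilde x_0\in\mathbb{R}^2$ is any fixed point. It is a known fact that the limit exists, does not depend on $\tilde x_0$, and extends to a norm on $\mathbb{R}^2$; this norm is the unique one for which there is a constant $C$ with $\|z\|^F_{st}\le d_{\tilde F}(\tilde x,\tilde x+z)\le\|z\|^F_{st}+C$ for all $z\in\mathbb{Z}^2$, $\tilde x\in\mathbb{R}^2$. The stable norm induces a flat Finsler metric on $\mathbb{T}^2$, denoted by the same symbol, whose lift to $\mathbb{R}^2$ is $(\tilde x,v)\mapsto\|v\|^F_{st}$; its Busemann-Hausdorff area is thus $\pi/|\{v\in\mathbb{R}^2:\|v\|^F_{st}\le1\}|$. *)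

theory Defs
  imports "HOL-Analysis.Analysis"
begin

section \<open>The 2-torus\<close>

definition int_lattice :: "(real^2) set" where
  "int_lattice = {z. \<forall>i. z $ i \<in> \<int>}"

definition lattice_equiv :: "real^2 \<Rightarrow> real^2 \<Rightarrow> bool" where
  "lattice_equiv x y \<longleftrightarrow> x - y \<in> int_lattice"

lemma equivp_lattice_equiv: "equivp lattice_equiv"
proof (rule equivpI)
  show "reflp lattice_equiv"
    by (simp add: reflp_def lattice_equiv_def int_lattice_def)
  show "symp lattice_equiv"
  proof (rule sympI)
    fix x y assume "lattice_equiv x y"
    then have "- (x $ i - y $ i) \<in> \<int>" for i
      unfolding lattice_equiv_def int_lattice_def by (metis (no_types, lifting) Ints_minus mem_Collect_eq vector_minus_component)
    then show "lattice_equiv y x"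
      by (simp add: lattice_equiv_def int_lattice_def)
  qed
  show "transp lattice_equiv"
  proof (rule transpI)
    fix x y z assume "lattice_equiv x y" "lattice_equiv y z"
    then have "(x $ i - y $ i) + (y $ i - z $ i) \<in> \<int>" for i
      unfolding lattice_equiv_def int_lattice_def by (metis (no_types, lifting) Ints_add mem_Collect_eq vector_minus_component)
    then show "lattice_equiv x z"
      by (simp add: lattice_equiv_def int_lattice_def)
  qed
qed

quotient_type torus = "real^2" / lattice_equiv
  by (rule equivp_lattice_equiv)

definition torus_proj :: "real^2 \<Rightarrow> torus" where
  "torus_proj = abs_torus"

lemma torus_proj_eq_iff: "torus_proj x = torus_proj y \<longleftrightarrow> x - y \<in> int_lattice"
  by (simp add: torus_proj_def torus.abs_eq_iff lattice_equiv_def)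

text \<open>The torus carries the quotient topology.\<close>

instantiation torus :: topological_space
begin

definition open_torus :: "torus set \<Rightarrow> bool" where
  "open_torus U \<longleftrightarrow> open (torus_proj -` U)"

instance
proof
  show "open (UNIV :: torus set)"
    by (simp add: open_torus_def)
  show "open (S \<inter> T)" if "open S" "open T" for S T :: "torus set"
    using that by (simp add: open_torus_def open_Int)
  show "open (\<Union>K)" if "\<forall>S\<in>K. open S" for K :: "torus set set"
    using that by (auto simp: open_torus_def vimage_Union)
qed

end

section \<open>Finsler metrics\<close>

text \<open>Norms on the plane are not required to be symmetric.\<close>

definition asym_norm :: "(real^2 \<Rightarrow> real) \<Rightarrow> bool" where
  "asym_norm N \<longleftrightarrow>
     (\<forall>v. v \<noteq> 0 \<longrightarrow> 0 < N v) \<and>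
     convex_on UNIV N \<and>
     (\<forall>c v. 0 \<le> c \<longrightarrow> N (c *\<^sub>R v) = c * N v)"

text \<open>
  The tangent bundle of the torus is trivialised by the differential of the quotient map: the pair
  \<open>(torus_proj x, v)\<close> stands for the image under that differential at \<open>x\<close> of the vector \<open>v\<close>, which
  does not depend on the choice of \<open>x\<close> in its class. Hence the tangent bundle is the product
  of the torus and the plane.
\<close>

definition finsler_metric :: "(torus \<Rightarrow> real^2 \<Rightarrow> real) \<Rightarrow> bool" where
  "finsler_metric F \<longleftrightarrow>
     continuous_on UNIV (\<lambda>(p, v). F p v) \<and> (\<forall>p. asym_norm (F p))"

definition reversible :: "(torus \<Rightarrow> real^2 \<Rightarrow> real) \<Rightarrow> bool" where
  "reversible F \<longleftrightarrow> (\<forall>p v. F p (- v) = F p v)"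

definition lift_metric :: "(torus \<Rightarrow> real^2 \<Rightarrow> real) \<Rightarrow> real^2 \<Rightarrow> real^2 \<Rightarrow> real" where
  "lift_metric F x v = F (torus_proj x) v"

definition area_BH :: "(torus \<Rightarrow> real^2 \<Rightarrow> real) \<Rightarrow> real" where
  "area_BH F =
     integral (cbox 0 1) (\<lambda>x. pi / measure lebesgue {v. lift_metric F x v \<le> 1})"

section \<open>Distance and stable norm\<close>

text \<open>
  Smoothness on a closed interval includes the endpoints (one-sided derivatives of all orders);
  \<open>D k\<close> is the \<open>k\<close>-th derivative. This is the reason for not using
  \<^const>\<open>piecewise_C1_differentiable_on\<close>, which does not bound the velocity near the
  break points and therefore admits curves whose speed is not integrable.
\<close>

definition smooth_on_interval :: "(real \<Rightarrow> real^2) \<Rightarrow> real \<Rightarrow> real \<Rightarrow> bool" where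
  "smooth_on_interval \<gamma> a b \<longleftrightarrow>
     (\<exists>D. (\<forall>t\<in>{a..b}. D (0::nat) t = \<gamma> t) \<and>
          (\<forall>k. \<forall>t\<in>{a..b}. (D k has_vector_derivative D (Suc k) t) (at t within {a..b})))"

definition piecewise_smooth :: "(real \<Rightarrow> real^2) \<Rightarrow> real \<Rightarrow> real \<Rightarrow> bool" where
  "piecewise_smooth \<gamma> a b \<longleftrightarrow>
     (\<exists>n \<tau>. \<tau> (0::nat) = a \<and> \<tau> n = b \<and>
        (\<forall>i<n. \<tau> i < \<tau> (Suc i) \<and> smooth_on_interval \<gamma> (\<tau> i) (\<tau> (Suc i))))"

text \<open>
  At the finitely many break points the value of \<^const>\<open>vector_derivative\<close> may be
  arbitrary, which does not affect the integral.
\<close>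

definition curve_length ::
  "(real^2 \<Rightarrow> real^2 \<Rightarrow> real) \<Rightarrow> (real \<Rightarrow> real^2) \<Rightarrow> real \<Rightarrow> real \<Rightarrow> real" where
  "curve_length G \<gamma> a b =
     integral {a..b} (\<lambda>t. G (\<gamma> t) (vector_derivative \<gamma> (at t within {a..b})))"

definition finsler_dist :: "(real^2 \<Rightarrow> real^2 \<Rightarrow> real) \<Rightarrow> real^2 \<Rightarrow> real^2 \<Rightarrow> real" where
  "finsler_dist G x y =
     Inf {curve_length G \<gamma> a b |\<gamma> a b.
            a < b \<and> piecewise_smooth \<gamma> a b \<and> \<gamma> a = x \<and> \<gamma> b = y}"

text \<open>
  A norm is determined by its values on the integer lattice, so at most one \<open>N\<close> satisfies the
  description; existence and independence of the base point \<open>x\<^sub>0\<close> are classical.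
\<close>

definition stable_norm :: "(torus \<Rightarrow> real^2 \<Rightarrow> real) \<Rightarrow> real^2 \<Rightarrow> real" where
  "stable_norm F =
     (THE N. asym_norm N \<and>
        (\<forall>x\<^sub>0. \<forall>z\<in>int_lattice.
           (\<lambda>k. finsler_dist (lift_metric F) x\<^sub>0 (x\<^sub>0 + real k *\<^sub>R z) / real k) \<longlonglongrightarrow> N z))"

definition flat_metric :: "(real^2 \<Rightarrow> real) \<Rightarrow> torus \<Rightarrow> real^2 \<Rightarrow> real" where
  "flat_metric N = (\<lambda>p v. N v)"

end

theory Submission
  imports Defs
begin

text \<open>
  Let \<open>N\<close> be the stable norm. A linear functional \<open>f \<le> N\<close> is calibrated by the quasiperiodic
  1-Lipschitz function \<open>h x = inf\<^sub>y (f y + d(y, x))\<close>, whose differential lies in the dual unit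
  ball of \<open>F\<close> at almost every point; mollifying \<open>h\<close> replaces Rademacher's theorem at the cost of a
  factor \<open>1 + \<eta>\<close>. The integral of \<open>dh\<^sub>i \<and> dh\<^sub>j\<close> over the torus is \<open>f\<^sub>i \<and> f\<^sub>j\<close>.

  The areas are compared by an inequality of Burago and Ivanov: if a symmetric set \<open>K\<close> is contained in
  \<open>{|f\<^sub>i| \<le> 1, i < n}\<close> and \<open>p\<close> is a probability vector, then
  \<open>q(p) = 1/2 \<Sum> p\<^sub>i p\<^sub>j |f\<^sub>i \<and> f\<^sub>j| \<le> 1/|K|\<close>, and for some \<open>p\<close> there is equality with
  \<open>K = {|f\<^sub>i| \<le> 1, i < n}\<close>. Indeed \<open>q(p)\<close> is the area of the zonogon generated by the vectors
  \<open>p\<^sub>i f\<^sub>i\<close> rotated by a right angle, and the Karush-Kuhn-Tucker conditions at a maximizer of \<open>q\<close>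
  say that this zonogon is the polygon \<open>q(p) {|f\<^sub>i| \<le> 1, i < n}\<close>. Taking \<open>p\<close> to be optimal for a polygon
  circumscribed about the unit ball of \<open>N\<close>, applying the inequality pointwise to the differentials
  \<open>dh\<^sub>i\<close> and integrating gives the theorem with the polygon in place of the ball.
\<close>

section \<open>Zonogons\<close>

text \<open>The two halves of the Burago-Ivanov inequality are used asymmetrically. A single vector
  p, optimal for the flat polygon, serves at every point x, where it has no reason to be optimal;
  hence the upper bound is proved for all p, and attainment for one. The Karush-Kuhn-Tucker
  conditions give both because half of the sum of p_j |f_i \<and> f_j| over j is the support
  function of the zonogon in the rotated direction f_i: it is at most q(p) for every i, so the
  zonogon lies in the polygon scaled by q(p), and equals q(p) where p_i > 0, which gives the
  opposite inclusion. The zonogon has area q(p) and the scaled polygon q(p)^2 |K|; one factor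
  cancels. The obstacle to integrating is the absolute value, since only the signed Jacobian has an
  integral determined by the periods. The signs are therefore frozen to those of the constants f_i
  \<and> f_j: this bounds |dh_i \<and> dh_j| from below pointwise, and the absolute values come back
  after integration. Reversibility makes the bounds on the functionals two-sided, so that strips
  |f_i| \<le> 1 describe the balls.\<close>

definition wedge :: "real^2 \<Rightarrow> real^2 \<Rightarrow> real" where
  "wedge a b = a$1 * b$2 - a$2 * b$1"

lemma wedge_simps [simp]:
  "wedge a a = 0" "wedge 0 a = 0" "wedge a 0 = 0"
  "wedge (- a) b = - wedge a b" "wedge a (- b) = - wedge a b"
  "wedge (c *\<^sub>R a) b = c * wedge a b" "wedge a (c *\<^sub>R b) = c * wedge a b"
  by (auto simp: wedge_def algebra_simps)

lemma wedge_add: "wedge (a + b) c = wedge a c + wedge b c" "wedge a (b + c) = wedge a b + wedge a c"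
  by (auto simp: wedge_def algebra_simps)

lemma wedge_commute: "wedge a b = - wedge b a"
  by (simp add: wedge_def)

lemma linear_wedge: "linear (wedge a)"
  by (rule linearI) (auto simp: wedge_add)

lemma continuous_on_wedge [continuous_intros]:
  "continuous_on S f \<Longrightarrow> continuous_on S g \<Longrightarrow> continuous_on S (\<lambda>x. wedge (f x) (g x))"
  unfolding wedge_def by (intro continuous_intros)

text \<open>Minkowski sum of \<open>Z\<close> with the centred segment from -w/2 to w/2. Centring
  makes zonogons symmetric about the origin, so that their images under linear functionals are
  intervals [-h, h].\<close>

definition segsum :: "(real^2) set \<Rightarrow> real^2 \<Rightarrow> (real^2) set" where
  "segsum Z w = (\<lambda>(z, s). z + s *\<^sub>R w) ` (Z \<times> {-1/2..1/2})"

section \<open>Area by slicing along parallel lines\<close>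

lemma Basis_vec2: "(Basis :: (real^2) set) = {axis 1 1, axis 2 1}"
  by (auto simp: Basis_vec_def UNIV_2)

lemma continuous_on_vec2 [continuous_intros]:
  fixes f g :: "'a::topological_space \<Rightarrow> real"
  assumes "continuous_on S f" "continuous_on S g"
  shows "continuous_on S (\<lambda>x. vector [f x, g x] :: real^2)"
proof -
  have "continuous_on S (\<lambda>x. \<chi> i. if i = (1::2) then f x else g x)"
    by (rule continuous_on_vec_lambda, rename_tac i, case_tac "i = 1") (use assms in auto)
  moreover have "(\<chi> i. if i = (1::2) then f x else g x) = (vector [f x, g x] :: real^2)" for x
    by (simp add: vec_eq_iff forall_2)
  ultimately show ?thesis by simp
qed

text \<open>Identifies Lebesgue measure on \<open>real^2\<close> with the product measure, so that
  Fubini's theorem can be used; agreement on boxes suffices.\<close>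

lemma lborel_vec2: "distr (lborel :: (real \<times> real) measure) borel (\<lambda>x. vector [fst x, snd x] :: real^2) = lborel"
proof -
  have meas: "(\<lambda>x. vector [fst x, snd x] :: real^2) \<in> borel_measurable (borel :: (real \<times> real) measure)"
    by (intro borel_measurable_continuous_onI continuous_intros)
  have ne: "axis 1 1 \<noteq> (axis 2 1 :: real^2)"
    by (simp add: axis_eq_axis)
  show ?thesis
  proof (rule lborel_eqI[symmetric])
    fix l u :: "real^2" assume lu: "\<And>b. b \<in> Basis \<Longrightarrow> l \<bullet> b \<le> u \<bullet> b"
    have le: "l $ i \<le> u $ i" for i
      using lu[of "axis i 1"] by (simp add: inner_axis)
    have "(\<lambda>x. vector [fst x, snd x] :: real^2) -` box l u = box (l$1, l$2) (u$1, u$2)"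
      by (auto simp: box_def Basis_vec2 inner_axis Basis_prod_def)
    then have "emeasure (distr lborel borel (\<lambda>x. vector [fst x, snd x] :: real^2)) (box l u)
        = emeasure lborel (box (l$1, l$2) (u$1, u$2))"
      using meas by (subst emeasure_distr) auto
    also have "\<dots> = ennreal ((u$1 - l$1) * (u$2 - l$2))"
      by (subst emeasure_lborel_box) (auto simp: Basis_prod_def le)
    also have "(u$1 - l$1) * (u$2 - l$2) = (\<Prod>b\<in>Basis. (u - l) \<bullet> b)"
      using ne by (simp add: inner_axis Basis_vec2)
    finally show "emeasure (distr lborel borel (\<lambda>x. vector [fst x, snd x] :: real^2)) (box l u)
        = ennreal (\<Prod>b\<in>Basis. (u - l) \<bullet> b)" .
  qed simp
qed

lemma emeasure_lborel_compact:
  fixes S :: "'a::euclidean_space set"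
  assumes "compact S"
  shows "emeasure lborel S = ennreal (measure lebesgue S)"
  using emeasure_compact_finite[OF assms] borel_compact[OF assms]
  by (simp add: emeasure_eq_ennreal_measure measure_completion)

text \<open>Cavalieri's principle for lines parallel to \<open>w\<close>. The coordinates s and y
  refer to the basis formed by \<open>w\<close> and its rotation divided by |w|^2, which spans a
  parallelogram of area 1, so no Jacobian factor appears. Leaving \<open>w\<close> unnormalized
  gives the segment from -w/2 to w/2 length 1 in the coordinate s.\<close>

lemma emeasure_lborel_slices:
  fixes w :: "real^2"
  assumes S: "compact S" and w: "w \<noteq> 0"
  shows "emeasure lborel S =
    (\<integral>\<^sup>+ y. emeasure lborel {s. s *\<^sub>R w + (y / (norm w)\<^sup>2) *\<^sub>R vector [- w$2, w$1] \<in> S} \<partial>lborel)"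
proof -
  define c where "c = 1 / (norm w)\<^sup>2"
  define T :: "real^2 \<Rightarrow> real^2" where "T v = vector [c * (w \<bullet> v), wedge w v]" for v
  have nw: "(norm w)\<^sup>2 = w$1 * w$1 + w$2 * w$2"
    by (simp only: power2_norm_eq_inner) (simp add: inner_vec_def sum_2)
  have c: "c * (w$1 * w$1 + w$2 * w$2) = 1"
    using w unfolding nw[symmetric] by (simp add: c_def)
  have lin: "linear T"
    by (rule linearI) (auto simp: T_def wedge_add vec_eq_iff forall_2 inner_right_distrib algebra_simps)
  have comps: "T v $ 1 = c * w$1 * v$1 + c * w$2 * v$2" "T v $ 2 = w$1 * v$2 - w$2 * v$1" for v
    by (simp_all add: T_def wedge_def inner_vec_def sum_2 algebra_simps)
  have "det (matrix T) = c * w$1 * w$1 + c * w$2 * w$2"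
    by (simp add: det_2 matrix_def comps axis_def)
  also have "\<dots> = 1"
    using c by (simp add: algebra_simps)
  finally have det: "det (matrix T) = 1" .
  have TS: "compact (T ` S)"
    by (rule compact_continuous_image[OF linear_continuous_on S]) (simp add: lin linear_conv_bounded_linear[symmetric])
  have slice: "vector [s, y] \<in> T ` S \<longleftrightarrow> s *\<^sub>R w + (y / (norm w)\<^sup>2) *\<^sub>R vector [- w$2, w$1] \<in> S" for s y
  proof -
    have "T v = vector [s, y] \<longleftrightarrow> v = s *\<^sub>R w + (y * c) *\<^sub>R vector [- w$2, w$1]" for v
    proof
      assume "T v = vector [s, y]"
      then have s: "s = c * w$1 * v$1 + c * w$2 * v$2" and y: "y = w$1 * v$2 - w$2 * v$1"
        using comps[of v] by auto
      have "s * w$1 + y * c * (- w$2) = (c * (w$1 * w$1 + w$2 * w$2)) * v$1"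
        unfolding s y by (simp add: algebra_simps)
      moreover have "s * w$2 + y * c * w$1 = (c * (w$1 * w$1 + w$2 * w$2)) * v$2"
        unfolding s y by (simp add: algebra_simps)
      ultimately show "v = s *\<^sub>R w + (y * c) *\<^sub>R vector [- w$2, w$1]"
        by (simp add: vec_eq_iff forall_2 c)
    next
      assume v: "v = s *\<^sub>R w + (y * c) *\<^sub>R vector [- w$2, w$1]"
      have "T v $ 1 = s * (c * (w$1 * w$1 + w$2 * w$2))" "T v $ 2 = y * (c * (w$1 * w$1 + w$2 * w$2))"
        unfolding comps v by (simp_all add: algebra_simps)
      then show "T v = vector [s, y]"
        by (simp add: vec_eq_iff forall_2 c)
    qed
    then show ?thesis
      unfolding image_iff by (metis (no_types, lifting) c_def mult.right_neutral times_divide_eq_right)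
  qed
  have [measurable]: "(\<lambda>x. vector [fst x, snd x] :: real^2) \<in> borel_measurable borel"
    by (intro borel_measurable_continuous_onI continuous_intros)
  have TS_b [measurable]: "T ` S \<in> sets borel" and S_b [measurable]: "S \<in> sets borel"
    using TS S by (auto intro: borel_compact)
  have "emeasure lborel S = measure lebesgue S"
    by (rule emeasure_lborel_compact[OF S])
  also have "\<dots> = measure lebesgue (T ` S)"
    using measure_linear_image[OF lin, of S] det S by (simp add: lmeasurable_compact)
  also have "\<dots> = emeasure lborel (T ` S)"
    by (rule emeasure_lborel_compact[OF TS, symmetric])
  also have "\<dots> = emeasure (distr lborel borel (\<lambda>x. vector [fst x, snd x] :: real^2)) (T ` S)"
    by (simp only: lborel_vec2)
  also have "\<dots> = emeasure lborel {x. (vector [fst x, snd x] :: real^2) \<in> T ` S}"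
    by (subst emeasure_distr) (auto simp: vimage_def)
  also have "\<dots> = emeasure (lborel \<Otimes>\<^sub>M lborel) {x. (vector [fst x, snd x] :: real^2) \<in> T ` S}"
    by (simp only: lborel_prod)
  also have "\<dots> = (\<integral>\<^sup>+ y. emeasure lborel ((\<lambda>s. (s, y)) -` {x. (vector [fst x, snd x] :: real^2) \<in> T ` S}) \<partial>lborel)"
  proof (rule lborel_pair.emeasure_pair_measure_alt2)
    have "(\<lambda>x. vector [fst x, snd x] :: real^2) -` (T ` S) \<inter> space borel \<in> sets borel"
      by (rule measurable_sets) measurable
    then have "{x. (vector [fst x, snd x] :: real^2) \<in> T ` S} \<in> sets lborel"
      by (simp add: vimage_def)
    then show "{x. (vector [fst x, snd x] :: real^2) \<in> T ` S} \<in> sets (lborel \<Otimes>\<^sub>M lborel)"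
      by (simp only: lborel_prod)
  qed
  also have "\<dots> = (\<integral>\<^sup>+ y. emeasure lborel {s. s *\<^sub>R w + (y / (norm w)\<^sup>2) *\<^sub>R vector [- w$2, w$1] \<in> S} \<partial>lborel)"
    by (simp add: vimage_def slice)
  finally show ?thesis .
qed

lemma compact_segsum: "compact Z \<Longrightarrow> compact (segsum Z w)"
  unfolding segsum_def
  by (intro compact_continuous_image compact_Times compact_Icc)
    (auto simp: case_prod_beta intro!: continuous_intros)

text \<open>Every slice of a compact convex set along \<open>w\<close> is an interval, and for
  \<open>w\<close> nonzero adding the segment lengthens each nonempty one by exactly 1. The nonempty
  slices are those with y in [\<alpha>, \<beta>], whose length is therefore the gain in
  area.\<close>

lemma measure_segsum:
  assumes Z: "compact Z" "convex Z" and range: "wedge w ` Z = {\<alpha>..\<beta>}" and le: "\<alpha> \<le> \<beta>"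
  shows "measure lebesgue (segsum Z w) = measure lebesgue Z + (\<beta> - \<alpha>)"
proof (cases "w = 0")
  case True
  then have sub: "{\<alpha>..\<beta>} \<subseteq> {0}" and "segsum Z w = Z"
    using range by (auto simp: segsum_def image_def)
  moreover have "\<alpha> = 0" "\<beta> = 0"
    using subsetD[OF sub, of \<alpha>] subsetD[OF sub, of \<beta>] le by simp_all
  ultimately show ?thesis
    by simp
next
  case w: False
  define b where "b y = (y / (norm w)\<^sup>2) *\<^sub>R (vector [- w$2, w$1] :: real^2)" for y
  define sl where "sl S y = {s. s *\<^sub>R w + b y \<in> S}" for S y
  have nw: "(norm w)\<^sup>2 = w$1 * w$1 + w$2 * w$2"
    by (simp only: power2_norm_eq_inner) (simp add: inner_vec_def sum_2)
  have nz: "w$1 * w$1 + w$2 * w$2 \<noteq> 0"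
    using w unfolding nw[symmetric] by simp
  have wb: "wedge w (b y) = y" for y
    using nz by (simp add: b_def nw) (simp add: wedge_def)
  have decomp: "z = ((w \<bullet> z) / (norm w)\<^sup>2) *\<^sub>R w + b (wedge w z)" for z
  proof -
    have "(norm w)\<^sup>2 *\<^sub>R z = (w \<bullet> z) *\<^sub>R w + wedge w z *\<^sub>R (vector [- w$2, w$1] :: real^2)"
      by (simp add: nw vec_eq_iff forall_2 wedge_def inner_vec_def sum_2 algebra_simps)
    then have "z = (1 / (norm w)\<^sup>2) *\<^sub>R ((w \<bullet> z) *\<^sub>R w + wedge w z *\<^sub>R (vector [- w$2, w$1] :: real^2))"
      using w by (metis (no_types, lifting) divide_self_if norm_eq_zero power_not_zero scaleR_one scaleR_scaleR times_divide_eq_left mult_1)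
    then show ?thesis
      by (simp add: b_def scaleR_add_right)
  qed
  have slcont: "continuous_on UNIV (\<lambda>s. s *\<^sub>R w + b y)" for y
    by (intro continuous_intros)
  have sl_interval: "\<exists>l u. sl Z y = {l..u}" for y
  proof -
    have "closed (sl Z y)"
      using closed_vimage[OF compact_imp_closed[OF Z(1)] slcont[of y]] by (simp add: sl_def vimage_def)
    moreover have "bounded (sl Z y)"
    proof -
      obtain B where B: "\<And>z. z \<in> Z \<Longrightarrow> norm z \<le> B"
        using compact_imp_bounded[OF Z(1)] by (auto simp: bounded_iff)
      have "norm s \<le> (B + norm (b y)) / norm w" if "s \<in> sl Z y" for s
      proof -
        have "norm (s *\<^sub>R w) \<le> norm (s *\<^sub>R w + b y) + norm (b y)"
          by (metis add_diff_cancel norm_triangle_ineq4)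
        also have "\<dots> \<le> B + norm (b y)"
          using B that by (auto simp: sl_def)
        finally show ?thesis
          using w by (simp add: field_simps)
      qed
      then show ?thesis
        by (auto simp: bounded_iff)
    qed
    moreover have "convex (sl Z y)"
    proof -
      have "s * u + t * v \<in> sl Z y" if "s \<ge> 0" "t \<ge> 0" "s + t = 1" "u \<in> sl Z y" "v \<in> sl Z y" for s t u v
      proof -
        have "s *\<^sub>R (u *\<^sub>R w + b y) + t *\<^sub>R (v *\<^sub>R w + b y) \<in> Z"
          using that Z(2) by (auto simp: convex_def sl_def)
        also have "s *\<^sub>R (u *\<^sub>R w + b y) + t *\<^sub>R (v *\<^sub>R w + b y) = (s * u + t * v) *\<^sub>R w + (s + t) *\<^sub>R b y"
          by (simp add: algebra_simps)
        finally show ?thesis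
          using that by (simp add: sl_def)
      qed
      then show ?thesis
        by (simp add: convex_def)
    qed
    ultimately show ?thesis
      using connected_compact_interval_1 compact_eq_bounded_closed convex_connected by metis
  qed
  have sl_nonempty: "sl Z y \<noteq> {} \<longleftrightarrow> y \<in> {\<alpha>..\<beta>}" for y
  proof -
    have "y \<in> wedge w ` Z \<longleftrightarrow> sl Z y \<noteq> {}"
    proof
      assume "y \<in> wedge w ` Z"
      then obtain z where "z \<in> Z" "y = wedge w z"
        by auto
      then have "((w \<bullet> z) / (norm w)\<^sup>2) *\<^sub>R w + b y \<in> Z"
        using decomp[of z] by metis
      then show "sl Z y \<noteq> {}"
        by (auto simp: sl_def)
    next
      assume "sl Z y \<noteq> {}"
      then obtain s where "s *\<^sub>R w + b y \<in> Z"
        by (auto simp: sl_def)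
      then show "y \<in> wedge w ` Z"
        by (intro image_eqI) (auto simp: wedge_add wb)
    qed
    then show ?thesis
      using range by simp
  qed
  have sl_seg: "sl (segsum Z w) y = (\<lambda>(s, t). s + t) ` (sl Z y \<times> {-1/2..1/2})" for y
  proof (intro equalityI subsetI)
    fix s assume "s \<in> sl (segsum Z w) y"
    then obtain z t where zt: "z \<in> Z" "-1/2 \<le> t" "t \<le> 1/2" "s *\<^sub>R w + b y = z + t *\<^sub>R w"
      by (auto simp: sl_def segsum_def)
    then have "(s - t) *\<^sub>R w + b y = z"
      by (simp add: algebra_simps)
    then have "s - t \<in> sl Z y"
      using zt by (simp add: sl_def)
    then have "(s - t, t) \<in> sl Z y \<times> {-1/2..1/2}" "s = (\<lambda>(s, t). s + t) (s - t, t)"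
      using zt by auto
    then show "s \<in> (\<lambda>(s, t). s + t) ` (sl Z y \<times> {-1/2..1/2})"
      by blast
  next
    fix s assume "s \<in> (\<lambda>(s, t). s + t) ` (sl Z y \<times> {-1/2..1/2})"
    then obtain u t where ut: "u \<in> sl Z y" "-1/2 \<le> t" "t \<le> 1/2" "s = u + t"
      by auto
    then have "s *\<^sub>R w + b y = (u *\<^sub>R w + b y) + t *\<^sub>R w"
      by (simp add: algebra_simps)
    then show "s \<in> sl (segsum Z w) y"
      using ut by (auto simp: sl_def segsum_def intro!: image_eqI[of _ _ "(u *\<^sub>R w + b y, t)"])
  qed
  have slice_measure: "emeasure lborel (sl (segsum Z w) y) =
      emeasure lborel (sl Z y) + indicator {\<alpha>..\<beta>} y" for y
  proof (cases "y \<in> {\<alpha>..\<beta>}")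
    case True
    then have ne: "sl Z y \<noteq> {}"
      using sl_nonempty by blast
    obtain l u where lu: "sl Z y = {l..u}"
      using sl_interval by blast
    then have "l \<le> u"
      using ne by auto
    have "sl (segsum Z w) y = {l - 1/2..u + 1/2}"
    proof (intro equalityI subsetI)
      fix s assume s: "s \<in> {l - 1/2..u + 1/2}"
      \<comment> \<open>The point of the slice of \<open>Z\<close> nearest to \<open>s\<close>; what
        remains of \<open>s\<close> is supplied by the segment.\<close>
      define v where "v = max l (min u s)"
      have "v \<in> {l..u}" "s - v \<in> {-1/2..1/2}"
        using s \<open>l \<le> u\<close> by (auto simp: v_def)
      then show "s \<in> sl (segsum Z w) y"
        unfolding sl_seg lu by (intro image_eqI[of _ _ "(v, s - v)"]) auto
    qed (auto simp: sl_seg lu)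
    then show ?thesis
      using \<open>l \<le> u\<close> True lu by (simp add: ennreal_plus[symmetric] ennreal_1[symmetric] del: ennreal_plus ennreal_1)
  next
    case False
    then have "sl Z y = {}"
      using sl_nonempty by blast
    then show ?thesis
      using False by (simp add: sl_seg)
  qed
  have slices: "emeasure lborel S = (\<integral>\<^sup>+ y. emeasure lborel (sl S y) \<partial>lborel)" if "compact S" for S
    using emeasure_lborel_slices[OF that w] by (simp add: sl_def b_def)
  have slm: "(\<lambda>y. emeasure lborel (sl Z y)) \<in> borel_measurable lborel"
  proof -
    have cont: "continuous_on UNIV (\<lambda>x. fst x *\<^sub>R w + b (snd x))"
      unfolding b_def using w by (intro continuous_intros) auto
    have "closed ((\<lambda>x. fst x *\<^sub>R w + b (snd x)) -` Z)"
      by (rule closed_vimage[OF compact_imp_closed[OF Z(1)] cont])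
    then have "(\<lambda>x. fst x *\<^sub>R w + b (snd x)) -` Z \<in> sets (lborel \<Otimes>\<^sub>M lborel)"
      by (simp only: lborel_prod) simp
    from lborel_pair.measurable_emeasure_Pair2[OF this] show ?thesis
      by (simp add: sl_def vimage_def)
  qed
  have "ennreal (measure lebesgue (segsum Z w)) = emeasure lborel (segsum Z w)"
    by (rule emeasure_lborel_compact[OF compact_segsum[OF Z(1)], symmetric])
  also have "\<dots> = (\<integral>\<^sup>+ y. emeasure lborel (sl Z y) + indicator {\<alpha>..\<beta>} y \<partial>lborel)"
    by (simp add: slices[OF compact_segsum[OF Z(1)]] slice_measure)
  also have "\<dots> = (\<integral>\<^sup>+ y. emeasure lborel (sl Z y) \<partial>lborel) + (\<integral>\<^sup>+ y. indicator {\<alpha>..\<beta>} y \<partial>lborel)"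
    by (rule nn_integral_add) (use slm in auto)
  also have "\<dots> = emeasure lborel Z + ennreal (\<beta> - \<alpha>)"
    using le by (simp add: slices[OF Z(1)])
  also have "\<dots> = ennreal (measure lebesgue Z + (\<beta> - \<alpha>))"
    using le by (simp add: emeasure_lborel_compact[OF Z(1)])
  finally show ?thesis
    using le by (subst (asm) ennreal_inj) auto
qed

section \<open>Zonogons: width, area and description by half-planes\<close>

fun zonogon :: "(nat \<Rightarrow> real^2) \<Rightarrow> nat \<Rightarrow> (real^2) set" where
  "zonogon w 0 = {0}"
| "zonogon w (Suc n) = segsum (zonogon w n) (w n)"

lemma compact_zonogon: "compact (zonogon w n)"
  by (induction n) (auto simp: compact_segsum)

lemma convex_segsum:
  assumes "convex Z"
  shows "convex (segsum Z w)"
proof -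
  have eq: "segsum Z w = (\<Union>x\<in>Z. \<Union>y\<in>(\<lambda>s. s *\<^sub>R w) ` {-1/2..1/2}. {x + y})"
    by (auto simp: segsum_def)
  have "convex ((\<lambda>s. s *\<^sub>R w) ` {-1/2..1/2})"
    by (intro convex_linear_image) (auto simp: linear_scaleR_left)
  then show ?thesis
    unfolding eq by (intro convex_sums assms)
qed

lemma convex_zonogon: "convex (zonogon w n)"
  by (induction n) (auto simp: convex_segsum)

lemma wedge_image_segsum:
  assumes "wedge a ` Z = {-h..h}" "0 \<le> h"
  shows "wedge a ` segsum Z w = {-(h + \<bar>wedge a w\<bar> / 2)..h + \<bar>wedge a w\<bar> / 2}"
proof (intro equalityI subsetI)
  fix y assume "y \<in> wedge a ` segsum Z w"
  then obtain z s where zs: "z \<in> Z" "-1/2 \<le> s" "s \<le> 1/2" "y = wedge a z + s * wedge a w"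
    by (auto simp: segsum_def wedge_add)
  then have "wedge a z \<in> {-h..h}"
    using assms by blast
  moreover have "\<bar>s * wedge a w\<bar> \<le> \<bar>wedge a w\<bar> / 2"
    using mult_right_mono[of "\<bar>s\<bar>" "1/2" "\<bar>wedge a w\<bar>"] zs by (auto simp: abs_mult)
  ultimately show "y \<in> {-(h + \<bar>wedge a w\<bar> / 2)..h + \<bar>wedge a w\<bar> / 2}"
    using zs by (auto simp: abs_le_iff)
next
  fix y assume y: "y \<in> {-(h + \<bar>wedge a w\<bar> / 2)..h + \<bar>wedge a w\<bar> / 2}"
  \<comment> \<open>The part of \<open>y\<close> beyond [-h, h] is at most half of |wedge a w| and
    is supplied by a multiple of \<open>w\<close>.\<close>
  define u where "u = max (-h) (min h y)"
  have "u \<in> {-h..h}"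
    using assms(2) by (auto simp: u_def)
  then obtain z where z: "z \<in> Z" "wedge a z = u"
    using assms(1) by (metis imageE)
  have d: "\<bar>y - u\<bar> \<le> \<bar>wedge a w\<bar> / 2"
    using y assms(2) abs_ge_zero[of "wedge a w"] by (auto simp: u_def max_def min_def)
  define s where "s = (if wedge a w = 0 then 0 else (y - u) / wedge a w)"
  have "\<bar>s\<bar> \<le> 1/2" "s * wedge a w = y - u"
    using d by (auto simp: s_def divide_simps)
  then show "y \<in> wedge a ` segsum Z w"
    using z by (intro image_eqI[of _ _ "z + s *\<^sub>R w"]) (auto simp: segsum_def wedge_add image_iff abs_le_iff intro!: bexI[of _ z] bexI[of _ s])
qed

text \<open>As \<open>wedge a\<close> is the inner product with the rotated \<open>a\<close>, the
  right endpoint is the support function of the zonogon in that direction. The length of the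
  interval is the area gained by adding \<open>a\<close> as a generator, and its endpoints allow a
  comparison with polygons.\<close>

lemma wedge_image_zonogon:
  "wedge a ` zonogon w n = {-((\<Sum>i<n. \<bar>wedge a (w i)\<bar>) / 2)..(\<Sum>i<n. \<bar>wedge a (w i)\<bar>) / 2}"
proof (induction n)
  case (Suc n)
  have "0 \<le> (\<Sum>i<n. \<bar>wedge a (w i)\<bar>) / 2"
    by (simp add: sum_nonneg)
  from wedge_image_segsum[OF Suc.IH this] show ?case
    by (simp add: add_divide_distrib)
qed auto

text \<open>A new generator adds the width of the zonogon built so far, that is, one term for each
  pair with an earlier generator. The symmetric double sum counts each pair twice and the diagonal
  contributes nothing, hence the factor 1/2.\<close>

theorem measure_zonogon:
  "measure lebesgue (zonogon w n) = (\<Sum>i<n. \<Sum>j<n. \<bar>wedge (w i) (w j)\<bar>) / 2"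
proof (induction n)
  case (Suc n)
  have "measure lebesgue (zonogon w (Suc n)) =
      measure lebesgue (zonogon w n) + (\<Sum>i<n. \<bar>wedge (w n) (w i)\<bar>)"
    by (simp, subst measure_segsum[OF compact_zonogon convex_zonogon wedge_image_zonogon]) (simp_all add: sum_nonneg)
  moreover have "(\<Sum>i<n. \<bar>wedge (w i) (w n)\<bar>) = (\<Sum>i<n. \<bar>wedge (w n) (w i)\<bar>)"
    by (metis wedge_commute abs_minus_cancel)
  ultimately show ?case
    using Suc by (simp add: sum.distrib field_simps)
qed auto

text \<open>Cramer's rule without division by the determinant.\<close>

lemma wedge_expand: "wedge a b *\<^sub>R y = wedge y b *\<^sub>R a + wedge a y *\<^sub>R b"
  by (simp add: vec_eq_iff forall_2 wedge_def algebra_simps)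

text \<open>
  The support function inequality only has to be checked in the directions of the generators,
  because these are the extreme points of the polar body, up to scaling.
\<close>

lemma halfplanes_subset_zonogon:
  assumes nonpar: "i0 < n" "j0 < n" "wedge (w i0) (w j0) \<noteq> 0"
    and x: "\<And>i. i < n \<Longrightarrow> \<bar>wedge (w i) x\<bar> \<le> (\<Sum>j<n. \<bar>wedge (w i) (w j)\<bar>) / 2"
  shows "x \<in> zonogon w n"
proof -
  \<comment> \<open>Twice the support function of the zonogon, in rotated coordinates;
    \<open>C\<close> is thus the polar body up to a rotation and a factor 2.\<close>
  define S where "S y = (\<Sum>j<n. \<bar>wedge y (w j)\<bar>)" for y
  define C where "C = {y. S y \<le> 1}"
  have S_scale: "S (c *\<^sub>R y) = \<bar>c\<bar> * S y" for c y
    by (simp add: S_def abs_mult sum_distrib_left)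
  have S_triangle: "S (y + z) \<le> S y + S z" for y z
    unfolding S_def sum.distrib[symmetric] by (intro sum_mono) (simp add: wedge_add abs_triangle_ineq)
  have S_nonneg: "0 \<le> S y" for y
    by (simp add: S_def sum_nonneg)
  have S_ge: "j < n \<Longrightarrow> \<bar>wedge y (w j)\<bar> \<le> S y" for y j
    unfolding S_def by (rule member_le_sum) auto
  \<comment> \<open>By Cramer's rule, a vector whose wedge with two nonparallel generators is zero
    vanishes.\<close>
  have S_pos: "0 < S y" if "y \<noteq> 0" for y
  proof (rule ccontr)
    assume "\<not> 0 < S y"
    then have "S y = 0"
      using S_nonneg[of y] by simp
    then have "wedge y (w i0) = 0" "wedge y (w j0) = 0"
      using S_ge[of i0 y] S_ge[of j0 y] nonpar by auto
    then have "wedge (w i0) (w j0) *\<^sub>R y = 0"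
      using wedge_expand[of "w i0" "w j0" y] wedge_commute[of y "w i0"] by simp
    then show False
      using that nonpar by simp
  qed
  have S_cont: "continuous_on UNIV S"
    unfolding S_def by (intro continuous_intros)
  have "convex C"
  proof (rule convexI)
    fix y z and u v :: real assume yz: "y \<in> C" "z \<in> C" and uv: "0 \<le> u" "0 \<le> v" "u + v = 1"
    have "S (u *\<^sub>R y + v *\<^sub>R z) \<le> u * S y + v * S z"
      using S_triangle[of "u *\<^sub>R y" "v *\<^sub>R z"] uv by (simp add: S_scale)
    also have "\<dots> \<le> u * 1 + v * 1"
      using yz uv by (intro add_mono mult_left_mono) (auto simp: C_def)
    finally show "u *\<^sub>R y + v *\<^sub>R z \<in> C"
      using uv by (simp add: C_def)
  qed
  have "closed C"
    using closed_Collect_le[OF S_cont continuous_on_const[of UNIV 1]] by (simp add: C_def)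
  moreover have "bounded C"
  proof -
    have "norm y \<le> (norm (w i0) + norm (w j0)) / \<bar>wedge (w i0) (w j0)\<bar>" if "y \<in> C" for y
    proof -
      have le1: "\<bar>wedge y (w j0)\<bar> \<le> 1" "\<bar>wedge (w i0) y\<bar> \<le> 1"
        using that S_ge[of i0 y] S_ge[of j0 y] nonpar wedge_commute[of "w i0" y] by (auto simp: C_def)
      moreover have "\<bar>wedge (w i0) (w j0)\<bar> * norm y \<le> \<bar>wedge y (w j0)\<bar> * norm (w i0) + \<bar>wedge (w i0) y\<bar> * norm (w j0)"
        using norm_triangle_ineq[of "wedge y (w j0) *\<^sub>R w i0" "wedge (w i0) y *\<^sub>R w j0"]
        by (simp add: wedge_expand[symmetric] del: wedge_simps)
      moreover have "\<bar>wedge y (w j0)\<bar> * norm (w i0) \<le> 1 * norm (w i0)" "\<bar>wedge (w i0) y\<bar> * norm (w j0) \<le> 1 * norm (w j0)"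
        by (rule mult_right_mono[OF le1(1)], simp) (rule mult_right_mono[OF le1(2)], simp)
      ultimately show ?thesis
        using nonpar by (simp add: field_simps)
    qed
    then show ?thesis
      by (auto simp: bounded_iff)
  qed
  ultimately have "compact C"
    by (simp add: compact_eq_bounded_closed)
  have extreme: "wedge y x \<le> 1/2" if y: "y extreme_point_of C" for y
  proof (cases "\<exists>i<n. w i \<noteq> 0 \<and> wedge y (w i) = 0")
    case True
    then obtain i where i: "i < n" "w i \<noteq> 0" "wedge y (w i) = 0"
      by auto
    obtain c where c: "y = c *\<^sub>R w i"
    proof -
      obtain k where k: "w i $ k \<noteq> 0"
        using i(2) by (auto simp: vec_eq_iff)
      have "y = (y $ k / w i $ k) *\<^sub>R w i"
        using k i(3) exhaust_2[of k] by (auto simp: vec_eq_iff forall_2 wedge_def field_simps)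
      then show thesis
        using that by blast
    qed
    have "wedge y x \<le> \<bar>c\<bar> * \<bar>wedge (w i) x\<bar>"
      by (simp add: c abs_mult[symmetric])
    also have "\<dots> \<le> \<bar>c\<bar> * (S (w i) / 2)"
      using x[OF i(1)] by (intro mult_left_mono) (auto simp: S_def)
    also have "\<dots> = S y / 2"
      by (simp add: c S_scale)
    also have "\<dots> \<le> 1 / 2"
      using y by (simp add: extreme_point_of_def C_def)
    finally show ?thesis .
  next
    case False
    \<comment> \<open>No nonzero generator is parallel to \<open>y\<close>, so no term of
      \<open>S\<close> changes sign near \<open>y\<close> and \<open>S\<close> is affine there:
      moving by d changes it by \<open>wedge d v\<close>. Along \<open>v\<close> itself the change
      is zero, which makes \<open>y\<close> interior to a segment in \<open>C\<close>; if
      \<open>v\<close> is zero, any direction will do.\<close>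
    define v where "v = (\<Sum>j<n. sgn (wedge y (w j)) *\<^sub>R w j)"
    define d where "d = (if v = 0 then vector [1, 0] else v)"
    have d: "d \<noteq> 0" "wedge d v = 0"
    proof -
      have "(vector [1, 0] :: real^2) \<noteq> 0"
        by (simp add: vec_eq_iff forall_2)
      then show "d \<noteq> 0" "wedge d v = 0"
        by (auto simp: d_def)
    qed
    have wd: "(\<Sum>j<n. sgn (wedge y (w j)) * wedge d (w j)) = 0"
    proof -
      have "wedge d v = (\<Sum>j<n. sgn (wedge y (w j)) * wedge d (w j))"
        by (simp add: v_def linear_sum[OF linear_wedge])
      then show ?thesis
        using d by simp
    qed
    have "\<exists>e>0. \<forall>j<n. e * \<bar>wedge d (w j)\<bar> \<le> \<bar>wedge y (w j)\<bar>"
    proof -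
      have "\<forall>j<n. \<exists>e>0. e * \<bar>wedge d (w j)\<bar> \<le> \<bar>wedge y (w j)\<bar>"
      proof (intro allI impI)
        fix j assume j: "j < n"
        show "\<exists>e>0. e * \<bar>wedge d (w j)\<bar> \<le> \<bar>wedge y (w j)\<bar>"
        proof (cases "w j = 0")
          case True
          then show ?thesis by (auto intro: exI[of _ 1])
        next
          case nz: False
          then have "\<bar>wedge y (w j)\<bar> > 0"
            using False j by auto
          then show ?thesis
            by (intro exI[of _ "\<bar>wedge y (w j)\<bar> / (1 + \<bar>wedge d (w j)\<bar>)"]) (auto simp: field_simps)
        qed
      qed
      then obtain e where e: "\<And>j. j < n \<Longrightarrow> 0 < e j \<and> e j * \<bar>wedge d (w j)\<bar> \<le> \<bar>wedge y (w j)\<bar>"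
        by metis
      define e0 where "e0 = Min (e ` {..<n})"
      have "e0 \<in> e ` {..<n}"
        unfolding e0_def using nonpar(1) by (intro Min_in) auto
      then have "0 < e0"
        using e by auto
      moreover have "\<And>j. j < n \<Longrightarrow> e0 \<le> e j"
        unfolding e0_def by (intro Min_le) auto
      ultimately show ?thesis
        using e by (intro exI[of _ e0]) (meson abs_ge_zero mult_right_mono order_trans)
    qed
    then obtain e where e: "0 < e" "\<And>j. j < n \<Longrightarrow> e * \<bar>wedge d (w j)\<bar> \<le> \<bar>wedge y (w j)\<bar>"
      by auto
    have S_shift: "S (y + (s * e) *\<^sub>R d) = S y" if "\<bar>s\<bar> = 1" for s
    proof -
      have "\<bar>wedge (y + (s * e) *\<^sub>R d) (w j)\<bar> = \<bar>wedge y (w j)\<bar> + s * e * (sgn (wedge y (w j)) * wedge d (w j))"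
        if "j < n" for j
      proof -
        have "\<bar>s * e * wedge d (w j)\<bar> \<le> \<bar>wedge y (w j)\<bar>"
          using e(2)[OF that] e(1) \<open>\<bar>s\<bar> = 1\<close> by (simp add: abs_mult)
        then show ?thesis
          by (auto simp: wedge_add sgn_if)
      qed
      then have "S (y + (s * e) *\<^sub>R d) = (\<Sum>j<n. \<bar>wedge y (w j)\<bar> + s * e * (sgn (wedge y (w j)) * wedge d (w j)))"
        by (simp add: S_def)
      also have "\<dots> = S y"
        by (simp add: S_def sum.distrib sum_distrib_left[symmetric] wd)
      finally show ?thesis .
    qed
    have "y \<in> C"
      using y by (simp add: extreme_point_of_def)
    then have in_C: "y + e *\<^sub>R d \<in> C" "y - e *\<^sub>R d \<in> C"
      using S_shift[of 1] S_shift[of "-1"] by (auto simp: C_def)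
    have ed: "e *\<^sub>R d \<noteq> 0"
      using d e by simp
    then have ne: "y + e *\<^sub>R d \<noteq> y - e *\<^sub>R d"
    proof -
      have "(y + e *\<^sub>R d) - (y - e *\<^sub>R d) = 2 *\<^sub>R (e *\<^sub>R d)"
        by (simp add: vec_eq_iff)
      then show ?thesis
        using ed by (metis right_minus_eq scaleR_eq_0_iff zero_neq_numeral)
    qed
    have "y = midpoint (y + e *\<^sub>R d) (y - e *\<^sub>R d)"
      by (simp add: midpoint_def)
    then have "y \<in> open_segment (y + e *\<^sub>R d) (y - e *\<^sub>R d)"
      using ne midpoint_in_open_segment by metis
    then have False
      using y in_C by (auto simp: extreme_point_of_def)
    then show ?thesis ..
  qed
  have C_le: "wedge y x \<le> 1/2" if "y \<in> C" for y
  proof -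
    have "C = convex hull {y. y extreme_point_of C}"
      by (rule Krein_Milman_Minkowski) fact+
    also have "\<dots> \<subseteq> {y. wedge y x \<le> 1/2}"
    proof (rule hull_minimal)
      have "{y. wedge y x \<le> 1/2} = {y. vector [x$2, - x$1] \<bullet> y \<le> 1/2}"
        by (auto simp: wedge_def inner_vec_def sum_2 algebra_simps)
      then show "convex {y. wedge y x \<le> 1/2}"
        by (simp only: convex_halfspace_le)
    qed (use extreme in auto)
    finally show ?thesis
      using that by auto
  qed
  have all_le: "wedge y x \<le> S y / 2" for y
  proof (cases "y = 0")
    case False
    then have "(1 / S y) *\<^sub>R y \<in> C"
      using S_pos[of y] by (simp add: C_def S_scale)
    from C_le[OF this] show ?thesis
      using S_pos[OF False] by (simp add: field_simps)
  qed (simp add: S_def)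
  show ?thesis
  proof (rule ccontr)
    assume "x \<notin> zonogon w n"
    then obtain a b where ab: "a \<bullet> x < b" "\<And>z. z \<in> zonogon w n \<Longrightarrow> b < a \<bullet> z"
      using separating_hyperplane_closed_point[OF convex_zonogon compact_imp_closed[OF compact_zonogon]] by metis
    define y :: "real^2" where "y = vector [- a$2, a$1]"
    have y: "wedge y z = - (a \<bullet> z)" for z
      by (simp add: y_def wedge_def inner_vec_def sum_2)
    have "S y / 2 \<in> wedge y ` zonogon w n"
      unfolding wedge_image_zonogon using S_nonneg[of y] by (auto simp: S_def)
    then obtain z where "z \<in> zonogon w n" "wedge y z = S y / 2"
      by auto
    then show False
      using ab all_le[of y] by (force simp: y)
  qed
qed

section \<open>The quadratic form on the simplex and its maximizers\<close>

definition qform :: "(nat \<Rightarrow> real^2) \<Rightarrow> nat \<Rightarrow> (nat \<Rightarrow> real) \<Rightarrow> real" where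
  "qform a n p = (\<Sum>i<n. \<Sum>j<n. p i * p j * \<bar>wedge (a i) (a j)\<bar>) / 2"

text \<open>The weights from index \<open>n\<close> on are fixed to 0, so that the simplex is a
  compact set in the product topology on all sequences.\<close>

definition simplex_weights :: "nat \<Rightarrow> (nat \<Rightarrow> real) set" where
  "simplex_weights n = {p. (\<forall>i. 0 \<le> p i) \<and> (\<forall>i\<ge>n. p i = 0) \<and> (\<Sum>i<n. p i) = 1}"

lemma continuous_on_coordinate: "continuous_on S (\<lambda>p::nat \<Rightarrow> real. p i)"
  by (rule continuous_on_subset[OF continuous_on_product_coordinates]) simp

lemma compact_simplex_weights: "compact (simplex_weights n)"
proof -
  have le1: "p i \<le> 1" if "p \<in> simplex_weights n" for p i
  proof (cases "i < n")
    case True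
    then have "p i \<le> (\<Sum>i<n. p i)"
      using that by (intro member_le_sum) (auto simp: simplex_weights_def)
    then show ?thesis
      using that by (simp add: simplex_weights_def)
  qed (use that in \<open>auto simp: simplex_weights_def\<close>)
  have "compactin (product_topology (\<lambda>i. euclidean) UNIV) (PiE UNIV (\<lambda>i. if i < n then {0..1} else {0::real}))"
    by (simp add: compactin_PiE)
  then have cube: "compact (PiE UNIV (\<lambda>i. if i < n then {0..1} else {0::real}))"
    by (simp add: euclidean_product_topology)
  have "continuous_on UNIV (\<lambda>p::nat \<Rightarrow> real. \<Sum>i<n. p i)"
    by (intro continuous_intros continuous_on_coordinate)
  then have "closed {p::nat \<Rightarrow> real. (\<Sum>i<n. p i) = 1}"
    by (intro closed_Collect_eq) auto
  then have "compact (PiE UNIV (\<lambda>i. if i < n then {0..1} else {0::real}) \<inter> {p. (\<Sum>i<n. p i) = 1})"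
    using cube by (rule compact_Int_closed[rotated])
  also have "PiE UNIV (\<lambda>i. if i < n then {0..1} else {0::real}) \<inter> {p. (\<Sum>i<n. p i) = 1} = simplex_weights n"
  proof (intro equalityI subsetI)
    fix p assume p: "p \<in> PiE UNIV (\<lambda>i. if i < n then {0..1} else {0::real}) \<inter> {p. (\<Sum>i<n. p i) = 1}"
    then have "p i \<in> (if i < n then {0..1} else {0})" for i
      by (auto simp: PiE_iff)
    then have "0 \<le> p i" "i \<ge> n \<Longrightarrow> p i = 0" for i
      by (metis atLeastAtMost_iff order_refl singletonD, metis not_less singletonD)
    then show "p \<in> simplex_weights n"
      using p by (simp add: simplex_weights_def)
  next
    fix p assume "p \<in> simplex_weights n"
    then show "p \<in> PiE UNIV (\<lambda>i. if i < n then {0..1} else {0::real}) \<inter> {p. (\<Sum>i<n. p i) = 1}"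
      using le1[of p] by (auto simp: PiE_iff simplex_weights_def)
  qed
  finally show ?thesis .
qed

lemma qform_maximizer:
  assumes "0 < n"
  obtains p where "p \<in> simplex_weights n" "\<And>r. r \<in> simplex_weights n \<Longrightarrow> qform a n r \<le> qform a n p"
proof -
  have "(\<lambda>i. if i = 0 then 1 else 0) \<in> simplex_weights n"
    using assms by (auto simp: simplex_weights_def)
  moreover have "continuous_on (simplex_weights n) (qform a n)"
    unfolding qform_def by (intro continuous_intros continuous_on_coordinate) auto
  ultimately show thesis
    using continuous_attains_sup[OF compact_simplex_weights, of n "qform a n"] that by blast
qed

text \<open>Karush-Kuhn-Tucker conditions: move mass from \<open>i\<close> to \<open>k\<close>.\<close>

lemma qform_maximizer_conditions:
  assumes p: "p \<in> simplex_weights n" and max: "\<And>r. r \<in> simplex_weights n \<Longrightarrow> qform a n r \<le> qform a n p"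
    and k: "k < n"
  shows "(\<Sum>j<n. p j * \<bar>wedge (a k) (a j)\<bar>) \<le> 2 * qform a n p"
    and "0 < p k \<Longrightarrow> (\<Sum>j<n. p j * \<bar>wedge (a k) (a j)\<bar>) = 2 * qform a n p"
proof -
  define M where "M i = (\<Sum>j<n. p j * \<bar>wedge (a i) (a j)\<bar>)" for i
  have q2: "2 * qform a n p = (\<Sum>i<n. \<Sum>j<n. p i * p j * \<bar>wedge (a i) (a j)\<bar>)"
    by (simp add: qform_def)
  then have q: "2 * qform a n p = (\<Sum>i<n. p i * M i)"
    by (simp add: M_def sum_distrib_left mult.assoc)
  have key: "M l \<le> M i" if i: "i < n" "0 < p i" and l: "l < n" for i l
  proof (rule ccontr)
    assume "\<not> M l \<le> M i"
    then have gt: "0 < M l - M i" and "i \<noteq> l"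
      by auto
    define A where "A = \<bar>wedge (a i) (a l)\<bar>"
    \<comment> \<open>The move changes 2q by 2t (M l - M i) - 2 t^2 A. The first bound on
      \<open>t\<close> keeps the weight of \<open>i\<close> nonnegative; the second keeps the
      quadratic loss below the linear gain.\<close>
    define t where "t = min (p i) ((M l - M i) / (1 + A))"
    have A: "0 \<le> A"
      by (simp add: A_def)
    have t: "0 < t" "t \<le> p i"
      using gt i A by (auto simp: t_def)
    have tA: "t * A < M l - M i"
    proof -
      have "t * (1 + A) \<le> M l - M i"
        using A by (simp add: t_def min_le_iff_disj pos_le_divide_eq[symmetric])
      then show ?thesis
        using t by (simp add: algebra_simps)
    qed
    define e where "e j = (if j = l then t else 0) - (if j = i then t else 0)" for j
    define r where "r j = p j + e j" for j
    have e_sum: "(\<Sum>j<n. e j * f j) = t * f l - t * f i" for f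
      using i l by (simp add: e_def left_diff_distrib sum_subtractf if_distrib[where f="\<lambda>x. x * _"] cong: if_cong)
    have "r \<in> simplex_weights n"
    proof -
      have "(\<Sum>j<n. r j) = 1"
        using e_sum[of "\<lambda>_. 1"] p by (simp add: r_def sum.distrib simplex_weights_def)
      moreover have "0 \<le> r j" for j
        using p t \<open>i \<noteq> l\<close> by (auto simp: r_def e_def simplex_weights_def add_nonneg_nonneg)
      ultimately show ?thesis
        using p i l by (auto simp: simplex_weights_def r_def e_def)
    qed
    then have le: "qform a n r \<le> qform a n p"
      by (rule max)
    have "2 * qform a n r = (\<Sum>x<n. \<Sum>y<n. (p x * p y + p x * e y + e x * p y + e x * e y) * \<bar>wedge (a x) (a y)\<bar>)"
      by (simp add: qform_def r_def algebra_simps)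
    also have "\<dots> = 2 * qform a n p + (\<Sum>x<n. \<Sum>y<n. p x * e y * \<bar>wedge (a x) (a y)\<bar>)
        + (\<Sum>x<n. e x * M x) + (\<Sum>x<n. e x * (\<Sum>y<n. e y * \<bar>wedge (a x) (a y)\<bar>))"
      by (simp add: q2 M_def sum.distrib ring_distribs sum_distrib_left mult.assoc)
    also have "(\<Sum>x<n. \<Sum>y<n. p x * e y * \<bar>wedge (a x) (a y)\<bar>) = (\<Sum>y<n. \<Sum>x<n. p x * e y * \<bar>wedge (a x) (a y)\<bar>)"
      by (rule sum.swap)
    also have "\<dots> = (\<Sum>y<n. e y * M y)"
      unfolding M_def sum_distrib_left
      by (intro sum.cong refl) (metis (no_types, lifting) wedge_commute abs_minus_cancel mult.assoc mult.left_commute)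
    also have "(\<Sum>y<n. e y * M y) = t * (M l - M i)"
      by (simp only: e_sum) (simp add: algebra_simps)
    also have "(\<Sum>x<n. e x * (\<Sum>y<n. e y * \<bar>wedge (a x) (a y)\<bar>)) = - 2 * t * t * A"
      using wedge_commute[of "a l" "a i"] by (simp only: e_sum) (simp add: A_def algebra_simps)
    finally have "0 \<ge> 2 * t * ((M l - M i) - t * A)"
      using le by (simp add: algebra_simps)
    then show False
      using t tA by (simp add: mult_le_0_iff)
  qed
  have one: "(\<Sum>i<n. p i) = 1" and nn: "\<And>i. 0 \<le> p i"
    using p by (auto simp: simplex_weights_def)
  \<comment> \<open>By \<open>key\<close> in both directions \<open>M\<close> is constant on the
    support of \<open>p\<close>; the constant is the \<open>p\<close>-average of \<open>M\<close>,
    which is 2q.\<close>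
  have const: "M i = 2 * qform a n p" if "i < n" "0 < p i" for i
  proof -
    have "(\<Sum>j<n. p j * M j) = (\<Sum>j<n. p j * M i)"
    proof (intro sum.cong refl)
      fix j assume "j \<in> {..<n}"
      then show "p j * M j = p j * M i"
        using key[of i j] key[of j i] that nn[of j] by (cases "p j = 0") auto
    qed
    then show ?thesis
      using one by (simp add: q sum_distrib_right[symmetric])
  qed
  then show "0 < p k \<Longrightarrow> (\<Sum>j<n. p j * \<bar>wedge (a k) (a j)\<bar>) = 2 * qform a n p"
    using k by (simp add: M_def)
  obtain i where i: "i < n" "0 < p i"
  proof -
    have "\<exists>i<n. p i \<noteq> 0"
      using one by (metis (no_types, lifting) lessThan_iff sum.neutral zero_neq_one)
    then show thesis
      using that nn by (metis order_le_less)
  qed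
  show "(\<Sum>j<n. p j * \<bar>wedge (a k) (a j)\<bar>) \<le> 2 * qform a n p"
    using key[OF i k] const[OF i] by (simp add: M_def)
qed

lemma measure_lebesgue_scale:
  fixes S :: "(real^2) set"
  assumes "S \<in> lmeasurable"
  shows "(\<lambda>x. c *\<^sub>R x) ` S \<in> lmeasurable" "measure lebesgue ((\<lambda>x. c *\<^sub>R x) ` S) = c\<^sup>2 * measure lebesgue S"
proof -
  have lin: "linear (\<lambda>x::real^2. c *\<^sub>R x)"
    by (simp add: linear_scaleR_left linear_iff algebra_simps)
  have "det (matrix (\<lambda>x::real^2. c *\<^sub>R x)) = c * c"
    by (simp add: det_2 matrix_def axis_def)
  then show "measure lebesgue ((\<lambda>x. c *\<^sub>R x) ` S) = c\<^sup>2 * measure lebesgue S"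
    using measure_linear_image[OF lin assms] by (simp add: power2_eq_square abs_mult)
  show "(\<lambda>x. c *\<^sub>R x) ` S \<in> lmeasurable"
    using measurable_linear_image[OF lin assms] .
qed

lemma sum_wedge_weighted:
  assumes "\<And>i. 0 \<le> p i"
  shows "(\<Sum>j<n. \<bar>wedge x (p j *\<^sub>R a j)\<bar>) = (\<Sum>j<n. p j * \<bar>wedge x (a j)\<bar>)"
  using assms by (simp add: abs_mult)

lemma measure_zonogon_weighted:
  assumes "\<And>i. 0 \<le> p i"
  shows "measure lebesgue (zonogon (\<lambda>i. p i *\<^sub>R a i) n) = qform a n p"
  using assms by (simp add: measure_zonogon qform_def abs_mult mult.assoc mult.left_commute)

text \<open>It suffices to treat a maximizer \<open>p\<close>, with maximum Q. The equality part of
  the Karush-Kuhn-Tucker conditions puts K scaled by Q inside the strips that cut out the zonogon of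
  the vectors p_i a_i, so Q^2 |K| is at most its area Q.\<close>

theorem qform_measure_le_1:
  assumes r: "r \<in> simplex_weights n"
    and K: "K \<in> lmeasurable" "\<And>x i. x \<in> K \<Longrightarrow> i < n \<Longrightarrow> \<bar>wedge (a i) x\<bar> \<le> 1"
  shows "qform a n r * measure lebesgue K \<le> 1"
proof -
  have "0 < n"
    using r by (cases n) (auto simp: simplex_weights_def)
  then obtain p where p: "p \<in> simplex_weights n" and max: "\<And>r. r \<in> simplex_weights n \<Longrightarrow> qform a n r \<le> qform a n p"
    using qform_maximizer by blast
  define Q where "Q = qform a n p"
  have nn: "\<And>i. 0 \<le> p i"
    using p by (auto simp: simplex_weights_def)
  have "Q * measure lebesgue K \<le> 1"
  proof (cases "Q \<le> 0")
    case True
    then show ?thesis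
      using measure_nonneg[of lebesgue K] by (smt (verit) mult_nonneg_nonneg mult_nonpos_nonneg)
  next
    case False
    have nonpar: "\<exists>i<n. \<exists>j<n. wedge (p i *\<^sub>R a i) (p j *\<^sub>R a j) \<noteq> 0"
    proof (rule ccontr)
      assume "\<not> ?thesis"
      then have "p i * p j * \<bar>wedge (a i) (a j)\<bar> = 0" if "i < n" "j < n" for i j
        using that by simp metis
      then have "Q = 0"
        unfolding Q_def qform_def by (simp add: sum.neutral)
      then show False
        using False by simp
    qed
    have "(\<lambda>x. Q *\<^sub>R x) ` K \<subseteq> zonogon (\<lambda>i. p i *\<^sub>R a i) n"
    proof (intro subsetI)
      fix y assume "y \<in> (\<lambda>x. Q *\<^sub>R x) ` K"
      then obtain x where x: "x \<in> K" "y = Q *\<^sub>R x"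
        by auto
      show "y \<in> zonogon (\<lambda>i. p i *\<^sub>R a i) n"
      proof -
        obtain i0 j0 where "i0 < n" "j0 < n" "wedge (p i0 *\<^sub>R a i0) (p j0 *\<^sub>R a j0) \<noteq> 0"
          using nonpar by auto
        moreover have "\<bar>wedge (p i *\<^sub>R a i) y\<bar> \<le> (\<Sum>j<n. \<bar>wedge (p i *\<^sub>R a i) (p j *\<^sub>R a j)\<bar>) / 2" if "i < n" for i
        \<comment> \<open>A generator of weight zero vanishes and imposes no condition, so equality
          on the support of \<open>p\<close> is enough.\<close>
        proof (cases "p i = 0")
          case pi: False
          then have pos: "0 < p i"
            using nn[of i] by simp
          have "\<bar>wedge (p i *\<^sub>R a i) y\<bar> = p i * Q * \<bar>wedge (a i) x\<bar>"
            using False pos by (simp add: x abs_mult)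
          also have "\<dots> \<le> p i * Q"
            using K(2)[OF x(1) that] False pos by (simp add: mult_left_le)
          also have "\<dots> = (\<Sum>j<n. \<bar>wedge (p i *\<^sub>R a i) (p j *\<^sub>R a j)\<bar>) / 2"
          proof -
            have "(\<Sum>j<n. p j * \<bar>wedge (p i *\<^sub>R a i) (a j)\<bar>) = p i * (\<Sum>j<n. p j * \<bar>wedge (a i) (a j)\<bar>)"
              using pos by (simp add: sum_distrib_left abs_mult mult.left_commute)
            then show ?thesis
              unfolding sum_wedge_weighted[OF nn] using qform_maximizer_conditions(2)[OF p max that pos]
              by (simp add: Q_def)
          qed
          finally show ?thesis .
        qed simp
        ultimately show ?thesis
          by (rule halfplanes_subset_zonogon[where w = "\<lambda>i. p i *\<^sub>R a i"])
      qed
    qed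
    then have "measure lebesgue ((\<lambda>x. Q *\<^sub>R x) ` K) \<le> measure lebesgue (zonogon (\<lambda>i. p i *\<^sub>R a i) n)"
      using measure_lebesgue_scale(1)[OF K(1)] lmeasurable_compact[OF compact_zonogon]
      by (intro measure_mono_fmeasurable) (auto simp: fmeasurableD)
    then have "Q * (Q * measure lebesgue K) \<le> Q * 1"
      using measure_lebesgue_scale(2)[OF K(1), of Q] measure_zonogon_weighted[OF nn, where a = a and n = n]
      by (simp add: Q_def power2_eq_square mult.assoc)
    then show ?thesis
      using False by (simp add: mult_le_cancel_left)
  qed
  moreover have "qform a n r * measure lebesgue K \<le> Q * measure lebesgue K"
    using max[OF r] by (intro mult_right_mono) (auto simp: Q_def)
  ultimately show ?thesis
    by linarith
qed

text \<open>The inequality part of the Karush-Kuhn-Tucker conditions bounds the support function of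
  the zonogon by Q in every rotated direction a_i, so the zonogon, of area Q, lies in the polygon
  scaled by Q.\<close>

theorem exists_qform_measure_ge_1:
  assumes nonpar: "i0 < n" "j0 < n" "wedge (a i0) (a j0) \<noteq> 0"
    and P_eq: "P = {x. \<forall>i<n. \<bar>wedge (a i) x\<bar> \<le> 1}" and P: "P \<in> lmeasurable"
  obtains p where "p \<in> simplex_weights n" "1 \<le> qform a n p * measure lebesgue P"
proof -
  have "0 < n"
    using nonpar by simp
  then obtain p where p: "p \<in> simplex_weights n" and max: "\<And>r. r \<in> simplex_weights n \<Longrightarrow> qform a n r \<le> qform a n p"
    using qform_maximizer by blast
  define Q where "Q = qform a n p"
  have nn: "\<And>i. 0 \<le> p i"
    using p by (auto simp: simplex_weights_def)
  have "0 < Q"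
  proof -
    \<comment> \<open>Half of the mass on each of two nonparallel functionals shows that the maximum
      is positive, so that a factor Q can be cancelled.\<close>
    define r where "r i = (if i = i0 then 1/2 else 0) + (if i = j0 then 1/2 else 0 :: real)" for i
    have "i0 \<noteq> j0"
      using nonpar by auto
    have "r \<in> simplex_weights n"
      using nonpar by (auto simp: simplex_weights_def r_def sum.distrib)
    moreover have "0 < qform a n r"
    proof -
      have r0: "0 \<le> r i" for i
        by (simp add: r_def)
      have "0 < r i0 * r j0 * \<bar>wedge (a i0) (a j0)\<bar>"
        using nonpar by (simp add: r_def)
      also have "\<dots> \<le> (\<Sum>j<n. r i0 * r j * \<bar>wedge (a i0) (a j)\<bar>)"
        using nonpar r0 by (intro member_le_sum[of j0]) auto
      also have "\<dots> \<le> (\<Sum>i<n. \<Sum>j<n. r i * r j * \<bar>wedge (a i) (a j)\<bar>)"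
        using nonpar r0 by (intro member_le_sum[of i0]) (auto intro!: sum_nonneg)
      finally show ?thesis
        by (simp add: qform_def)
    qed
    ultimately show ?thesis
      using max unfolding Q_def by fastforce
  qed
  have "zonogon (\<lambda>i. p i *\<^sub>R a i) n \<subseteq> (\<lambda>x. Q *\<^sub>R x) ` P"
  proof (intro subsetI)
    fix y assume y: "y \<in> zonogon (\<lambda>i. p i *\<^sub>R a i) n"
    have "\<bar>wedge (a i) ((1 / Q) *\<^sub>R y)\<bar> \<le> 1" if i: "i < n" for i
    proof -
      have "wedge (a i) y \<in> wedge (a i) ` zonogon (\<lambda>i. p i *\<^sub>R a i) n"
        using y by blast
      then have "\<bar>wedge (a i) y\<bar> \<le> (\<Sum>j<n. p j * \<bar>wedge (a i) (a j)\<bar>) / 2"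
        unfolding wedge_image_zonogon sum_wedge_weighted[OF nn] by (auto simp: abs_le_iff)
      also have "\<dots> \<le> Q"
        using qform_maximizer_conditions(1)[OF p max i] by (simp add: Q_def)
      finally show ?thesis
        using \<open>0 < Q\<close> by (simp add: abs_mult)
    qed
    moreover have "y = Q *\<^sub>R ((1 / Q) *\<^sub>R y)"
      using \<open>0 < Q\<close> by simp
    ultimately show "y \<in> (\<lambda>x. Q *\<^sub>R x) ` P"
      unfolding P_eq by blast
  qed
  then have "measure lebesgue (zonogon (\<lambda>i. p i *\<^sub>R a i) n) \<le> measure lebesgue ((\<lambda>x. Q *\<^sub>R x) ` P)"
    using measure_lebesgue_scale(1)[OF P] lmeasurable_compact[OF compact_zonogon]
    by (intro measure_mono_fmeasurable) (auto simp: fmeasurableD)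
  then have "Q * 1 \<le> Q * (Q * measure lebesgue P)"
    using measure_lebesgue_scale(2)[OF P, of Q] measure_zonogon_weighted[OF nn, where a = a and n = n]
    by (simp add: Q_def power2_eq_square mult.assoc)
  then have "1 \<le> Q * measure lebesgue P"
    using \<open>0 < Q\<close> by (simp only: mult_le_cancel_left_pos)
  then show thesis
    using that p by (simp add: Q_def)
qed

section \<open>Periodic Finsler metrics on the plane\<close>

text \<open>The torus is replaced by a periodic metric on the plane. Its compactness survives in the
  constants \<open>m\<close> and \<open>M\<close>, which compare all the norms with the Euclidean
  one.\<close>

locale finsler_plane =
  fixes G :: "real^2 \<Rightarrow> real^2 \<Rightarrow> real" and m M :: real
  assumes continuous: "continuous_on UNIV (\<lambda>(x, v). G x v)"
    and periodic: "z \<in> int_lattice \<Longrightarrow> G (x + z) v = G x v"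
    and asym_norm: "asym_norm (G x)"
    and reversible: "G x (- v) = G x v"
    and m_pos: "0 < m" and M_pos: "0 < M"
    and lower: "m * norm v \<le> G x v"
    and upper: "G x v \<le> M * norm v"

section \<open>Reduction to a fundamental square\<close>

lemma int_lattice_closed:
  "0 \<in> int_lattice" "y \<in> int_lattice \<Longrightarrow> z \<in> int_lattice \<Longrightarrow> y + z \<in> int_lattice"
  "z \<in> int_lattice \<Longrightarrow> - z \<in> int_lattice"
  by (auto simp: int_lattice_def)

lemma int_lattice_axis: "axis i 1 \<in> int_lattice"
  by (auto simp: int_lattice_def axis_def)

definition floor_vec :: "real^2 \<Rightarrow> real^2" where
  "floor_vec x = (\<chi> i. of_int \<lfloor>x $ i\<rfloor>)"

lemma floor_vec_lattice: "floor_vec x \<in> int_lattice"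
  by (simp add: floor_vec_def int_lattice_def)

lemma mem_cbox_01: "x \<in> cbox 0 (1::real^2) \<longleftrightarrow> (\<forall>i. 0 \<le> x $ i \<and> x $ i \<le> 1)"
  by (simp add: mem_box_cart)

lemma frac_vec_cbox: "x - floor_vec x \<in> cbox 0 1"
  using real_of_int_floor_add_one_ge by (simp add: mem_cbox_01 floor_vec_def diff_le_eq add.commute)

lemma norm_le_cbox: "x \<in> cbox 0 1 \<Longrightarrow> norm (x :: real^2) \<le> 2"
proof -
  assume x: "x \<in> cbox 0 1"
  have "norm x \<le> (\<Sum>i\<in>UNIV. \<bar>x $ i\<bar>)"
    by (rule norm_le_l1_cart)
  also have "\<dots> \<le> 2"
    using x by (auto simp: mem_cbox_01 sum_2 intro: order_trans[OF add_mono[of _ 1 _ 1]])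
  finally show ?thesis .
qed

lemma continuous_on_torus_proj: "continuous_on UNIV torus_proj"
  by (simp add: continuous_on_open_vimage open_torus_def)

lemma torus_proj_add_lattice: "z \<in> int_lattice \<Longrightarrow> torus_proj (x + z) = torus_proj x"
  by (simp add: torus_proj_eq_iff)

lemma continuous_on_lift_metric:
  assumes "finsler_metric F"
  shows "continuous_on UNIV (\<lambda>(x, v). lift_metric F x v)"
proof -
  have proj: "continuous_on UNIV (\<lambda>(x, v :: real^2). (torus_proj x, v))"
    unfolding case_prod_beta
    by (intro continuous_on_Pair continuous_on_compose2[OF continuous_on_torus_proj] continuous_intros) auto
  have "continuous_on UNIV (\<lambda>(p, v). F p v)"
    using assms by (simp add: finsler_metric_def)
  from continuous_on_compose2[OF this proj] show ?thesis
    by (simp add: lift_metric_def case_prod_beta)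
qed

lemma asym_norm_zero: "asym_norm N \<Longrightarrow> N 0 = 0"
  unfolding asym_norm_def by (metis mult_zero_left order_refl scaleR_zero_left)

text \<open>The constants are the extrema of the metric on the unit square times the unit circle:
  periodicity moves any point into the square, homogeneity any nonzero vector to the circle.\<close>

lemma finsler_plane_lift_metric:
  assumes F: "finsler_metric F" and rev: "reversible F"
  obtains m M where "finsler_plane (lift_metric F) m M"
proof -
  let ?G = "lift_metric F"
  let ?K = "cbox (0::real^2) 1 \<times> sphere (0::real^2) 1"
  have cont: "continuous_on ?K (\<lambda>(x, v). ?G x v)"
    by (rule continuous_on_subset[OF continuous_on_lift_metric[OF F]]) simp
  have compact: "compact ?K"
    by (intro compact_Times compact_cbox compact_sphere)
  have norm: "asym_norm (?G x)" for x
  proof -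
    have "?G x = F (torus_proj x)"
      by (simp add: lift_metric_def fun_eq_iff)
    then show ?thesis
      using F by (simp add: finsler_metric_def)
  qed
  have hom: "?G x (c *\<^sub>R v) = c * ?G x v" if "0 \<le> c" for x c v
    using norm that by (simp add: asym_norm_def)
  have per: "?G (x + z) v = ?G x v" if "z \<in> int_lattice" for x z v
    using that by (simp add: lift_metric_def torus_proj_add_lattice)
  have "(0, axis 1 1) \<in> ?K"
    by (simp add: mem_cbox_01)
  then have ne: "?K \<noteq> {}"
    by blast
  obtain p where p: "p \<in> ?K" "\<And>q. q \<in> ?K \<Longrightarrow> (\<lambda>(x, v). ?G x v) p \<le> (\<lambda>(x, v). ?G x v) q"
    using continuous_attains_inf[OF compact ne cont] by blast
  obtain p' where p': "p' \<in> ?K" "\<And>q. q \<in> ?K \<Longrightarrow> (\<lambda>(x, v). ?G x v) q \<le> (\<lambda>(x, v). ?G x v) p'"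
    using continuous_attains_sup[OF compact ne cont] by blast
  define m where "m = (\<lambda>(x, v). ?G x v) p"
  define M where "M = (\<lambda>(x, v). ?G x v) p'"
  have "0 < m"
  proof -
    obtain x v where xv: "p = (x, v)"
      by fastforce
    then have "v \<noteq> 0"
      using p(1) by auto
    then show ?thesis
      using norm[of x] by (simp add: m_def xv asym_norm_def)
  qed
  moreover have "m \<le> M"
    using p(2)[OF p'(1)] by (simp add: m_def M_def)
  moreover have bounds: "m * norm v \<le> ?G x v \<and> ?G x v \<le> M * norm v" for x v
  proof (cases "v = 0")
    case False
    let ?u = "(1 / norm v) *\<^sub>R v"
    have "?G x v = ?G (x - floor_vec x) v"
      using per[OF floor_vec_lattice[of x], of "x - floor_vec x" v] by simp
    also have "v = norm v *\<^sub>R ?u"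
      using False by simp
    also have "?G (x - floor_vec x) (norm v *\<^sub>R ?u) = norm v * ?G (x - floor_vec x) ?u"
      by (rule hom) simp
    finally have eq: "?G x v = norm v * ?G (x - floor_vec x) ?u"
      using False by simp
    have "(x - floor_vec x, ?u) \<in> ?K"
      using False frac_vec_cbox[of x] by simp
    then have "m \<le> ?G (x - floor_vec x) ?u" "?G (x - floor_vec x) ?u \<le> M"
      using p(2) p'(2) by (auto simp: m_def M_def)
    then show ?thesis
      unfolding eq by (metis mult.commute mult_left_mono norm_ge_zero)
  qed (use norm in \<open>simp add: asym_norm_zero\<close>)
  ultimately have "finsler_plane ?G m M"
    using continuous_on_lift_metric[OF F] per norm rev
    by unfold_locales (auto simp: reversible_def lift_metric_def)
  then show thesis
    by (rule that)
qed

context finsler_plane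
begin

lemma homogeneous: "0 \<le> c \<Longrightarrow> G x (c *\<^sub>R v) = c * G x v"
  using asym_norm[of x] by (simp add: asym_norm_def)

lemma homogeneous_abs: "G x (c *\<^sub>R v) = \<bar>c\<bar> * G x v"
  using homogeneous[of c x v] homogeneous[of "- c" x v] reversible[of x "(- c) *\<^sub>R v"]
  by (cases "0 \<le> c") auto

lemma continuous_on_G [continuous_intros]:
  assumes "continuous_on S f" "continuous_on S g"
  shows "continuous_on S (\<lambda>t. G (f t) (g t))"
  using continuous_on_compose2[OF continuous continuous_on_Pair[OF assms]] by auto

text \<open>The modulus of continuity is multiplicative: on unit vectors the metric is at least
  \<open>m\<close>, so an additive error \<eta> m is a relative error \<eta>, which homogeneity
  carries to all vectors.\<close>

lemma uniformly_close:
  assumes "0 < \<eta>"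
  obtains \<rho> where "0 < \<rho>" "\<And>x y v. dist x y < \<rho> \<Longrightarrow> G y v \<le> (1 + \<eta>) * G x v"
proof -
  \<comment> \<open>Both points are translated by the lattice vector that brings \<open>x\<close>
    into the unit square; \<open>y\<close>, at distance at most 1 from \<open>x\<close>, then lies
    in this larger box.\<close>
  let ?K = "cbox (-1) (2::real^2) \<times> sphere (0::real^2) 1"
  have "compact ?K"
    by (intro compact_Times compact_cbox compact_sphere)
  moreover have "continuous_on ?K (\<lambda>(x, v). G x v)"
    by (rule continuous_on_subset[OF continuous]) simp
  ultimately have "uniformly_continuous_on ?K (\<lambda>(x, v). G x v)"
    by (intro compact_uniformly_continuous)
  then obtain d where d: "0 < d" "\<And>p q. p \<in> ?K \<Longrightarrow> q \<in> ?K \<Longrightarrow> dist q p < d \<Longrightarrow>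
      dist ((\<lambda>(x, v). G x v) q) ((\<lambda>(x, v). G x v) p) < \<eta> * m"
    using assms m_pos unfolding uniformly_continuous_on_def by (metis mult_pos_pos)
  have "G y v \<le> (1 + \<eta>) * G x v" if "dist x y < min d 1" for x y v
  proof (cases "v = 0")
    case False
    let ?u = "(1 / norm v) *\<^sub>R v" and ?x = "x - floor_vec x" and ?y = "y - floor_vec x"
    have gx: "G x v = norm v * G ?x ?u" "G y v = norm v * G ?y ?u"
      using False periodic[OF floor_vec_lattice[of x], of ?x v] periodic[OF floor_vec_lattice[of x], of ?y v]
        homogeneous[of "norm v" ?x ?u] homogeneous[of "norm v" ?y ?u] by auto
    have frac: "0 \<le> ?x $ i \<and> ?x $ i \<le> 1" for i
      using frac_vec_cbox[of x] mem_cbox_01 by blast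
    have "-1 \<le> ?x $ i \<and> ?x $ i \<le> 2" for i
      using frac[of i] by linarith
    then have "(?x, ?u) \<in> ?K"
      using False by (simp add: mem_box_cart)
    moreover have "(?y, ?u) \<in> ?K"
    proof -
      have "\<bar>y $ i - x $ i\<bar> \<le> 1" for i
        using that component_le_norm_cart[of "y - x" i] by (simp add: dist_norm norm_minus_commute)
      then have "-1 \<le> ?y $ i \<and> ?y $ i \<le> 2" for i
        using frac[of i] by (simp add: abs_le_iff) (smt (verit))
      then show ?thesis
        using False by (simp add: mem_box_cart)
    qed
    moreover have "dist (?y, ?u) (?x, ?u) < d"
      using that by (simp add: dist_Pair_Pair dist_commute) (simp add: dist_norm)
    ultimately have "\<bar>G ?y ?u - G ?x ?u\<bar> < \<eta> * m"
      using d(2) by (fastforce simp: dist_real_def)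
    moreover have "\<eta> * m \<le> \<eta> * G ?x ?u"
      using lower[of ?u ?x] False assms by (intro mult_left_mono) auto
    ultimately have "G ?y ?u \<le> (1 + \<eta>) * G ?x ?u"
      by (simp add: algebra_simps)
    then show ?thesis
      unfolding gx mult.left_commute[of "1 + \<eta>"] by (rule mult_left_mono) simp
  qed (use asym_norm in \<open>simp add: asym_norm_zero\<close>)
  then show thesis
    using d(1) by (intro that[of "min d 1"]) auto
qed

section \<open>Unit balls and the integrand of the area\<close>

definition unit_ball :: "real^2 \<Rightarrow> (real^2) set" where
  "unit_ball x = {v. G x v \<le> 1}"

lemma compact_unit_ball: "compact (unit_ball x)"
proof -
  have "norm v \<le> 1 / m" if "v \<in> unit_ball x" for v
    using that lower[of v x] m_pos by (simp add: unit_ball_def field_simps)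
  then have "bounded (unit_ball x)"
    by (auto simp: bounded_iff)
  moreover have "closed (unit_ball x)"
    unfolding unit_ball_def by (intro closed_Collect_le continuous_intros)
  ultimately show ?thesis
    by (simp add: compact_eq_bounded_closed)
qed

lemma measure_unit_ball_bounds:
  "measure lebesgue (cball (0::real^2) (1 / M)) \<le> measure lebesgue (unit_ball x)"
  "measure lebesgue (unit_ball x) \<le> measure lebesgue (cball (0::real^2) (1 / m))"
proof -
  have "cball 0 (1 / M) \<subseteq> unit_ball x"
  proof
    fix v :: "real^2" assume "v \<in> cball 0 (1 / M)"
    then have "M * norm v \<le> 1"
      using M_pos by (simp add: field_simps)
    then show "v \<in> unit_ball x"
      using upper[of x v] by (simp add: unit_ball_def)
  qed
  then show "measure lebesgue (cball (0::real^2) (1 / M)) \<le> measure lebesgue (unit_ball x)"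
    by (intro measure_mono_fmeasurable lmeasurable_compact compact_unit_ball) auto
  have "unit_ball x \<subseteq> cball 0 (1 / m)"
  proof
    fix v assume "v \<in> unit_ball x"
    then show "v \<in> cball 0 (1 / m)"
      using lower[of v x] m_pos by (simp add: unit_ball_def field_simps)
  qed
  then show "measure lebesgue (unit_ball x) \<le> measure lebesgue (cball (0::real^2) (1 / m))"
    using compact_unit_ball by (intro measure_mono_fmeasurable lmeasurable_compact) (auto intro: lmeasurable_compact fmeasurableD)
qed

lemma measure_unit_ball_pos: "0 < measure lebesgue (unit_ball x)"
proof -
  have "0 < measure lebesgue (cball (0::real^2) (1 / M))"
    using content_cball_pos[of "1 / M" "0::real^2"] M_pos by (simp add: measure_completion)
  then show ?thesis
    using measure_unit_ball_bounds(1)[of x] by linarith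
qed

lemma measure_unit_ball_compare:
  assumes "0 < \<eta>" "\<And>v. G y v \<le> (1 + \<eta>) * G x v"
  shows "measure lebesgue (unit_ball x) \<le> (1 + \<eta>)\<^sup>2 * measure lebesgue (unit_ball y)"
proof -
  have "unit_ball x \<subseteq> (\<lambda>v. (1 + \<eta>) *\<^sub>R v) ` unit_ball y"
  proof
    fix v assume v: "v \<in> unit_ball x"
    have "G y ((1 / (1 + \<eta>)) *\<^sub>R v) = G y v / (1 + \<eta>)"
      using assms(1) by (subst homogeneous) auto
    also have "\<dots> \<le> G x v"
      using assms by (simp add: field_simps)
    also have "\<dots> \<le> 1"
      using v by (simp add: unit_ball_def)
    finally have "(1 / (1 + \<eta>)) *\<^sub>R v \<in> unit_ball y"
      by (simp add: unit_ball_def)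
    moreover have "v = (1 + \<eta>) *\<^sub>R ((1 / (1 + \<eta>)) *\<^sub>R v)"
      using assms by simp
    ultimately show "v \<in> (\<lambda>v. (1 + \<eta>) *\<^sub>R v) ` unit_ball y"
      by blast
  qed
  then have "measure lebesgue (unit_ball x) \<le> measure lebesgue ((\<lambda>v. (1 + \<eta>) *\<^sub>R v) ` unit_ball y)"
    using measure_lebesgue_scale(1)[OF lmeasurable_compact[OF compact_unit_ball]]
    by (intro measure_mono_fmeasurable) (auto intro: fmeasurableD lmeasurable_compact[OF compact_unit_ball])
  then show ?thesis
    by (simp add: measure_lebesgue_scale(2)[OF lmeasurable_compact[OF compact_unit_ball]])
qed

text \<open>The unit balls at two nearby points are contained in each other up to the factor 1 +
  \<eta>, so their areas agree up to (1 + \<eta>)^2.\<close>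

lemma continuous_on_measure_unit_ball: "continuous_on UNIV (\<lambda>x. measure lebesgue (unit_ball x))"
  unfolding continuous_on_iff
proof (intro ballI allI impI)
  fix x :: "real^2" and \<epsilon> :: real assume "0 < \<epsilon>"
  let ?V = "\<lambda>x. measure lebesgue (unit_ball x)"
  define B where "B = measure lebesgue (cball (0::real^2) (1 / m)) + 1"
  have B: "0 < B" "?V x \<le> B" for x
    using measure_unit_ball_bounds(2)[of x] measure_nonneg[of lebesgue "cball (0::real^2) (1 / m)"]
    unfolding B_def by linarith+
  \<comment> \<open>With \<eta> \<le> 1 the factor (1 + \<eta>)^2 is at most 1 + 3 \<eta>; the 4 in
    the denominator leaves room for a strict inequality.\<close>
  define \<eta> where "\<eta> = min 1 (\<epsilon> / (4 * B))"
  have \<eta>: "0 < \<eta>" "\<eta> \<le> 1" "3 * \<eta> * B < \<epsilon>"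
    using \<open>0 < \<epsilon>\<close> B by (auto simp: \<eta>_def min_def field_simps)
  obtain \<rho> where \<rho>: "0 < \<rho>" "\<And>x y v. dist x y < \<rho> \<Longrightarrow> G y v \<le> (1 + \<eta>) * G x v"
    using uniformly_close[OF \<eta>(1)] by blast
  have one: "?V x \<le> ?V y + 3 * \<eta> * B" if "dist x y < \<rho>" for x y
  proof -
    have "?V x \<le> (1 + \<eta>)\<^sup>2 * ?V y"
      using measure_unit_ball_compare[OF \<eta>(1)] \<rho>(2)[OF that] by blast
    also have "(1 + \<eta>)\<^sup>2 \<le> 1 + 3 * \<eta>"
      using \<eta> by (simp add: power2_eq_square algebra_simps mult_left_le)
    then have "(1 + \<eta>)\<^sup>2 * ?V y \<le> (1 + 3 * \<eta>) * ?V y"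
      by (intro mult_right_mono) auto
    also have "\<dots> = ?V y + 3 * \<eta> * ?V y"
      by (simp add: algebra_simps)
    also have "\<dots> \<le> ?V y + 3 * \<eta> * B"
      using \<eta> B by (intro add_left_mono mult_left_mono) auto
    finally show ?thesis .
  qed
  have "dist (?V y) (?V x) < \<epsilon>" if "dist y x < \<rho>" for y
    using one[of x y] one[of y x] that \<eta>(3) by (simp add: dist_real_def dist_commute abs_less_iff)
  then show "\<exists>d>0. \<forall>y\<in>UNIV. dist y x < d \<longrightarrow> dist (?V y) (?V x) < \<epsilon>"
    using \<rho>(1) by blast
qed

lemma integrable_inverse_measure_unit_ball:
  "(\<lambda>x. 1 / measure lebesgue (unit_ball x)) integrable_on cbox 0 1"
proof (rule integrable_continuous)
  show "continuous_on (cbox 0 1) (\<lambda>x. 1 / measure lebesgue (unit_ball x))"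
    using measure_unit_ball_pos by (intro continuous_intros continuous_on_subset[OF continuous_on_measure_unit_ball]) (auto simp: less_le)
qed

end

section \<open>The Finsler distance\<close>

text \<open>Shifts and reversals of the parameter are the cases \<sigma> = 1 and \<sigma> = -1. The
  k-th derivative picks up the factor \<sigma>^k, and the translation by \<open>z\<close> affects
  only the zeroth.\<close>

lemma smooth_on_interval_affine:
  assumes smooth: "smooth_on_interval \<gamma> p q"
    and maps: "\<And>t. t \<in> {p'..q'} \<Longrightarrow> \<sigma> * t + c \<in> {p..q}"
  shows "smooth_on_interval (\<lambda>t. \<gamma> (\<sigma> * t + c) + z) p' q'"
proof -
  obtain D where D0: "\<And>t. t \<in> {p..q} \<Longrightarrow> D (0::nat) t = \<gamma> t"
    and D: "\<And>k t. t \<in> {p..q} \<Longrightarrow> (D k has_vector_derivative D (Suc k) t) (at t within {p..q})"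
    using smooth unfolding smooth_on_interval_def by blast
  define E where "E k t = \<sigma> ^ k *\<^sub>R D k (\<sigma> * t + c) + (if k = 0 then z else 0)" for k t
  have "(E k has_vector_derivative E (Suc k) t) (at t within {p'..q'})" if t: "t \<in> {p'..q'}" for k t
  proof -
    have lin: "((\<lambda>t. \<sigma> * t + c) has_vector_derivative \<sigma>) (at t within {p'..q'})"
      by (auto intro!: derivative_eq_intros)
    have "(D k has_vector_derivative D (Suc k) (\<sigma> * t + c)) (at (\<sigma> * t + c) within (\<lambda>t. \<sigma> * t + c) ` {p'..q'})"
      using D[OF maps[OF t]] by (rule has_vector_derivative_within_subset) (use maps in auto)
    from vector_diff_chain_within[OF lin this]
    have "((\<lambda>t. D k (\<sigma> * t + c)) has_vector_derivative \<sigma> *\<^sub>R D (Suc k) (\<sigma> * t + c)) (at t within {p'..q'})"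
      by (simp add: o_def)
    from has_vector_derivative_add[OF bounded_linear.has_vector_derivative[OF bounded_linear_scaleR_right[of "\<sigma> ^ k"] this]
        has_vector_derivative_const[of "if k = 0 then z else 0"]]
    show ?thesis
      by (simp add: E_def[abs_def] mult.commute)
  qed
  moreover have "E 0 t = \<gamma> (\<sigma> * t + c) + z" if "t \<in> {p'..q'}" for t
    using D0[OF maps[OF that]] by (simp add: E_def)
  ultimately show ?thesis
    unfolding smooth_on_interval_def by blast
qed

lemma piecewise_smooth_shift:
  assumes "piecewise_smooth \<gamma> a b"
  shows "piecewise_smooth (\<lambda>t. \<gamma> (1 * t + c) + z) (a - c) (b - c)"
proof -
  obtain n \<tau> where \<tau>: "\<tau> (0::nat) = a" "\<tau> n = b" "\<And>i. i < n \<Longrightarrow> \<tau> i < \<tau> (Suc i)"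
    "\<And>i. i < n \<Longrightarrow> smooth_on_interval \<gamma> (\<tau> i) (\<tau> (Suc i))"
    using assms unfolding piecewise_smooth_def by blast
  show ?thesis
    unfolding piecewise_smooth_def
  proof (intro exI[of _ n] exI[of _ "\<lambda>i. \<tau> i - c"] conjI allI impI)
    fix i assume i: "i < n"
    show "smooth_on_interval (\<lambda>t. \<gamma> (1 * t + c) + z) (\<tau> i - c) (\<tau> (Suc i) - c)"
      by (rule smooth_on_interval_affine[OF \<tau>(4)[OF i]]) auto
  qed (use \<tau> in auto)
qed

lemma piecewise_smooth_reverse:
  assumes "piecewise_smooth \<gamma> a b"
  shows "piecewise_smooth (\<lambda>t. \<gamma> (- 1 * t + c) + z) (c - b) (c - a)"
proof -
  obtain n \<tau> where \<tau>: "\<tau> (0::nat) = a" "\<tau> n = b" "\<And>i. i < n \<Longrightarrow> \<tau> i < \<tau> (Suc i)"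
    "\<And>i. i < n \<Longrightarrow> smooth_on_interval \<gamma> (\<tau> i) (\<tau> (Suc i))"
    using assms unfolding piecewise_smooth_def by blast
  show ?thesis
    unfolding piecewise_smooth_def
  proof (intro exI[of _ n] exI[of _ "\<lambda>i. c - \<tau> (n - i)"] conjI allI impI)
    fix i assume i: "i < n"
    then have j: "n - Suc i < n" "Suc (n - Suc i) = n - i"
      by auto
    show "c - \<tau> (n - i) < c - \<tau> (n - Suc i)"
      using \<tau>(3)[OF j(1)] j by simp
    show "smooth_on_interval (\<lambda>t. \<gamma> (- 1 * t + c) + z) (c - \<tau> (n - i)) (c - \<tau> (n - Suc i))"
      by (rule smooth_on_interval_affine[OF \<tau>(4)[OF j(1)]]) (use j in auto)
  qed (use \<tau> in auto)
qed

lemma smooth_on_interval_cong: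
  assumes "smooth_on_interval \<gamma> p q" "\<And>t. t \<in> {p..q} \<Longrightarrow> \<gamma>' t = \<gamma> t"
  shows "smooth_on_interval \<gamma>' p q"
  using assms unfolding smooth_on_interval_def by metis

lemma mono_partition:
  fixes \<tau> :: "nat \<Rightarrow> real"
  assumes "\<And>i. i < n \<Longrightarrow> \<tau> i < \<tau> (Suc i)" "i \<le> j" "j \<le> n"
  shows "\<tau> i \<le> \<tau> j"
  using assms(2,3)
proof (induction j rule: dec_induct)
  case (step k)
  then show ?case
    using assms(1)[of k] by auto
qed simp

lemma piecewise_smooth_join:
  assumes "piecewise_smooth \<gamma>1 a b" "piecewise_smooth \<gamma>2 b c" and eq: "\<gamma>1 b = \<gamma>2 b"
  shows "piecewise_smooth (\<lambda>t. if t \<le> b then \<gamma>1 t else \<gamma>2 t) a c" (is "piecewise_smooth ?\<gamma> a c")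
proof -
  obtain n \<tau> where \<tau>: "\<tau> (0::nat) = a" "\<tau> n = b" "\<And>i. i < n \<Longrightarrow> \<tau> i < \<tau> (Suc i)"
    "\<And>i. i < n \<Longrightarrow> smooth_on_interval \<gamma>1 (\<tau> i) (\<tau> (Suc i))"
    using assms(1) unfolding piecewise_smooth_def by blast
  obtain k \<upsilon> where \<upsilon>: "\<upsilon> (0::nat) = b" "\<upsilon> k = c" "\<And>i. i < k \<Longrightarrow> \<upsilon> i < \<upsilon> (Suc i)"
    "\<And>i. i < k \<Longrightarrow> smooth_on_interval \<gamma>2 (\<upsilon> i) (\<upsilon> (Suc i))"
    using assms(2) unfolding piecewise_smooth_def by blast
  \<comment> \<open>At index \<open>n\<close> both partitions have the value \<open>b\<close>, so
    either branch may be used there.\<close>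
  define \<theta> where "\<theta> i = (if i \<le> n then \<tau> i else \<upsilon> (i - n))" for i
  have \<theta>: "\<theta> i = \<upsilon> (i - n)" if "n \<le> i" for i
    using that \<tau>(2) \<upsilon>(1) by (cases "i = n") (auto simp: \<theta>_def)
  show ?thesis
    unfolding piecewise_smooth_def
  proof (intro exI[of _ "n + k"] exI[of _ \<theta>] conjI allI impI)
    fix i assume i: "i < n + k"
    show "\<theta> i < \<theta> (Suc i)"
      using i \<tau>(3)[of i] \<upsilon>(3)[of "i - n"] by (cases "i < n") (auto simp: \<theta> Suc_diff_le, simp add: \<theta>_def)
    show "smooth_on_interval ?\<gamma> (\<theta> i) (\<theta> (Suc i))"
    proof (cases "i < n")
      case True
      have "\<theta> i = \<tau> i" "\<theta> (Suc i) = \<tau> (Suc i)"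
        using True by (auto simp: \<theta>_def)
      moreover have "smooth_on_interval ?\<gamma> (\<tau> i) (\<tau> (Suc i))"
      proof (rule smooth_on_interval_cong[OF \<tau>(4)[OF True]])
        fix t assume "t \<in> {\<tau> i..\<tau> (Suc i)}"
        then have "t \<le> b"
          using mono_partition[of n \<tau> "Suc i" n] \<tau> True by auto
        then show "?\<gamma> t = \<gamma>1 t"
          by simp
      qed
      ultimately show ?thesis
        by simp
    next
      case False
      then have j: "i - n < k" "\<theta> i = \<upsilon> (i - n)" "\<theta> (Suc i) = \<upsilon> (Suc (i - n))"
        using i by (auto simp: \<theta> Suc_diff_le)
      moreover have "smooth_on_interval ?\<gamma> (\<upsilon> (i - n)) (\<upsilon> (Suc (i - n)))"
      proof (rule smooth_on_interval_cong[OF \<upsilon>(4)[OF j(1)]])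
        fix t assume "t \<in> {\<upsilon> (i - n)..\<upsilon> (Suc (i - n))}"
        then have "b \<le> t"
          using mono_partition[of k \<upsilon> 0 "i - n"] \<upsilon> j by auto
        then show "?\<gamma> t = \<gamma>2 t"
          using eq by auto
      qed
      ultimately show ?thesis
        by simp
    qed
  qed (use \<tau> \<upsilon> in \<open>auto simp: \<theta>_def\<close>)
qed

lemma smooth_on_interval_line: "smooth_on_interval (\<lambda>t. x + t *\<^sub>R v) a b"
proof -
  define D where "D k t = (if k = 0 then x + t *\<^sub>R v else if k = 1 then v else 0)" for k :: nat and t :: real
  have "(D k has_vector_derivative D (Suc k) t) (at t within {a..b})" for k t
  proof (cases "k = 0")
    case True
    have "((\<lambda>t. x + t *\<^sub>R v) has_vector_derivative v) (at t within {a..b})"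
      by (auto intro!: derivative_eq_intros)
    then show ?thesis
      using True by (simp add: D_def[abs_def])
  next
    case False
    then show ?thesis
      by (cases "k = 1") (simp_all add: D_def[abs_def])
  qed
  then show ?thesis
    unfolding smooth_on_interval_def by (intro exI[of _ D]) (simp add: D_def)
qed

lemma piecewise_smooth_line: "a < b \<Longrightarrow> piecewise_smooth (\<lambda>t. x + t *\<^sub>R v) a b"
  unfolding piecewise_smooth_def
  by (intro exI[of _ 1] exI[of _ "\<lambda>i. if i = 0 then a else b"]) (simp add: smooth_on_interval_line)

section \<open>Lengths of curves\<close>

context finsler_plane
begin

text \<open>The two-sided derivative does not mention the interval, so integrals of the speed over
  adjacent intervals add up; the endpoints, where the one-sided derivative may differ, are
  negligible.\<close>

definition speed :: "(real \<Rightarrow> real^2) \<Rightarrow> real \<Rightarrow> real" where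
  "speed \<gamma> t = G (\<gamma> t) (vector_derivative \<gamma> (at t))"

lemma curve_length_speed: "curve_length G \<gamma> a b = integral {a..b} (speed \<gamma>)"
  unfolding curve_length_def
proof (rule integral_spike[of "{a, b}"])
  fix t assume "t \<in> {a..b} - {a, b}"
  then have "at t within {a..b} = at t"
    by (intro at_within_interior) auto
  then show "speed \<gamma> t = G (\<gamma> t) (vector_derivative \<gamma> (at t within {a..b}))"
    by (simp add: speed_def)
qed auto

text \<open>Derivatives that are continuous up to the endpoints make the speed integrable. The lower
  bound is the fundamental theorem of calculus followed by the norm inequality for
  integrals.\<close>

lemma smooth_speed:
  assumes smooth: "smooth_on_interval \<gamma> c d" and cd: "c < d"
  obtains L where "(speed \<gamma> has_integral L) {c..d}" "m * norm (\<gamma> d - \<gamma> c) \<le> L"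
    "\<And>t. t \<in> {c<..<d} \<Longrightarrow> \<gamma> differentiable (at t)"
proof -
  obtain D where D0: "\<And>t. t \<in> {c..d} \<Longrightarrow> D (0::nat) t = \<gamma> t"
    and D: "\<And>k t. t \<in> {c..d} \<Longrightarrow> (D k has_vector_derivative D (Suc k) t) (at t within {c..d})"
    using smooth unfolding smooth_on_interval_def by blast
  have contD: "continuous_on {c..d} (D k)" for k
    using D by (intro continuous_on_vector_derivative) blast
  have "continuous_on {c..d} \<gamma>"
    using continuous_on_cong[OF refl, of "{c..d}" "D 0" \<gamma>] contD[of 0] D0 by blast
  then have cont: "continuous_on {c..d} (\<lambda>t. G (\<gamma> t) (D 1 t))"
    by (intro continuous_intros contD)
  have deriv: "(\<gamma> has_vector_derivative D 1 t) (at t)" if t: "t \<in> {c<..<d}" for t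
  proof -
    have "(D 0 has_vector_derivative D 1 t) (at t within {c..d})"
      using D[of t 0] t by auto
    moreover have "at t within {c..d} = at t"
      using t by (intro at_within_interior) auto
    ultimately have "(D 0 has_vector_derivative D 1 t) (at t)"
      by simp
    then show ?thesis
      by (rule has_vector_derivative_transform_within_open[of _ _ _ "{c<..<d}"]) (use t D0 in auto)
  qed
  define L where "L = integral {c..d} (\<lambda>t. G (\<gamma> t) (D 1 t))"
  have int: "((\<lambda>t. G (\<gamma> t) (D 1 t)) has_integral L) {c..d}"
    unfolding L_def using integrable_continuous_real[OF cont] by (rule integrable_integral)
  have "(speed \<gamma> has_integral L) {c..d}"
  proof (rule has_integral_spike_finite[of "{c, d}", OF _ _ int])
    fix t assume "t \<in> {c..d} - {c, d}"
    then show "speed \<gamma> t = G (\<gamma> t) (D 1 t)"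
      using vector_derivative_at[OF deriv[of t]] by (simp add: speed_def)
  qed simp
  moreover have "m * norm (\<gamma> d - \<gamma> c) \<le> L"
  proof -
    have "(D 1 has_integral (D 0 d - D 0 c)) {c..d}"
      using D[of _ 0] cd by (intro fundamental_theorem_of_calculus) auto
    then have hi: "((\<lambda>t. m *\<^sub>R D 1 t) has_integral m *\<^sub>R (\<gamma> d - \<gamma> c)) {c..d}"
      using D0 cd by (intro has_integral_cmul) auto
    have "m *\<^sub>R (\<gamma> d - \<gamma> c) = integral {c..d} (\<lambda>t. m *\<^sub>R D 1 t)" "(\<lambda>t. m *\<^sub>R D 1 t) integrable_on {c..d}"
      by (fact integral_unique[OF hi, symmetric]) (fact has_integral_integrable[OF hi])
    moreover have "norm (integral {c..d} (\<lambda>t. m *\<^sub>R D 1 t)) \<le> L"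
      unfolding L_def using calculation(2) int lower m_pos
      by (intro integral_norm_bound_integral) (auto simp: has_integral_integrable)
    ultimately show ?thesis
      using m_pos by (metis abs_of_pos norm_scaleR)
  qed
  moreover have "\<gamma> differentiable (at t)" if "t \<in> {c<..<d}" for t
    using deriv[OF that] by (auto simp: has_vector_derivative_def differentiable_def)
  ultimately show thesis
    by (rule that)
qed

lemma piecewise_smooth_speed:
  assumes "piecewise_smooth \<gamma> a b"
  obtains L S where "(speed \<gamma> has_integral L) {a..b}" "m * norm (\<gamma> b - \<gamma> a) \<le> L"
    "finite S" "\<And>t. t \<in> {a..b} - S \<Longrightarrow> \<gamma> differentiable (at t)"
proof -
  obtain n \<tau> where \<tau>: "\<tau> (0::nat) = a" "\<tau> n = b" "\<And>i. i < n \<Longrightarrow> \<tau> i < \<tau> (Suc i)"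
    "\<And>i. i < n \<Longrightarrow> smooth_on_interval \<gamma> (\<tau> i) (\<tau> (Suc i))"
    using assms unfolding piecewise_smooth_def by blast
  have "\<exists>L S. (speed \<gamma> has_integral L) {a..\<tau> k} \<and> m * norm (\<gamma> (\<tau> k) - \<gamma> a) \<le> L \<and>
      finite S \<and> (\<forall>t\<in>{a..\<tau> k} - S. \<gamma> differentiable (at t))" if "k \<le> n" for k
    using that
  proof (induction k)
    case 0
    then show ?case
      using \<tau>(1) by (intro exI[of _ 0] exI[of _ "{a}"]) (auto simp: has_integral_refl)
  next
    case (Suc k)
    then obtain L S where L: "(speed \<gamma> has_integral L) {a..\<tau> k}" "m * norm (\<gamma> (\<tau> k) - \<gamma> a) \<le> L"
      "finite S" "\<forall>t\<in>{a..\<tau> k} - S. \<gamma> differentiable (at t)"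
      by (metis Suc_leD)
    have k: "k < n"
      using Suc by simp
    obtain K where K: "(speed \<gamma> has_integral K) {\<tau> k..\<tau> (Suc k)}" "m * norm (\<gamma> (\<tau> (Suc k)) - \<gamma> (\<tau> k)) \<le> K"
      "\<And>t. t \<in> {\<tau> k<..<\<tau> (Suc k)} \<Longrightarrow> \<gamma> differentiable (at t)"
      using smooth_speed[OF \<tau>(4)[OF k] \<tau>(3)[OF k]] by blast
    have le: "a \<le> \<tau> k" "\<tau> k \<le> \<tau> (Suc k)"
      using mono_partition[of n \<tau> 0 k] \<tau> k less_imp_le[OF \<tau>(3)[OF k]] by auto
    have "(speed \<gamma> has_integral (L + K)) {a..\<tau> (Suc k)}"
      by (rule has_integral_combine[OF le L(1) K(1)])
    moreover have "m * norm (\<gamma> (\<tau> (Suc k)) - \<gamma> a) \<le> L + K"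
    proof -
      have "norm (\<gamma> (\<tau> (Suc k)) - \<gamma> a) \<le> norm (\<gamma> (\<tau> k) - \<gamma> a) + norm (\<gamma> (\<tau> (Suc k)) - \<gamma> (\<tau> k))"
        using norm_triangle_ineq[of "\<gamma> (\<tau> k) - \<gamma> a" "\<gamma> (\<tau> (Suc k)) - \<gamma> (\<tau> k)"] by simp
      then have "m * norm (\<gamma> (\<tau> (Suc k)) - \<gamma> a) \<le> m * norm (\<gamma> (\<tau> k) - \<gamma> a) + m * norm (\<gamma> (\<tau> (Suc k)) - \<gamma> (\<tau> k))"
        using m_pos by (simp add: distrib_left[symmetric])
      then show ?thesis
        using L(2) K(2) by linarith
    qed
    moreover have "\<forall>t\<in>{a..\<tau> (Suc k)} - (S \<union> {\<tau> k, \<tau> (Suc k)}). \<gamma> differentiable (at t)"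
    proof
      fix t assume t: "t \<in> {a..\<tau> (Suc k)} - (S \<union> {\<tau> k, \<tau> (Suc k)})"
      then show "\<gamma> differentiable (at t)"
        using L(4) K(3)[of t] by (cases "t \<le> \<tau> k") auto
    qed
    ultimately show ?case
      using L(3) by (intro exI[of _ "L + K"] exI[of _ "S \<union> {\<tau> k, \<tau> (Suc k)}"]) auto
  qed
  from this[of n] show thesis
    using \<tau>(2) that by auto
qed

definition curve :: "(real \<Rightarrow> real^2) \<Rightarrow> real \<Rightarrow> real \<Rightarrow> real^2 \<Rightarrow> real^2 \<Rightarrow> bool" where
  "curve \<gamma> a b x y \<longleftrightarrow> a < b \<and> piecewise_smooth \<gamma> a b \<and> \<gamma> a = x \<and> \<gamma> b = y"

text \<open>Keeps the set of lengths bounded below, so that \<open>Inf\<close> in the distance is a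
  true infimum.\<close>

lemma curve_length_lower:
  assumes "curve \<gamma> a b x y"
  shows "m * norm (y - x) \<le> curve_length G \<gamma> a b"
  using assms piecewise_smooth_speed[of \<gamma> a b]
  by (metis curve_def curve_length_speed integral_unique)

text \<open>A parameter change of slope \<sigma> multiplies the velocity by \<sigma>; for \<sigma> =
  -1 the speed is preserved because the metric is reversible.\<close>

lemma curve_length_affine:
  assumes \<gamma>: "piecewise_smooth \<gamma> a b" and \<sigma>: "\<bar>\<sigma>\<bar> = 1" and z: "z \<in> int_lattice"
    and image: "(\<lambda>x. (1 / \<sigma>) * x + - (1 / \<sigma>) * c) ` {a..b} = {a'..b'}"
  shows "curve_length G (\<lambda>t. \<gamma> (\<sigma> * t + c) + z) a' b' = curve_length G \<gamma> a b"
proof -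
  obtain L S where L: "(speed \<gamma> has_integral L) {a..b}" and S: "finite S"
    "\<And>t. t \<in> {a..b} - S \<Longrightarrow> \<gamma> differentiable (at t)"
    using piecewise_smooth_speed[OF \<gamma>] by metis
  have \<sigma>0: "\<sigma> \<noteq> 0"
    using \<sigma> by auto
  have "((\<lambda>t. speed \<gamma> (\<sigma> *\<^sub>R t + c)) has_integral (1 / \<bar>\<sigma>\<bar> ^ DIM(real)) *\<^sub>R L) ((\<lambda>x. (1 / \<sigma>) *\<^sub>R x + - ((1 / \<sigma>) *\<^sub>R c)) ` cbox a b)"
    by (rule has_integral_affinity) (use L \<sigma>0 in auto)
  then have int: "((\<lambda>t. speed \<gamma> (\<sigma> * t + c)) has_integral L) {a'..b'}"
    using image \<sigma> by simp
  have eq: "speed (\<lambda>t. \<gamma> (\<sigma> * t + c) + z) t = speed \<gamma> (\<sigma> * t + c)"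
    if t: "t \<in> {a'..b'} - (\<lambda>s. (1 / \<sigma>) * s + - (1 / \<sigma>) * c) ` S" for t
  proof -
    obtain s where s: "s \<in> {a..b}" "t = (1 / \<sigma>) * s + - (1 / \<sigma>) * c"
      using t image by blast
    then have st: "s = \<sigma> * t + c"
      using \<sigma>0 by (simp add: field_simps)
    have "s \<notin> S"
      using t s(2) by blast
    then have "\<gamma> differentiable (at s)"
      using S(2) s(1) by auto
    then have "(\<gamma> has_vector_derivative vector_derivative \<gamma> (at s)) (at s)"
      by (simp add: vector_derivative_works)
    moreover have "((\<lambda>t. \<sigma> * t + c) has_vector_derivative \<sigma>) (at t)"
      by (auto intro!: derivative_eq_intros)
    ultimately have "((\<lambda>t. \<gamma> (\<sigma> * t + c)) has_vector_derivative \<sigma> *\<^sub>R vector_derivative \<gamma> (at s)) (at t)"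
      using vector_diff_chain_at[of "\<lambda>t. \<sigma> * t + c" \<sigma> t \<gamma>] by (simp add: st o_def)
    then have "((\<lambda>t. \<gamma> (\<sigma> * t + c) + z) has_vector_derivative \<sigma> *\<^sub>R vector_derivative \<gamma> (at s)) (at t)"
      by (simp add: has_vector_derivative_add_const)
    from vector_derivative_at[OF this] show ?thesis
      unfolding speed_def using periodic[OF z] \<sigma> by (simp add: homogeneous_abs st)
  qed
  have "(speed (\<lambda>t. \<gamma> (\<sigma> * t + c) + z) has_integral L) {a'..b'}"
    using finite_imageI[OF S(1)] eq int by (rule has_integral_spike_finite)
  then show ?thesis
    using L by (simp add: curve_length_speed integral_unique)
qed

lemma curve_shift:
  assumes "curve \<gamma> a b x y" "z \<in> int_lattice"
  obtains \<gamma>' where "curve \<gamma>' (a - c) (b - c) (x + z) (y + z)" "curve_length G \<gamma>' (a - c) (b - c) = curve_length G \<gamma> a b"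
proof (rule that)
  let ?\<gamma> = "\<lambda>t. \<gamma> (1 * t + c) + z"
  show "curve ?\<gamma> (a - c) (b - c) (x + z) (y + z)"
    using assms piecewise_smooth_shift[of \<gamma> a b c z] by (simp add: curve_def)
  show "curve_length G ?\<gamma> (a - c) (b - c) = curve_length G \<gamma> a b"
    using assms by (intro curve_length_affine) (auto simp: curve_def image_iff intro!: bexI[of _ "_ + c"])
qed

lemma curve_reverse:
  assumes "curve \<gamma> a b x y"
  obtains \<gamma>' where "curve \<gamma>' (- b) (- a) y x" "curve_length G \<gamma>' (- b) (- a) = curve_length G \<gamma> a b"
proof (rule that)
  let ?\<gamma> = "\<lambda>t. \<gamma> (- 1 * t + 0) + 0"
  show "curve ?\<gamma> (- b) (- a) y x"
    using assms piecewise_smooth_reverse[of \<gamma> a b 0 0] by (simp add: curve_def)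
  show "curve_length G ?\<gamma> (- b) (- a) = curve_length G \<gamma> a b"
    using assms by (intro curve_length_affine) (auto simp: curve_def int_lattice_closed)
qed

lemma curve_join:
  assumes "curve \<gamma>1 a b x y" "curve \<gamma>2 b c y w"
  obtains \<gamma> where "curve \<gamma> a c x w" "curve_length G \<gamma> a c = curve_length G \<gamma>1 a b + curve_length G \<gamma>2 b c"
proof (rule that)
  let ?\<gamma> = "\<lambda>t. if t \<le> b then \<gamma>1 t else \<gamma>2 t"
  have abc: "a < b" "b < c" and ps: "piecewise_smooth \<gamma>1 a b" "piecewise_smooth \<gamma>2 b c" and eq: "\<gamma>1 b = \<gamma>2 b"
    using assms by (auto simp: curve_def)
  show "curve ?\<gamma> a c x w"
    using assms piecewise_smooth_join[OF ps eq] by (auto simp: curve_def)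
  obtain L1 where L1: "(speed \<gamma>1 has_integral L1) {a..b}"
    using piecewise_smooth_speed[OF ps(1)] by metis
  obtain L2 where L2: "(speed \<gamma>2 has_integral L2) {b..c}"
    using piecewise_smooth_speed[OF ps(2)] by metis
  have "(speed ?\<gamma> has_integral L1) {a..b}"
  proof (rule has_integral_spike_finite[of "{b}", OF _ _ L1])
    fix t assume t: "t \<in> {a..b} - {b}"
    then have "\<forall>\<^sub>F s in nhds t. s \<in> UNIV \<longrightarrow> ?\<gamma> s = \<gamma>1 s"
      using eventually_nhds_in_open[of "{..<b}" t] by (auto elim!: eventually_mono)
    then have "vector_derivative ?\<gamma> (at t within UNIV) = vector_derivative \<gamma>1 (at t within UNIV)"
      by (rule vector_derivative_cong_eq) auto
    then show "speed ?\<gamma> t = speed \<gamma>1 t"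
      using t by (simp add: speed_def)
  qed simp
  moreover have "(speed ?\<gamma> has_integral L2) {b..c}"
  proof (rule has_integral_spike_finite[of "{b}", OF _ _ L2])
    fix t assume t: "t \<in> {b..c} - {b}"
    then have "\<forall>\<^sub>F s in nhds t. s \<in> UNIV \<longrightarrow> ?\<gamma> s = \<gamma>2 s"
      using eventually_nhds_in_open[of "{b<..}" t] by (auto elim!: eventually_mono)
    then have "vector_derivative ?\<gamma> (at t within UNIV) = vector_derivative \<gamma>2 (at t within UNIV)"
      by (rule vector_derivative_cong_eq) auto
    then show "speed ?\<gamma> t = speed \<gamma>2 t"
      using t by (simp add: speed_def)
  qed simp
  ultimately have "(speed ?\<gamma> has_integral (L1 + L2)) {a..c}"
    using abc by (intro has_integral_combine[of a b c]) auto
  then show "curve_length G ?\<gamma> a c = curve_length G \<gamma>1 a b + curve_length G \<gamma>2 b c"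
    using L1 L2 by (simp add: curve_length_speed integral_unique)
qed

section \<open>The distance and its invariance\<close>

abbreviation d :: "real^2 \<Rightarrow> real^2 \<Rightarrow> real" where
  "d \<equiv> finsler_dist G"

lemma d_eq: "d x y = Inf {curve_length G \<gamma> a b |\<gamma> a b. curve \<gamma> a b x y}"
  by (simp add: finsler_dist_def curve_def)

lemma curve_segment: "curve (\<lambda>t. x + t *\<^sub>R (y - x)) 0 1 x y"
  by (simp add: curve_def piecewise_smooth_line)

lemma d_le_curve_length: "curve \<gamma> a b x y \<Longrightarrow> d x y \<le> curve_length G \<gamma> a b"
  unfolding d_eq using curve_length_lower
  by (intro cInf_lower) (auto intro!: bdd_belowI[of _ "m * norm (y - x)"])

lemma d_curve_approx:
  assumes "0 < \<epsilon>"
  obtains \<gamma> a b where "curve \<gamma> a b x y" "curve_length G \<gamma> a b < d x y + \<epsilon>"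
proof -
  have "{curve_length G \<gamma> a b |\<gamma> a b. curve \<gamma> a b x y} \<noteq> {}"
    using curve_segment by blast
  from cInf_lessD[OF this, of "d x y + \<epsilon>"] show thesis
    using assms that unfolding d_eq by auto
qed

lemma d_lower: "m * norm (y - x) \<le> d x y"
  unfolding d_eq using curve_segment[of x y] curve_length_lower by (intro cInf_greatest) auto

lemma d_nonneg: "0 \<le> d x y"
  using d_lower[of y x] m_pos by (smt (verit) mult_nonneg_nonneg norm_ge_zero)

text \<open>Serves globally, with the constant \<open>M\<close>, and for the calibrations with a
  bound that holds near one point.\<close>

lemma d_le_segment:
  assumes "\<And>t. t \<in> {0..1} \<Longrightarrow> G (x + t *\<^sub>R v) v \<le> B"
  shows "d x (x + v) \<le> B"
proof -
  let ?\<gamma> = "\<lambda>t. x + t *\<^sub>R (x + v - x)"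
  have vd: "vector_derivative ?\<gamma> (at t) = v" for t
    by (rule vector_derivative_at) (auto intro!: derivative_eq_intros)
  have sp: "speed ?\<gamma> = (\<lambda>t. G (x + t *\<^sub>R v) v)"
    by (rule ext) (simp only: speed_def vd, simp)
  have "d x (x + v) \<le> integral {0..1} (speed ?\<gamma>)"
    using d_le_curve_length[OF curve_segment[of x "x + v"]] by (simp only: curve_length_speed)
  also have "\<dots> = integral {0..1} (\<lambda>t. G (x + t *\<^sub>R v) v)"
    by (simp only: sp)
  also have "\<dots> \<le> integral {0..1} (\<lambda>t::real. B)"
    using assms by (intro integral_le integrable_continuous_real continuous_intros) auto
  finally show ?thesis
    by simp
qed

lemma d_le: "d x y \<le> M * norm (y - x)"
  using d_le_segment[of x "y - x" "M * norm (y - x)"] upper by simp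

lemma d_triangle: "d x w \<le> d x y + d y w"
proof (rule field_le_epsilon)
  fix \<epsilon> :: real assume "0 < \<epsilon>"
  then have "0 < \<epsilon> / 2"
    by simp
  obtain \<gamma>1 a b where 1: "curve \<gamma>1 a b x y" "curve_length G \<gamma>1 a b < d x y + \<epsilon> / 2"
    using d_curve_approx[OF \<open>0 < \<epsilon> / 2\<close>] by blast
  obtain \<gamma>2 p q where 2: "curve \<gamma>2 p q y w" "curve_length G \<gamma>2 p q < d y w + \<epsilon> / 2"
    using d_curve_approx[OF \<open>0 < \<epsilon> / 2\<close>] by blast
  \<comment> \<open>The parameter of the second curve is shifted to start at \<open>b\<close>, where
    the first one ends; the translation in the plane is by 0.\<close>
  obtain \<gamma>3 where 3: "curve \<gamma>3 b (q - (p - b)) y w" "curve_length G \<gamma>3 b (q - (p - b)) = curve_length G \<gamma>2 p q"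
    using curve_shift[OF 2(1) int_lattice_closed(1), of "p - b"] by auto
  obtain \<gamma> where "curve \<gamma> a (q - (p - b)) x w"
    "curve_length G \<gamma> a (q - (p - b)) = curve_length G \<gamma>1 a b + curve_length G \<gamma>3 b (q - (p - b))"
    using curve_join[OF 1(1) 3(1)] by blast
  with d_le_curve_length[OF this(1)] 1(2) 2(2) 3(2) show "d x w \<le> d x y + d y w + \<epsilon>"
    by linarith
qed

lemma d_sym_le: "d y x \<le> d x y"
proof (rule field_le_epsilon)
  fix \<epsilon> :: real assume "0 < \<epsilon>"
  obtain \<gamma> a b where 1: "curve \<gamma> a b x y" "curve_length G \<gamma> a b < d x y + \<epsilon>"
    using d_curve_approx[OF \<open>0 < \<epsilon>\<close>] by blast
  obtain \<gamma>' where "curve \<gamma>' (- b) (- a) y x" "curve_length G \<gamma>' (- b) (- a) = curve_length G \<gamma> a b"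
    using curve_reverse[OF 1(1)] by blast
  with d_le_curve_length[OF this(1)] 1(2) show "d y x \<le> d x y + \<epsilon>"
    by linarith
qed

lemma d_sym: "d y x = d x y"
  using d_sym_le[of x y] d_sym_le[of y x] by simp

lemma d_periodic_le:
  assumes z: "z \<in> int_lattice"
  shows "d (x + z) (y + z) \<le> d x y"
proof (rule field_le_epsilon)
  fix \<epsilon> :: real assume "0 < \<epsilon>"
  obtain \<gamma> a b where 1: "curve \<gamma> a b x y" "curve_length G \<gamma> a b < d x y + \<epsilon>"
    using d_curve_approx[OF \<open>0 < \<epsilon>\<close>] by blast
  obtain \<gamma>' where "curve \<gamma>' (a - 0) (b - 0) (x + z) (y + z)" "curve_length G \<gamma>' (a - 0) (b - 0) = curve_length G \<gamma> a b"
    using curve_shift[OF 1(1) z] by blast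
  with d_le_curve_length[OF this(1)] 1(2) show "d (x + z) (y + z) \<le> d x y + \<epsilon>"
    by linarith
qed

lemma d_periodic: "z \<in> int_lattice \<Longrightarrow> d (x + z) (y + z) = d x y"
  using d_periodic_le[of z x y] d_periodic_le[of "- z" "x + z" "y + z"] int_lattice_closed(3)[of z] by simp

end

section \<open>The stable norm\<close>

lemma floor_vec_approx: "(\<lambda>k. (1 / real (Suc k)) *\<^sub>R floor_vec (real (Suc k) *\<^sub>R v)) \<longlonglongrightarrow> v"
proof -
  have "norm ((1 / real (Suc k)) *\<^sub>R floor_vec (real (Suc k) *\<^sub>R v) - v) \<le> 2 * inverse (real (Suc k))" for k
  proof -
    let ?c = "real (Suc k)"
    have "(1 / ?c) *\<^sub>R floor_vec (?c *\<^sub>R v) - v = - ((1 / ?c) *\<^sub>R (?c *\<^sub>R v - floor_vec (?c *\<^sub>R v)))"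
      by (simp add: scaleR_diff_right)
    then have "norm ((1 / ?c) *\<^sub>R floor_vec (?c *\<^sub>R v) - v) = (1 / ?c) * norm (?c *\<^sub>R v - floor_vec (?c *\<^sub>R v))"
      by (simp only: norm_minus_cancel norm_scaleR) simp
    also have "\<dots> \<le> (1 / ?c) * 2"
      by (intro mult_left_mono norm_le_cbox frac_vec_cbox) simp
    finally show ?thesis
      by (simp add: field_simps)
  qed
  then have ev: "\<forall>\<^sub>F k in sequentially. norm ((1 / real (Suc k)) *\<^sub>R floor_vec (real (Suc k) *\<^sub>R v) - v) \<le> 2 * inverse (real (Suc k))"
    by (rule always_eventually[OF allI])
  have "(\<lambda>k. 2 * inverse (real (Suc k))) \<longlonglongrightarrow> 2 * 0"
    by (intro tendsto_intros LIMSEQ_inverse_real_of_nat)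
  then have "(\<lambda>k. 2 * inverse (real (Suc k))) \<longlonglongrightarrow> 0"
    by (simp only: mult_zero_right)
  with ev show ?thesis
    by (rule LIM_zero_cancel[OF Lim_null_comparison])
qed

text \<open>Homogeneity extends the agreement from the lattice to its rational multiples, which are
  dense, and convex functions on the plane are continuous. This is the uniqueness that the definite
  description in \<open>stable_norm\<close> requires.\<close>

lemma asym_norm_eq_lattice:
  assumes N: "asym_norm N" and N': "asym_norm N'" and eq: "\<And>z. z \<in> int_lattice \<Longrightarrow> N z = N' z"
  shows "N = N'"
proof
  fix v
  let ?v = "\<lambda>k. (1 / real (Suc k)) *\<^sub>R floor_vec (real (Suc k) *\<^sub>R v)"
  have lim: "(\<lambda>k. P (?v k)) \<longlonglongrightarrow> P v" if "asym_norm P" for P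
  proof -
    have "continuous_on UNIV P"
      using that by (intro convex_on_continuous) (auto simp: asym_norm_def)
    then show ?thesis
      using floor_vec_approx by (rule continuous_on_tendsto_compose) auto
  qed
  have "N (?v k) = N' (?v k)" for k
    using N N' eq[OF floor_vec_lattice] by (simp add: asym_norm_def)
  then have "(\<lambda>k. N (?v k)) \<longlonglongrightarrow> N' v"
    using lim[OF N'] by simp
  then show "N v = N' v"
    using lim[OF N] LIMSEQ_unique by blast
qed

context finsler_plane
begin

text \<open>A lattice translation brings \<open>x\<close> to a point r of norm at most 2. Replacing
  r by 0 and moving the other endpoint by the same vector costs at most 2 M each.\<close>

lemma d_translate:
  "d x y \<le> d 0 (y - x) + 4 * M" "d 0 (y - x) \<le> d x y + 4 * M"
proof -
  define z where "z = floor_vec x"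
  define r where "r = x - z"
  have r: "norm r \<le> 2"
    unfolding r_def z_def by (intro norm_le_cbox frac_vec_cbox)
  have "- z \<in> int_lattice"
    by (simp add: z_def floor_vec_lattice int_lattice_closed)
  from d_periodic[OF this, of x y] have eq: "d x y = d r (y - z)"
    by (simp add: r_def)
  have Mr: "M * norm r \<le> 2 * M"
    using r M_pos by simp
  have "(y - z) - (y - x) = r" "(y - x) - (y - z) = - r"
    by (auto simp: r_def)
  then have small: "d r 0 \<le> 2 * M" "d 0 r \<le> 2 * M" "d (y - x) (y - z) \<le> 2 * M" "d (y - z) (y - x) \<le> 2 * M"
    using d_le[of r 0] d_le[of 0 r] d_le[of "y - x" "y - z"] d_le[of "y - z" "y - x"] Mr by simp_all
  show "d x y \<le> d 0 (y - x) + 4 * M"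
    using small d_triangle[of r "y - z" 0] d_triangle[of 0 "y - z" "y - x"] unfolding eq by linarith
  show "d 0 (y - x) \<le> d x y + 4 * M"
    using small d_triangle[of 0 "y - x" r] d_triangle[of r "y - x" "y - z"] unfolding eq by linarith
qed

text \<open>Adding the constant makes the distance from the origin subadditive.\<close>

definition E :: "real^2 \<Rightarrow> real" where
  "E v = d 0 v + 4 * M"

text \<open>An infimum over real scales is defined for all vectors at once, not only for lattice
  vectors, and turns homogeneity into a substitution. Subadditivity of \<open>E\<close> makes it a
  limit.\<close>

definition N :: "real^2 \<Rightarrow> real" where
  "N v = (INF t\<in>{0<..}. E (t *\<^sub>R v) / t)"

lemma E_nonneg: "0 \<le> E v"
  using d_nonneg[of 0 v] M_pos by (simp add: E_def)

lemma E_lower: "m * norm v \<le> E v"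
  using d_lower[of v 0] M_pos by (simp add: E_def)

lemma E_le: "E v \<le> M * norm v + 4 * M"
  using d_le[of 0 v] by (simp add: E_def)

lemma E_add: "E (v + w) \<le> E v + E w"
  using d_triangle[of 0 "v + w" v] d_translate(1)[of v "v + w"] by (simp add: E_def)

lemma E_multiple: "E (real q *\<^sub>R v + w) \<le> real q * E v + E w"
proof (induction q)
  case (Suc q)
  have "E (real (Suc q) *\<^sub>R v + w) = E (v + (real q *\<^sub>R v + w))"
    by (simp add: scaleR_add_left add.assoc)
  also have "\<dots> \<le> E v + (real q * E v + E w)"
    using E_add[of v "real q *\<^sub>R v + w"] Suc by simp
  finally show ?case
    by (simp add: algebra_simps)
qed simp

lemma E_bdd_below: "bdd_below ((\<lambda>t. E (t *\<^sub>R v) / t) ` {0<..})"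
  by (rule bdd_belowI[of _ 0]) (auto simp: E_nonneg)

lemma N_le: "0 < t \<Longrightarrow> N v \<le> E (t *\<^sub>R v) / t"
  unfolding N_def by (intro cINF_lower E_bdd_below) auto

lemma N_lower: "m * norm v \<le> N v"
  unfolding N_def
proof (intro cINF_greatest)
  fix t :: real assume t: "t \<in> {0<..}"
  then have "m * norm v * t \<le> E (t *\<^sub>R v)"
    using E_lower[of "t *\<^sub>R v"] by (simp add: mult_ac)
  then show "m * norm v \<le> E (t *\<^sub>R v) / t"
    using t by (simp add: pos_le_divide_eq)
qed auto

text \<open>Fekete's lemma. For a nearly optimal t write k = q t + r with 0 \<le> r \<le> t; the
  remainder r contributes a bounded amount, which disappears on division by k.\<close>

lemma N_limit: "(\<lambda>k. E (real k *\<^sub>R v) / real k) \<longlonglongrightarrow> N v"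
proof (rule LIMSEQ_I)
  fix \<epsilon> :: real assume \<epsilon>: "0 < \<epsilon>"
  have "(INF t\<in>{0<..}. E (t *\<^sub>R v) / t) < N v + \<epsilon> / 2"
    using \<epsilon> by (simp add: N_def)
  then obtain t where t: "0 < t" "E (t *\<^sub>R v) / t < N v + \<epsilon> / 2"
    by (subst (asm) cINF_less_iff) (auto simp: E_bdd_below)
  define B where "B = M * (t * norm v) + 4 * M"
  have B: "0 < B"
    using M_pos t by (auto simp: B_def intro!: add_nonneg_pos)
  obtain K where K: "2 * B / \<epsilon> < real K"
    using reals_Archimedean2 by blast
  have "norm (E (real k *\<^sub>R v) / real k - N v) < \<epsilon>" if "K \<le> k" for k
  proof -
    have k: "2 * B / \<epsilon> < real k"
      using K that by linarith
    have kpos: "0 < real k"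
      using k B \<epsilon> by (meson divide_nonneg_pos less_eq_real_def mult_nonneg_nonneg order.strict_trans1 zero_le_numeral)
    define q where "q = nat \<lfloor>real k / t\<rfloor>"
    define r where "r = real k - real q * t"
    have "real q \<le> real k / t" "real k / t < real q + 1"
      using kpos t by (auto simp: q_def)
    then have q: "real q * t \<le> real k" and r: "0 \<le> r" "r \<le> t"
      using t by (auto simp: r_def field_simps)
    have "E (real k *\<^sub>R v) = E (real q *\<^sub>R (t *\<^sub>R v) + r *\<^sub>R v)"
      by (simp add: r_def algebra_simps)
    also have "\<dots> \<le> real q * E (t *\<^sub>R v) + E (r *\<^sub>R v)"
      by (rule E_multiple)
    also have "E (r *\<^sub>R v) \<le> B"
      using E_le[of "r *\<^sub>R v"] r M_pos mult_right_mono[OF r(2), of "norm v"] by (simp add: B_def) (meson add_mono mult_le_cancel_left_pos order.refl order_trans)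
    finally have "E (real k *\<^sub>R v) \<le> real q * E (t *\<^sub>R v) + B"
      by simp
    also have "real q * E (t *\<^sub>R v) = (real q * t) * (E (t *\<^sub>R v) / t)"
      using t by simp
    also have "\<dots> \<le> real k * (E (t *\<^sub>R v) / t)"
      using q t E_nonneg by (intro mult_right_mono) auto
    finally have "E (real k *\<^sub>R v) / real k \<le> E (t *\<^sub>R v) / t + B / real k"
      using kpos by (simp add: field_simps)
    moreover have "B / real k < \<epsilon> / 2"
      using k kpos \<epsilon> by (simp add: field_simps)
    ultimately show ?thesis
      using t(2) N_le[OF kpos, of v] unfolding real_norm_def abs_less_iff by (intro conjI) linarith+
  qed
  then show "\<exists>no. \<forall>n\<ge>no. norm (E (real n *\<^sub>R v) / real n - N v) < \<epsilon>"
    by blast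
qed

lemma N_homogeneous:
  assumes "0 \<le> c"
  shows "N (c *\<^sub>R v) = c * N v"
proof -
  have le: "N (c *\<^sub>R v) \<le> c * N v" if c: "0 < c" for c v
  proof -
    have "N (c *\<^sub>R v) / c \<le> E (s *\<^sub>R v) / s" if "s \<in> {0<..}" for s
      using N_le[of "s / c" "c *\<^sub>R v"] that c by (simp add: field_simps)
    then have "N (c *\<^sub>R v) / c \<le> N v"
      unfolding N_def[of v] by (intro cINF_greatest) auto
    then show ?thesis
      using c by (simp add: field_simps)
  qed
  show ?thesis
  proof (cases "c = 0")
    \<comment> \<open>No substitution is available for c = 0, and \<open>E 0\<close> is 4 M, not 0;
      the value follows from the limit.\<close>
    case True
    have "(\<lambda>k. 4 * M * (1 / real k)) \<longlonglongrightarrow> 4 * M * 0"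
      by (intro tendsto_intros lim_1_over_n)
    moreover have "d 0 0 = 0"
      using d_le[of 0 0] d_nonneg[of 0 0] by simp
    ultimately have "(\<lambda>k. E (real k *\<^sub>R 0) / real k) \<longlonglongrightarrow> 0"
      by (simp add: E_def)
    then show ?thesis
      using LIMSEQ_unique[OF N_limit[of 0]] True by simp
  next
    case False
    then have "0 < c"
      using assms by simp
    then show ?thesis
      using le[of c v] le[of "1 / c" "c *\<^sub>R v"] by (simp add: field_simps)
  qed
qed

lemma N_triangle: "N (v + w) \<le> N v + N w"
proof (rule LIMSEQ_le[OF N_limit tendsto_add[OF N_limit N_limit]])
  have "E (real k *\<^sub>R (v + w)) / real k \<le> E (real k *\<^sub>R v) / real k + E (real k *\<^sub>R w) / real k" for k
    using E_add[of "real k *\<^sub>R v" "real k *\<^sub>R w"]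
    by (simp add: scaleR_add_right add_divide_distrib[symmetric] divide_right_mono)
  then show "\<exists>K. \<forall>k\<ge>K. E (real k *\<^sub>R (v + w)) / real k \<le> E (real k *\<^sub>R v) / real k + E (real k *\<^sub>R w) / real k"
    by blast
qed

text \<open>Reversing a path and translating it back to the origin costs at most 4 M, which the
  limit forgets.\<close>

lemma N_minus: "N (- v) = N v"
proof -
  have le: "N (- v) \<le> N v" for v
  proof (rule LIMSEQ_le[OF N_limit])
    have "(\<lambda>k. E (real k *\<^sub>R v) / real k + 4 * M * (1 / real k)) \<longlonglongrightarrow> N v + 4 * M * 0"
      by (intro tendsto_intros lim_1_over_n N_limit)
    then show "(\<lambda>k. E (real k *\<^sub>R v) / real k + 4 * M * (1 / real k)) \<longlonglongrightarrow> N v"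
      by simp
    have "E (- w) \<le> E w + 4 * M" for w
      using d_translate(1)[of "- w" 0] d_sym[of "- w" 0] by (simp add: E_def)
    then have "E (real k *\<^sub>R - v) / real k \<le> E (real k *\<^sub>R v) / real k + 4 * M * (1 / real k)" for k
      by (simp add: add_divide_distrib[symmetric] divide_right_mono)
    then show "\<exists>K. \<forall>k\<ge>K. E (real k *\<^sub>R - v) / real k \<le> E (real k *\<^sub>R v) / real k + 4 * M * (1 / real k)"
      by blast
  qed
  show ?thesis
    using le[of v] le[of "- v"] by simp
qed

lemma asym_norm_N: "asym_norm N"
proof -
  have "convex_on UNIV N"
  proof (rule convex_onI)
    fix t :: real and x y :: "real^2" assume "0 < t" "t < 1"
    then show "N ((1 - t) *\<^sub>R x + t *\<^sub>R y) \<le> (1 - t) * N x + t * N y"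
      using N_triangle[of "(1 - t) *\<^sub>R x" "t *\<^sub>R y"] by (simp add: N_homogeneous)
  qed simp
  moreover have "0 < N v" if "v \<noteq> 0" for v
    using N_lower[of v] m_pos that by (smt (verit) mult_pos_pos zero_less_norm_iff)
  ultimately show ?thesis
    by (simp add: asym_norm_def N_homogeneous)
qed

text \<open>The additive error consists of 4 M from \<open>E\<close> and 4 M for moving the starting
  point to the origin.\<close>

lemma N_le_d: "N v \<le> d x (x + v) + 8 * M"
  using N_le[of 1 v] d_translate(2)[of "x + v" x] by (simp add: E_def)

text \<open>Distances measured from \<open>x\<close> and from the origin differ by a bounded amount,
  so the base point drops out of the limit.\<close>

lemma d_limit: "(\<lambda>k. d x (x + real k *\<^sub>R z) / real k) \<longlonglongrightarrow> N z"
proof (rule tendsto_sandwich)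
  have E: "d x (x + v) \<le> E v" "E v - 8 * M \<le> d x (x + v)" for v
    using d_translate(1)[of x "x + v"] d_translate(2)[of "x + v" x] by (auto simp: E_def)
  show "\<forall>\<^sub>F k in sequentially. d x (x + real k *\<^sub>R z) / real k \<le> E (real k *\<^sub>R z) / real k"
    using E by (auto intro!: always_eventually divide_right_mono)
  show "\<forall>\<^sub>F k in sequentially. E (real k *\<^sub>R z) / real k - 8 * M * (1 / real k) \<le> d x (x + real k *\<^sub>R z) / real k"
    using E(2) by (auto intro!: always_eventually divide_right_mono simp: diff_divide_distrib[symmetric])
  have "(\<lambda>k. E (real k *\<^sub>R z) / real k - 8 * M * (1 / real k)) \<longlonglongrightarrow> N z - 8 * M * 0"
    by (intro tendsto_intros lim_1_over_n N_limit)
  then show "(\<lambda>k. E (real k *\<^sub>R z) / real k - 8 * M * (1 / real k)) \<longlonglongrightarrow> N z"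
    by simp
qed (rule N_limit)

end

lemma stable_norm_eq:
  assumes "finsler_plane (lift_metric F) m M"
  shows "stable_norm F = finsler_plane.N (lift_metric F) M"
proof -
  interpret finsler_plane "lift_metric F" m M
    by fact
  show ?thesis
    unfolding stable_norm_def
  proof (rule the_equality)
    show "asym_norm N \<and> (\<forall>x\<^sub>0. \<forall>z\<in>int_lattice. (\<lambda>k. d x\<^sub>0 (x\<^sub>0 + real k *\<^sub>R z) / real k) \<longlonglongrightarrow> N z)"
      using asym_norm_N d_limit by blast
    fix P assume P: "asym_norm P \<and> (\<forall>x\<^sub>0. \<forall>z\<in>int_lattice. (\<lambda>k. d x\<^sub>0 (x\<^sub>0 + real k *\<^sub>R z) / real k) \<longlonglongrightarrow> P z)"
    have "P z = N z" if "z \<in> int_lattice" for z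
      using P that LIMSEQ_unique[OF _ d_limit[of 0 z]] by blast
    then show "P = N"
      using P asym_norm_N by (intro asym_norm_eq_lattice) auto
  qed
qed

section \<open>Smooth calibrating functions\<close>

lemma has_real_derivative_max0_square:
  "((\<lambda>s::real. (max 0 s)\<^sup>2) has_real_derivative 2 * max 0 s) (at s)"
proof -
  consider "s < 0" | "s = 0" | "0 < s"
    by linarith
  then show ?thesis
  proof cases
    case 1
    have "((\<lambda>s::real. 0) has_real_derivative 2 * max 0 s) (at s)"
      using 1 by simp
    then show ?thesis
      by (rule has_field_derivative_transform_within_open[where S="{..<0}"]) (use 1 in auto)
  next
    case 3
    have "((\<lambda>s::real. s\<^sup>2) has_real_derivative 2 * max 0 s) (at s)"
      using 3 by (auto intro!: derivative_eq_intros)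
    then show ?thesis
      by (rule has_field_derivative_transform_within_open[where S="{0<..}"]) (use 3 in auto)
  next
    case 2
    have "(\<lambda>h::real. (max 0 h)\<^sup>2 / h) \<midarrow>0\<rightarrow> 0"
    proof (rule Lim_null_comparison)
      show "\<forall>\<^sub>F h in at 0. norm ((max 0 h)\<^sup>2 / h) \<le> \<bar>h\<bar>"
        by (rule always_eventually) (auto simp: max_def power2_eq_square)
      show "((\<lambda>h::real. \<bar>h\<bar>) \<longlongrightarrow> 0) (at 0)"
        by (rule tendsto_rabs_zero) (rule tendsto_ident_at)
    qed
    then show ?thesis
      using 2 by (simp add: DERIV_def)
  qed
qed

text \<open>Squaring the positive part gives a C^1 bump supported in the disc of radius \<rho>; a
  continuous first derivative is all that differentiation under the integral sign asks for.
  Normalization is left to \<open>kernel_mass\<close>.\<close>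

definition kernel :: "real \<Rightarrow> real^2 \<Rightarrow> real" where
  "kernel \<rho> y = (max 0 (\<rho>\<^sup>2 - y \<bullet> y))\<^sup>2"

lemma kernel_nonneg: "0 \<le> kernel \<rho> y"
  by (simp add: kernel_def)

lemma kernel_support: "0 < \<rho> \<Longrightarrow> kernel \<rho> y \<noteq> 0 \<Longrightarrow> norm y < \<rho>"
  unfolding kernel_def power2_norm_eq_inner[symmetric]
  by (metis abs_le_square_iff abs_norm_cancel abs_of_pos diff_gt_0_iff_gt linorder_not_less max.absorb1 diff_le_0_iff_le zero_power2)

lemma continuous_on_kernel [continuous_intros]:
  "continuous_on S f \<Longrightarrow> continuous_on S (\<lambda>x. kernel \<rho> (f x))"
  unfolding kernel_def by (intro continuous_intros)

text \<open>Integration is over boxes; this one contains the disc in which the kernel lives.\<close>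

definition cube :: "real \<Rightarrow> real^2 \<Rightarrow> (real^2) set" where
  "cube r x = cbox (x - r *\<^sub>R 1) (x + r *\<^sub>R 1)"

lemma mem_cube: "y \<in> cube r x \<longleftrightarrow> (\<forall>i. \<bar>y $ i - x $ i\<bar> \<le> r)"
  by (auto simp: cube_def mem_box_cart abs_le_iff algebra_simps)

definition kernel_mass :: "real \<Rightarrow> real" where
  "kernel_mass \<rho> = integral (cube \<rho> 0) (kernel \<rho>)"

lemma kernel_mass_pos:
  assumes "0 < \<rho>"
  shows "0 < kernel_mass \<rho>"
proof -
  have "kernel_mass \<rho> \<noteq> 0"
  proof
    assume "kernel_mass \<rho> = 0"
    moreover have "box (0 - \<rho> *\<^sub>R 1) (0 + \<rho> *\<^sub>R (1::real^2)) \<noteq> {}"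
      using assms by (simp add: box_ne_empty Basis_vec2 inner_axis)
    moreover have "continuous_on (cube \<rho> 0) (kernel \<rho>)"
      by (intro continuous_intros)
    ultimately have "\<forall>x\<in>cube \<rho> 0. kernel \<rho> x = 0"
      unfolding kernel_mass_def cube_def by (subst (asm) integral_cbox_eq_0_iff) (auto simp: kernel_nonneg)
    moreover have "0 \<in> cube \<rho> 0"
      using assms by (simp add: mem_cube)
    ultimately have "kernel \<rho> 0 = 0"
      by blast
    then show False
      using assms by (simp add: kernel_def max_def)
  qed
  moreover have "0 \<le> kernel_mass \<rho>"
    unfolding kernel_mass_def cube_def
    by (intro integral_nonneg integrable_continuous continuous_intros) (simp_all add: kernel_nonneg)
  ultimately show ?thesis
    by simp
qed

definition mollify :: "real \<Rightarrow> (real^2 \<Rightarrow> real) \<Rightarrow> real^2 \<Rightarrow> real" where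
  "mollify \<rho> h x = integral (cube \<rho> 0) (\<lambda>u. kernel \<rho> u * h (x + u)) / kernel_mass \<rho>"

lemma continuous_on_translate:
  fixes h :: "'a::real_normed_vector \<Rightarrow> real"
  shows "continuous_on UNIV h \<Longrightarrow> continuous_on S (\<lambda>u. h (x + u))"
  by (rule continuous_on_compose2[of UNIV h]) (auto intro!: continuous_intros)

text \<open>Averaging preserves bounds on increments. Stated for increments rather than derivatives,
  this carries the local, Lipschitz and quasiperiodic properties of a calibrating function over to
  its mollification.\<close>

lemma mollify_increment_le:
  assumes h: "continuous_on UNIV h" and \<rho>: "0 < \<rho>"
    and B: "\<And>u. norm u < \<rho> \<Longrightarrow> h (x + u) - h (y + u) \<le> B"
  shows "mollify \<rho> h x - mollify \<rho> h y \<le> B"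
proof -
  have int: "(\<lambda>u. kernel \<rho> u * h (x + u)) integrable_on cube \<rho> 0" for x
    unfolding cube_def by (intro integrable_continuous continuous_intros continuous_on_translate h)
  have intk: "kernel \<rho> integrable_on cube \<rho> 0"
    unfolding cube_def by (intro integrable_continuous continuous_intros)
  have "integral (cube \<rho> 0) (\<lambda>u. kernel \<rho> u * h (x + u)) - integral (cube \<rho> 0) (\<lambda>u. kernel \<rho> u * h (y + u))
      = integral (cube \<rho> 0) (\<lambda>u. kernel \<rho> u * h (x + u) - kernel \<rho> u * h (y + u))"
    by (rule integral_diff[symmetric]) (fact int)+
  also have "\<dots> \<le> integral (cube \<rho> 0) (\<lambda>u. kernel \<rho> u * B)"
  proof (rule integral_le)
    show "(\<lambda>u. kernel \<rho> u * h (x + u) - kernel \<rho> u * h (y + u)) integrable_on cube \<rho> 0"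
      by (intro integrable_diff int)
    show "(\<lambda>u. kernel \<rho> u * B) integrable_on cube \<rho> 0"
      using intk by (rule integrable_on_mult_left)
    fix u assume "u \<in> cube \<rho> 0"
    show "kernel \<rho> u * h (x + u) - kernel \<rho> u * h (y + u) \<le> kernel \<rho> u * B"
      using mult_left_mono[OF B kernel_nonneg, of u \<rho> u] kernel_support[OF \<rho>, of u]
      by (cases "kernel \<rho> u = 0") (auto simp: right_diff_distrib)
  qed
  also have "\<dots> = kernel_mass \<rho> * B"
    by (simp add: kernel_mass_def)
  finally show ?thesis
    using kernel_mass_pos[OF \<rho>] by (simp add: mollify_def diff_divide_distrib[symmetric] field_simps)
qed

lemma mollify_increment_eq:
  assumes h: "continuous_on UNIV h" and \<rho>: "0 < \<rho>" and B: "\<And>u. h (x + u) - h (y + u) = B"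
  shows "mollify \<rho> h x = mollify \<rho> h y + B"
proof (rule antisym)
  show "mollify \<rho> h x \<le> mollify \<rho> h y + B"
    using mollify_increment_le[OF h \<rho>, of x y B] B by simp
  have "h (y + u) - h (x + u) \<le> - B" for u
    using B[of u] by simp
  then show "mollify \<rho> h y + B \<le> mollify \<rho> h x"
    using mollify_increment_le[OF h \<rho>, of y x "- B"] by simp
qed

text \<open>A change of variables puts \<open>x\<close> into the kernel alone, so that
  differentiation falls on the kernel and not on \<open>h\<close>. The kernel confines the integrand
  to the cube of radius \<rho> about \<open>x\<close>; for \<open>x\<close> near \<open>x0\<close>
  this lies in the fixed cube of radius \<rho> + 1, over which the Leibniz rule applies.\<close>

lemma mollify_has_derivative:
  assumes h: "continuous_on UNIV h" and \<rho>: "0 < \<rho>"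
  shows "\<exists>D. (mollify \<rho> h has_derivative D) (at x0)"
proof -
  define f where "f x y = kernel \<rho> (y - x) * h y" for x y
  define fx where "fx x y = blinfun_inner_right ((4 * max 0 (\<rho>\<^sup>2 - (y - x) \<bullet> (y - x)) * h y) *\<^sub>R (y - x))" for x y
  have hc: "continuous_on S (\<lambda>x. h (g x))" if "continuous_on S g" for S :: "'b::topological_space set" and g
    using that by (rule continuous_on_compose2[OF h]) simp
  have fint: "f x integrable_on cube r y" for x y r
    unfolding f_def cube_def by (intro integrable_continuous continuous_intros hc)
  have moll: "mollify \<rho> h x = integral (cube (\<rho> + 1) x0) (f x) / kernel_mass \<rho>" if x: "x \<in> ball x0 1" for x
  proof -
    have "(\<lambda>u. kernel \<rho> u * h (x + u)) = f x \<circ> ((+) x)"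
      by (auto simp: f_def)
    then have "integral (cube \<rho> 0) (\<lambda>u. kernel \<rho> u * h (x + u)) = integral (cbox (0 - \<rho> *\<^sub>R 1 + x) (0 + \<rho> *\<^sub>R 1 + x)) (f x)"
      unfolding cube_def by (simp only: integral_shift_cbox_plus)
    also have "cbox (0 - \<rho> *\<^sub>R 1 + x) (0 + \<rho> *\<^sub>R 1 + x) = cube \<rho> x"
      by (simp add: cube_def add.commute)
    also have "integral (cube \<rho> x) (f x) = integral (cube (\<rho> + 1) x0) (f x)"
    proof (rule integral_unique[symmetric], rule has_integral_on_superset)
      show "(f x has_integral integral (cube \<rho> x) (f x)) (cube \<rho> x)"
        by (rule integrable_integral[OF fint])
      fix y assume "y \<notin> cube \<rho> x"
      then have "\<not> norm (y - x) < \<rho>"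
        using component_le_norm_cart[of "y - x"] by (force simp: mem_cube intro: order_trans)
      then show "f x y = 0"
        using kernel_support[OF \<rho>, of "y - x"] by (auto simp: f_def)
    next
      have x0: "\<bar>x $ i - x0 $ i\<bar> \<le> 1" for i
        using component_le_norm_cart[of "x - x0" i] x by (simp add: dist_norm norm_minus_commute)
      show "cube \<rho> x \<subseteq> cube (\<rho> + 1) x0"
      proof
        fix y assume "y \<in> cube \<rho> x"
        then have "\<bar>y $ i - x0 $ i\<bar> \<le> \<rho> + 1" for i
          using x0[of i] abs_triangle_ineq[of "y $ i - x $ i" "x $ i - x0 $ i"] by (simp add: mem_cube) (meson add_mono order_trans)
        then show "y \<in> cube (\<rho> + 1) x0"
          by (simp add: mem_cube)
      qed
    qed
    finally show ?thesis
      by (simp add: mollify_def)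
  qed
  have deriv: "((\<lambda>x. f x y) has_derivative blinfun_apply (fx x y)) (at x within U)" for x y U
  proof -
    have "((\<lambda>x. \<rho>\<^sup>2 - (y - x) \<bullet> (y - x)) has_derivative (\<lambda>v. 2 * ((y - x) \<bullet> v))) (at x within U)"
      by (auto intro!: derivative_eq_intros simp: inner_commute algebra_simps)
    from DERIV_compose_FDERIV[OF has_real_derivative_max0_square this]
    have "((\<lambda>x. kernel \<rho> (y - x)) has_derivative (\<lambda>v. 2 * ((y - x) \<bullet> v) * (2 * max 0 (\<rho>\<^sup>2 - (y - x) \<bullet> (y - x))))) (at x within U)"
      by (simp add: kernel_def)
    from has_derivative_mult_left[OF this, of "h y"]
    have "((\<lambda>x. f x y) has_derivative (\<lambda>v. 2 * ((y - x) \<bullet> v) * (2 * max 0 (\<rho>\<^sup>2 - (y - x) \<bullet> (y - x))) * h y)) (at x within U)"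
      by (simp add: f_def)
    moreover have "blinfun_apply (fx x y) = (\<lambda>v. 2 * ((y - x) \<bullet> v) * (2 * max 0 (\<rho>\<^sup>2 - (y - x) \<bullet> (y - x))) * h y)"
      by (rule ext) (simp add: fx_def)
    ultimately show ?thesis
      by simp
  qed
  have "((\<lambda>x. integral (cbox (x0 - (\<rho> + 1) *\<^sub>R 1) (x0 + (\<rho> + 1) *\<^sub>R 1)) (f x)) has_derivative
      blinfun_apply (integral (cbox (x0 - (\<rho> + 1) *\<^sub>R 1) (x0 + (\<rho> + 1) *\<^sub>R 1)) (fx x0))) (at x0 within ball x0 1)"
  proof (rule leibniz_rule)
    show "continuous_on (ball x0 1 \<times> cbox (x0 - (\<rho> + 1) *\<^sub>R 1) (x0 + (\<rho> + 1) *\<^sub>R 1)) (\<lambda>(x, y). fx x y)"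
      unfolding fx_def case_prod_beta
      by (intro bounded_linear.continuous_on[OF bounded_linear_blinfun_inner_right] continuous_intros hc)
  qed (use deriv fint in \<open>auto simp: cube_def\<close>)
  then have "((\<lambda>x. integral (cube (\<rho> + 1) x0) (f x)) has_derivative
      blinfun_apply (integral (cube (\<rho> + 1) x0) (fx x0))) (at x0)"
    unfolding cube_def by (subst (asm) at_within_open) auto
  from has_derivative_mult_left[OF this, of "1 / kernel_mass \<rho>"]
  have "((\<lambda>x. integral (cube (\<rho> + 1) x0) (f x) / kernel_mass \<rho>) has_derivative
      (\<lambda>v. blinfun_apply (integral (cube (\<rho> + 1) x0) (fx x0)) v / kernel_mass \<rho>)) (at x0)"
    by simp
  then have "(mollify \<rho> h has_derivative
      (\<lambda>v. blinfun_apply (integral (cube (\<rho> + 1) x0) (fx x0)) v / kernel_mass \<rho>)) (at x0)"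
    by (rule has_derivative_transform_within_open[of _ _ _ _ "ball x0 1"]) (auto simp: moll)
  then show ?thesis
    by blast
qed

lemma directional_derivative_limit:
  fixes g :: "real^2 \<Rightarrow> real"
  assumes g: "(g has_derivative D) (at x)"
  shows "(\<lambda>t. (g (x + t *\<^sub>R v) - g x) / t) \<midarrow>0\<rightarrow> D v"
proof -
  have lin: "linear D"
    using g by (rule has_derivative_linear)
  have "((\<lambda>t. x + t *\<^sub>R v) has_derivative (\<lambda>t. t *\<^sub>R v)) (at (0::real))"
    by (auto intro!: derivative_eq_intros)
  from has_derivative_compose[OF this, of g D] have "((\<lambda>t. g (x + t *\<^sub>R v)) has_derivative (\<lambda>t. D (t *\<^sub>R v))) (at 0)"
    using g by simp
  moreover have "(\<lambda>t. D (t *\<^sub>R v)) = (*) (D v)"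
    by (auto simp: linear_cmul[OF lin])
  ultimately have "((\<lambda>t. g (x + t *\<^sub>R v)) has_real_derivative D v) (at 0)"
    by (simp add: has_field_derivative_def)
  then show ?thesis
    by (simp add: DERIV_def)
qed

lemma directional_derivative_le:
  fixes g :: "real^2 \<Rightarrow> real"
  assumes g: "(g has_derivative D) (at x)" and "0 < \<delta>"
    and le: "\<And>t. 0 < t \<Longrightarrow> t < \<delta> \<Longrightarrow> g (x + t *\<^sub>R v) - g x \<le> t * B"
  shows "D v \<le> B"
proof -
  have "((\<lambda>t. (g (x + t *\<^sub>R v) - g x) / t) \<longlongrightarrow> D v) (at_right 0)"
    using directional_derivative_limit[OF g] by (rule tendsto_within_subset) auto
  then show ?thesis
  proof (rule tendsto_upperbound)
    show "\<forall>\<^sub>F t in at_right 0. (g (x + t *\<^sub>R v) - g x) / t \<le> B"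
      unfolding eventually_at_right_field using \<open>0 < \<delta>\<close> le
      by (intro exI[of _ \<delta>]) (auto simp: divide_le_eq mult.commute)
  qed simp
qed

section \<open>Calibrating functions and their mollifications\<close>

context finsler_plane
begin

definition calib :: "real^2 \<Rightarrow> real^2 \<Rightarrow> real" where
  "calib f x = (INF y. f \<bullet> y + d y x)"

context
  fixes f assumes f: "\<And>v. f \<bullet> v \<le> N v"
begin

text \<open>This is where f \<le> N enters: as N is at most the distance plus a constant, the linear
  term cannot decrease faster than the distance to \<open>x\<close> grows.\<close>

lemma calib_bdd: "bdd_below (range (\<lambda>y. f \<bullet> y + d y x))"
proof (rule bdd_belowI2)
  fix y
  show "f \<bullet> x - 8 * M \<le> f \<bullet> y + d y x"
    using f[of "x - y"] N_le_d[of "x - y" y] by (simp add: inner_diff_right)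
qed

lemma calib_le: "calib f x \<le> f \<bullet> y + d y x"
  unfolding calib_def by (rule cINF_lower[OF calib_bdd]) simp

lemma calib_d: "calib f y - calib f x \<le> d x y"
proof -
  have "calib f y - d x y \<le> calib f x"
    unfolding calib_def[of f x]
  proof (rule cINF_greatest)
    fix w
    show "calib f y - d x y \<le> f \<bullet> w + d w x"
      using calib_le[of y w] d_triangle[of w y x] by linarith
  qed simp
  then show ?thesis
    by simp
qed

text \<open>Substituting w + z in the infimum and using the periodicity of the distance gives one
  inequality; the other is the same statement for -z.\<close>

lemma calib_lattice:
  assumes z: "z \<in> int_lattice"
  shows "calib f (x + z) = calib f x + f \<bullet> z"
proof -
  have le: "calib f (x + z) \<le> calib f x + f \<bullet> z" if z: "z \<in> int_lattice" for x z
  proof -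
    have "calib f (x + z) - f \<bullet> z \<le> calib f x"
      unfolding calib_def[of f x]
    proof (rule cINF_greatest)
      fix w
      show "calib f (x + z) - f \<bullet> z \<le> f \<bullet> w + d w x"
        using calib_le[of "x + z" "w + z"] d_periodic[OF z, of w x] by (simp add: inner_add_right)
    qed simp
    then show ?thesis
      by simp
  qed
  show ?thesis
    using le[OF z, of x] le[OF int_lattice_closed(3)[OF z], of "x + z"] by simp
qed

lemma calib_lipschitz: "\<bar>calib f y - calib f x\<bar> \<le> M * norm (y - x)"
  using calib_d[of y x] calib_d[of x y] d_le[of x y] d_le[of y x] by (auto simp: abs_le_iff norm_minus_commute)

lemma continuous_on_calib: "continuous_on UNIV (calib f)"
  unfolding continuous_on_iff
proof (intro ballI allI impI)
  fix x and e :: real assume "0 < e"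
  have "dist (calib f y) (calib f x) < e" if "dist y x < e / M" for y
    using calib_lipschitz[of y x] that M_pos by (simp add: dist_norm field_simps)
  then show "\<exists>\<delta>>0. \<forall>y\<in>UNIV. dist y x < \<delta> \<longrightarrow> dist (calib f y) (calib f x) < e"
    using \<open>0 < e\<close> M_pos by (intro exI[of _ "e / M"]) auto
qed

lemma smooth_calibration:
  assumes \<eta>: "0 < \<eta>"
  obtains g D where "\<And>x. (g has_derivative D x) (at x)"
    "\<And>x z. z \<in> int_lattice \<Longrightarrow> g (x + z) = g x + f \<bullet> z"
    "\<And>x y. \<bar>g y - g x\<bar> \<le> M * norm (y - x)"
    "\<And>x v. \<bar>D x v\<bar> \<le> (1 + \<eta>) * G x v"
proof -
  obtain \<delta> where \<delta>: "0 < \<delta>" "\<And>x y v. dist x y < \<delta> \<Longrightarrow> G y v \<le> (1 + \<eta>) * G x v"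
    using uniformly_close[OF \<eta>] by blast
  \<comment> \<open>Averaging moves a point by less than \<rho> and the increment by less than
    \<rho> again, so the whole segment stays within \<delta> of \<open>x\<close>.\<close>
  define \<rho> where "\<rho> = \<delta> / 2"
  have \<rho>: "0 < \<rho>"
    using \<delta> by (simp add: \<rho>_def)
  define g where "g = mollify \<rho> (calib f)"
  have "\<forall>x. \<exists>D. (g has_derivative D) (at x)"
    unfolding g_def using mollify_has_derivative[OF continuous_on_calib \<rho>] by blast
  then obtain D where D: "\<And>x. (g has_derivative D x) (at x)"
    by metis
  have incr: "g (x + v) - g x \<le> (1 + \<eta>) * G x v" if v: "norm v < \<rho>" for x v
    unfolding g_def
  proof (rule mollify_increment_le[OF continuous_on_calib \<rho>])
    fix u :: "real^2" assume u: "norm u < \<rho>"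
    have "calib f (x + v + u) - calib f (x + u) \<le> d (x + u) (x + u + v)"
      using calib_d[where x = "x + u" and y = "x + u + v"] by (simp add: algebra_simps)
    also have "\<dots> \<le> (1 + \<eta>) * G x v"
    proof (rule d_le_segment)
      fix t :: real assume t: "t \<in> {0..1}"
      have "norm (t *\<^sub>R v) \<le> norm v"
        using t by (simp add: mult_left_le_one_le)
      then have "norm (u + t *\<^sub>R v) < \<delta>"
        using norm_triangle_ineq[of u "t *\<^sub>R v"] u v by (simp add: \<rho>_def)
      then have "dist x (x + u + t *\<^sub>R v) < \<delta>"
        by (subst dist_commute) (simp add: dist_norm add.assoc)
      then show "G (x + u + t *\<^sub>R v) v \<le> (1 + \<eta>) * G x v"
        by (rule \<delta>(2))
    qed
    finally show "calib f (x + v + u) - calib f (x + u) \<le> (1 + \<eta>) * G x v" .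
  qed
  have D_le: "D x v \<le> (1 + \<eta>) * G x v" for x v
  proof (rule directional_derivative_le[OF D])
    show "0 < \<rho> / (norm v + 1)"
      using \<rho> by (simp add: add_nonneg_pos)
    fix t :: real assume t: "0 < t" "t < \<rho> / (norm v + 1)"
    then have "t * (norm v + 1) < \<rho>"
      by (subst (asm) pos_less_divide_eq) (auto simp: add_nonneg_pos)
    then have "norm (t *\<^sub>R v) < \<rho>"
      using t by (simp add: algebra_simps)
    from incr[OF this, of x] show "g (x + t *\<^sub>R v) - g x \<le> t * ((1 + \<eta>) * G x v)"
      using t by (simp add: homogeneous mult.left_commute)
  qed
  \<comment> \<open>The one-sided bound is applied to v and -v; reversibility makes the right-hand
    sides equal.\<close>
  have "\<bar>D x v\<bar> \<le> (1 + \<eta>) * G x v" for x v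
    using D_le[of x v] D_le[of x "- v"] linear_neg[OF has_derivative_linear[OF D], of x v]
    by (simp add: reversible abs_le_iff)
  moreover have "g (x + z) = g x + f \<bullet> z" if "z \<in> int_lattice" for x z
    unfolding g_def
  proof (rule mollify_increment_eq[OF continuous_on_calib \<rho>])
    show "calib f (x + z + u) - calib f (x + u) = f \<bullet> z" for u
      using calib_lattice[OF that, of "x + u"] by (simp add: algebra_simps)
  qed
  moreover have "\<bar>g y - g x\<bar> \<le> M * norm (y - x)" for x y
  proof -
    have "g y - g x \<le> M * norm (y - x)" for x y
      unfolding g_def
    proof (rule mollify_increment_le[OF continuous_on_calib \<rho>])
      show "calib f (y + u) - calib f (x + u) \<le> M * norm (y - x)" for u
        using calib_lipschitz[of "y + u" "x + u"] by (simp add: abs_le_iff)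
    qed
    from this[of y x] this[of x y] show ?thesis
      by (simp add: abs_le_iff norm_minus_commute)
  qed
  ultimately show thesis
    using that D by blast
qed

end

end

section \<open>The integral of the Jacobian\<close>

abbreviation periodic_cont :: "(real^2 \<Rightarrow> real) \<Rightarrow> bool" where
  "periodic_cont u \<equiv> continuous_on UNIV u \<and> (\<forall>x. \<forall>z\<in>int_lattice. u (x + z) = u x)"

text \<open>The part of the shifted square with x_k \<ge> 1 is moved back by a lattice vector and
  fills the strip x_k \<le> s that the shift left uncovered.\<close>

lemma integral_torus_translate_pos:
  assumes u: "periodic_cont u" and s: "0 \<le> s" "s \<le> 1"
  shows "integral (cbox 0 1) (\<lambda>x. u (x + s *\<^sub>R axis k 1)) = integral (cbox 0 1) u"
proof -
  define e :: "real^2" where "e = axis k 1"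
  have e: "e \<in> Basis" "e \<in> int_lattice" and ek: "e $ k = 1" and el: "\<And>i. i \<noteq> k \<Longrightarrow> e $ i = 0"
    by (auto simp: e_def int_lattice_axis axis_in_Basis_iff) (simp_all add: axis_def)
  have inner_e: "x \<bullet> e = x $ k" for x
    by (simp add: e_def inner_axis)
  have int: "u integrable_on cbox a b" for a b
    using u by (intro integrable_continuous) (auto intro: continuous_on_subset)
  \<comment> \<open>The upper corner of the strip x_k \<le> s in the unit square.\<close>
  define c where "c = 1 - (1 - s) *\<^sub>R e"
  have comps: "(s *\<^sub>R e) $ i = (if i = k then s else 0)" "c $ i = (if i = k then s else 1)"
    "e $ i = (if i = k then 1 else 0)" for i
    using el by (auto simp: c_def ek)
  have "(\<lambda>x. u (x + s *\<^sub>R e)) = u \<circ> (+) (s *\<^sub>R e)"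
    by (auto simp: add.commute)
  then have "integral (cbox 0 1) (\<lambda>x. u (x + s *\<^sub>R e)) = integral (cbox (0 + s *\<^sub>R e) (1 + s *\<^sub>R e)) u"
    by (simp only: integral_shift_cbox_plus)
  also have "\<dots> = integral (cbox (0 + s *\<^sub>R e) (1 + s *\<^sub>R e) \<inter> {x. x \<bullet> e \<le> 1}) u
      + integral (cbox (0 + s *\<^sub>R e) (1 + s *\<^sub>R e) \<inter> {x. 1 \<le> x \<bullet> e}) u"
    by (rule integral_split[OF int e(1)])
  also have "cbox (0 + s *\<^sub>R e) (1 + s *\<^sub>R e) \<inter> {x. x \<bullet> e \<le> 1} = cbox 0 1 \<inter> {x. s \<le> x \<bullet> e}"
  proof (rule set_eqI)
    fix x
    have "(\<forall>i. (if i = k then s else 0) \<le> x $ i \<and> x $ i \<le> 1 + (if i = k then s else 0)) \<and> x $ k \<le> 1 \<longleftrightarrow>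
        (\<forall>i. 0 \<le> x $ i \<and> x $ i \<le> 1) \<and> s \<le> x $ k"
      using s by (smt (verit, best))
    then show "x \<in> cbox (0 + s *\<^sub>R e) (1 + s *\<^sub>R e) \<inter> {x. x \<bullet> e \<le> 1} \<longleftrightarrow> x \<in> cbox 0 1 \<inter> {x. s \<le> x \<bullet> e}"
      by (simp add: mem_box_cart inner_e comps del: vector_scaleR_component)
  qed
  also have "cbox (0 + s *\<^sub>R e) (1 + s *\<^sub>R e) \<inter> {x. 1 \<le> x \<bullet> e} = cbox (0 + e) (c + e)"
  proof (rule set_eqI)
    fix x
    have "(\<forall>i. (if i = k then s else 0) \<le> x $ i \<and> x $ i \<le> 1 + (if i = k then s else 0)) \<and> 1 \<le> x $ k \<longleftrightarrow>
        (\<forall>i. (if i = k then 1 else 0) \<le> x $ i \<and> x $ i \<le> (if i = k then s else 1) + (if i = k then 1 else 0))"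
      using s by (smt (verit, best))
    then show "x \<in> cbox (0 + s *\<^sub>R e) (1 + s *\<^sub>R e) \<inter> {x. 1 \<le> x \<bullet> e} \<longleftrightarrow> x \<in> cbox (0 + e) (c + e)"
      by (simp add: mem_box_cart inner_e comps del: vector_scaleR_component)
  qed
  also have "integral (cbox (0 + e) (c + e)) u = integral (cbox 0 c) (u \<circ> (+) e)"
    by (rule integral_shift_cbox_plus[symmetric])
  also have "u \<circ> (+) e = u"
    using u e(2) by (auto simp: add.commute[of e])
  also have "cbox 0 c = cbox 0 1 \<inter> {x. x \<bullet> e \<le> s}"
  proof (rule set_eqI)
    fix x
    have "(\<forall>i. 0 \<le> x $ i \<and> x $ i \<le> (if i = k then s else 1)) \<longleftrightarrow> (\<forall>i. 0 \<le> x $ i \<and> x $ i \<le> 1) \<and> x $ k \<le> s"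
      using s by (smt (verit, best))
    then show "x \<in> cbox 0 c \<longleftrightarrow> x \<in> cbox 0 1 \<inter> {x. x \<bullet> e \<le> s}"
      by (simp add: mem_box_cart inner_e comps)
  qed
  also have "integral (cbox 0 1 \<inter> {x. s \<le> x \<bullet> e}) u + integral (cbox 0 1 \<inter> {x. x \<bullet> e \<le> s}) u = integral (cbox 0 1) u"
    using integral_split[OF int[of 0 1] e(1), of s] by simp
  finally show ?thesis
    by (simp add: e_def)
qed

lemma continuous_on_shift:
  fixes u :: "real^2 \<Rightarrow> real"
  shows "continuous_on UNIV u \<Longrightarrow> continuous_on S (\<lambda>x. u (x + a))"
  by (rule continuous_on_compose2[of UNIV u]) (auto intro!: continuous_intros)

lemma periodic_cont_shift:
  assumes "periodic_cont u"
  shows "periodic_cont (\<lambda>x. u (x + a))"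
proof -
  have "u (x + z + a) = u (x + a)" if "z \<in> int_lattice" for x z
  proof -
    have eq: "x + z + a = (x + a) + z"
      by (simp add: algebra_simps)
    show ?thesis
      unfolding eq using assms that by simp
  qed
  then show ?thesis
    using assms continuous_on_shift by blast
qed

lemma integral_torus_translate:
  assumes u: "periodic_cont u" and s: "\<bar>s\<bar> \<le> 1"
  shows "integral (cbox 0 1) (\<lambda>x. u (x + s *\<^sub>R axis k 1)) = integral (cbox 0 1) u"
proof (cases "0 \<le> s")
  case True
  then show ?thesis
    using integral_torus_translate_pos[OF u] s by simp
next
  case False
  have "integral (cbox 0 1) (\<lambda>x. u ((x + (- s) *\<^sub>R axis k 1) + s *\<^sub>R axis k 1)) = integral (cbox 0 1) (\<lambda>x. u (x + s *\<^sub>R axis k 1))"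
    using integral_torus_translate_pos[OF periodic_cont_shift[OF u, of "s *\<^sub>R axis k 1"], of "- s" k] False s by simp
  then show ?thesis
    by simp
qed

text \<open>Central rather than one-sided: the shifts by t and -t are adjoint on the torus, so their
  difference is exactly skew-adjoint.\<close>

definition cdiff :: "2 \<Rightarrow> real \<Rightarrow> (real^2 \<Rightarrow> real) \<Rightarrow> real^2 \<Rightarrow> real" where
  "cdiff k t u x = u (x + t *\<^sub>R axis k 1) - u (x + (- t) *\<^sub>R axis k 1)"

lemma continuous_on_cdiff: "continuous_on UNIV u \<Longrightarrow> continuous_on UNIV (cdiff k t u)"
  unfolding cdiff_def[abs_def] by (intro continuous_intros continuous_on_shift)

lemma periodic_cont_cdiff:
  assumes "periodic_cont u"
  shows "periodic_cont (cdiff k t u)"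
proof -
  have "cdiff k t u (x + z) = cdiff k t u x" if "z \<in> int_lattice" for x z
  proof -
    have eq: "x + z + a = (x + a) + z" for a
      by (simp add: algebra_simps)
    show ?thesis
      using assms that unfolding cdiff_def eq by simp
  qed
  then show ?thesis
    using assms continuous_on_cdiff by blast
qed

lemma periodic_cont_mult: "periodic_cont u \<Longrightarrow> periodic_cont w \<Longrightarrow> periodic_cont (\<lambda>x. u x * w x)"
  by (auto intro!: continuous_intros)

lemma content_torus: "measure lborel (cbox (0::real^2) 1) = 1"
proof -
  have "(0::real^2) \<in> cbox 0 1"
    by (simp add: mem_cbox_01)
  then show ?thesis
    by (auto simp: content_cbox_if_cart)
qed

lemma integrable_torus: "continuous_on UNIV u \<Longrightarrow> u integrable_on cbox (0 :: real^2) 1" for u :: "real^2 \<Rightarrow> real"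
  by (rule integrable_continuous) (rule continuous_on_subset[of UNIV], auto)

lemma integral_cdiff:
  assumes u: "periodic_cont u" and t: "\<bar>t\<bar> \<le> 1"
  shows "integral (cbox 0 1) (cdiff k t u) = 0"
proof -
  have "integral (cbox 0 1) (cdiff k t u) = integral (cbox 0 1) (\<lambda>x. u (x + t *\<^sub>R axis k 1)) - integral (cbox 0 1) (\<lambda>x. u (x + (- t) *\<^sub>R axis k 1))"
    unfolding cdiff_def[abs_def] using u by (intro integral_diff integrable_torus continuous_on_shift) auto
  also have "\<dots> = 0"
    using integral_torus_translate[OF u, of t k] integral_torus_translate[OF u, of "- t" k] t by simp
  finally show ?thesis .
qed

text \<open>Discrete integration by parts; translation invariance on the torus leaves no boundary
  term.\<close>

lemma integral_cdiff_skew: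
  assumes u: "periodic_cont u" and w: "periodic_cont w" and t: "\<bar>t\<bar> \<le> 1"
  shows "integral (cbox 0 1) (\<lambda>x. cdiff k t u x * w x) = - integral (cbox 0 1) (\<lambda>x. u x * cdiff k t w x)"
proof -
  let ?I = "integral (cbox (0::real^2) 1)"
  have shift: "?I (\<lambda>x. u (x + s *\<^sub>R axis k 1) * w x) = ?I (\<lambda>x. u x * w (x + (- s) *\<^sub>R axis k 1))"
    if "\<bar>s\<bar> \<le> 1" for s
  proof -
    have "periodic_cont (\<lambda>x. u x * w (x + (- s) *\<^sub>R axis k 1))"
      using periodic_cont_mult[OF u periodic_cont_shift[OF w]] .
    from integral_torus_translate[OF this that, of k] show ?thesis
      by (simp add: add.assoc)
  qed
  have cont: "continuous_on UNIV u" "continuous_on UNIV w"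
    using u w by auto
  have "?I (\<lambda>x. cdiff k t u x * w x) = ?I (\<lambda>x. u (x + t *\<^sub>R axis k 1) * w x) - ?I (\<lambda>x. u (x + (- t) *\<^sub>R axis k 1) * w x)"
    unfolding cdiff_def left_diff_distrib
    by (intro integral_diff integrable_torus continuous_intros continuous_on_shift cont)
  also have "\<dots> = - (?I (\<lambda>x. u x * w (x + t *\<^sub>R axis k 1)) - ?I (\<lambda>x. u x * w (x + (- t) *\<^sub>R axis k 1)))"
    using shift[of t] shift[of "- t"] t by simp
  also have "\<dots> = - ?I (\<lambda>x. u x * cdiff k t w x)"
    unfolding cdiff_def right_diff_distrib
    by (subst integral_diff) (intro integrable_torus continuous_intros continuous_on_shift cont refl)+
  finally show ?thesis .
qed

lemma cdiff_commute: "cdiff k t (cdiff l s u) = cdiff l s (cdiff k t u)"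
proof
  fix x :: "real^2"
  have c: "x + a + b = x + b + a" for a b
    by simp
  show "cdiff k t (cdiff l s u) x = cdiff l s (cdiff k t u) x"
    unfolding cdiff_def c[of "t *\<^sub>R axis k 1"] c[of "(- t) *\<^sub>R axis k 1"] by simp
qed

text \<open>With D_k for the difference in direction k, both sides equal minus the integral of u D_1
  D_2 w: D_1, respectively D_2, is moved from u to w, and the two commute.\<close>

lemma integral_cdiff_jacobian_periodic:
  assumes u: "periodic_cont u" and w: "periodic_cont w" and t: "\<bar>t\<bar> \<le> 1"
  shows "integral (cbox 0 1) (\<lambda>x. cdiff 1 t u x * cdiff 2 t w x) = integral (cbox 0 1) (\<lambda>x. cdiff 2 t u x * cdiff 1 t w x)"
  using integral_cdiff_skew[OF u periodic_cont_cdiff[OF w] t, of 1 2 t] integral_cdiff_skew[OF u periodic_cont_cdiff[OF w] t, of 2 1 t]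
  by (simp add: cdiff_commute[of 1 t 2 t])

text \<open>
  The integral of the Jacobian depends only on the periods. For central differences in place of
  derivatives this is an exact identity, because these commute and are skew-adjoint.
\<close>

lemma integral_cdiff_jacobian:
  assumes g: "continuous_on UNIV g" "\<And>x z. z \<in> int_lattice \<Longrightarrow> g (x + z) = g x + f \<bullet> z"
    and g': "continuous_on UNIV g'" "\<And>x z. z \<in> int_lattice \<Longrightarrow> g' (x + z) = g' x + f' \<bullet> z"
    and t: "\<bar>t\<bar> \<le> 1"
  shows "integral (cbox 0 1) (\<lambda>x. cdiff 1 t g x * cdiff 2 t g' x - cdiff 2 t g x * cdiff 1 t g' x) = (2 * t)\<^sup>2 * wedge f f'"
proof -
  let ?I = "integral (cbox (0::real^2) 1)"
  \<comment> \<open>Subtracting the linear parts leaves periodic functions. In the expanded Jacobian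
    the linear parts give the constant, the mixed terms have mean zero, and the periodic part is the
    preceding case.\<close>
  define u where "u x = g x - f \<bullet> x" for x
  define w where "w x = g' x - f' \<bullet> x" for x
  have u: "periodic_cont u"
    unfolding u_def using g by (auto simp: inner_add_right intro!: continuous_intros)
  have w: "periodic_cont w"
    unfolding w_def using g' by (auto simp: inner_add_right intro!: continuous_intros)
  have dg: "cdiff k t g x = 2 * t * f $ k + cdiff k t u x" "cdiff k t g' x = 2 * t * f' $ k + cdiff k t w x" for k x
    by (simp_all add: cdiff_def u_def w_def inner_add_right inner_diff_right inner_axis algebra_simps)
  have c: "continuous_on UNIV (cdiff k t u)" "continuous_on UNIV (cdiff k t w)" for k
    using u w continuous_on_cdiff by blast+
  have hi: "(h has_integral ?I h) (cbox 0 1)" if "continuous_on UNIV h" for h :: "real^2 \<Rightarrow> real"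
    using integrable_torus[OF that] by (rule integrable_integral)
  have hu: "(cdiff k t u has_integral 0) (cbox 0 1)" and hw: "(cdiff k t w has_integral 0) (cbox 0 1)" for k
    using hi[OF c(1)] hi[OF c(2)] integral_cdiff[OF u t] integral_cdiff[OF w t] by simp_all
  have hp: "((\<lambda>x. cdiff 1 t u x * cdiff 2 t w x - cdiff 2 t u x * cdiff 1 t w x) has_integral 0) (cbox 0 1)"
    using has_integral_diff[OF hi[of "\<lambda>x. cdiff 1 t u x * cdiff 2 t w x"] hi[of "\<lambda>x. cdiff 2 t u x * cdiff 1 t w x"]]
      integral_cdiff_jacobian_periodic[OF u w t] c by (simp add: continuous_intros)
  have hconst: "((\<lambda>x::real^2. (2 * t)\<^sup>2 * wedge f f') has_integral (2 * t)\<^sup>2 * wedge f f') (cbox 0 1)"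
    using has_integral_const[of "(2 * t)\<^sup>2 * wedge f f'" "0::real^2" 1] by (simp add: content_torus)
  have "((\<lambda>x. (2 * t)\<^sup>2 * wedge f f' + (2 * t * f $ 1 * cdiff 2 t w x - 2 * t * f $ 2 * cdiff 1 t w x)
      + (2 * t * f' $ 2 * cdiff 1 t u x - 2 * t * f' $ 1 * cdiff 2 t u x)
      + (cdiff 1 t u x * cdiff 2 t w x - cdiff 2 t u x * cdiff 1 t w x)) has_integral
      (2 * t)\<^sup>2 * wedge f f' + (2 * t * f $ 1 * 0 - 2 * t * f $ 2 * 0) + (2 * t * f' $ 2 * 0 - 2 * t * f' $ 1 * 0) + 0) (cbox 0 1)"
    by (intro has_integral_add has_integral_diff has_integral_mult_right hu hw hp hconst)
  moreover have "(\<lambda>x. (2 * t)\<^sup>2 * wedge f f' + (2 * t * f $ 1 * cdiff 2 t w x - 2 * t * f $ 2 * cdiff 1 t w x)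
      + (2 * t * f' $ 2 * cdiff 1 t u x - 2 * t * f' $ 1 * cdiff 2 t u x)
      + (cdiff 1 t u x * cdiff 2 t w x - cdiff 2 t u x * cdiff 1 t w x)) =
      (\<lambda>x. cdiff 1 t g x * cdiff 2 t g' x - cdiff 2 t g x * cdiff 1 t g' x)"
    by (rule ext) (simp only: dg wedge_def, algebra)
  ultimately show ?thesis
    by (simp add: integral_unique)
qed

text \<open>The central quotient is the mean of the difference quotients for t and -t.\<close>

lemma cdiff_limit:
  assumes g: "(g has_derivative D) (at x)"
  shows "(\<lambda>n. cdiff k (inverse (real (Suc n))) g x / (2 * inverse (real (Suc n)))) \<longlonglongrightarrow> D (axis k 1)"
proof -
  let ?t = "\<lambda>n. inverse (real (Suc n))" and ?q = "\<lambda>t. (g (x + t *\<^sub>R axis k 1) - g x) / t"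
  have "filterlim ?t (at 0) sequentially"
    using LIMSEQ_inverse_real_of_nat by (intro filterlim_atI) auto
  from filterlim_compose[OF directional_derivative_limit[OF g] this]
  have 1: "(\<lambda>n. ?q (?t n)) \<longlonglongrightarrow> D (axis k 1)" .
  have "(\<lambda>n. - ?t n) \<longlonglongrightarrow> - 0"
    using LIMSEQ_inverse_real_of_nat by (rule tendsto_minus)
  then have "filterlim (\<lambda>n. - ?t n) (at 0) sequentially"
    by (intro filterlim_atI) auto
  from filterlim_compose[OF directional_derivative_limit[OF g] this]
  have 2: "(\<lambda>n. ?q (- ?t n)) \<longlonglongrightarrow> D (axis k 1)" .
  have "(\<lambda>n. (?q (?t n) + ?q (- ?t n)) / 2) \<longlonglongrightarrow> (D (axis k 1) + D (axis k 1)) / 2"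
    by (intro tendsto_intros 1 2) simp
  moreover have eq: "(?q t + ?q (- t)) / 2 = cdiff k t g x / (2 * t)" for t
    by (cases "t = 0") (simp_all add: cdiff_def field_simps)
  ultimately show ?thesis
    unfolding eq by simp
qed

text \<open>The discrete identity, divided by (2t)^2, holds for every step t = 1/(n + 1). The
  quotients converge pointwise to the derivatives and are dominated through the Lipschitz bound, so
  the integral passes to the limit.\<close>

lemma integral_jacobian:
  assumes g: "\<And>x. (g has_derivative D x) (at x)" "\<And>x z. z \<in> int_lattice \<Longrightarrow> g (x + z) = g x + f \<bullet> z"
      "\<And>x y. \<bar>g y - g x\<bar> \<le> L * norm (y - x)"
    and g': "\<And>x. (g' has_derivative D' x) (at x)" "\<And>x z. z \<in> int_lattice \<Longrightarrow> g' (x + z) = g' x + f' \<bullet> z"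
      "\<And>x y. \<bar>g' y - g' x\<bar> \<le> L * norm (y - x)"
  shows "((\<lambda>x. D x (axis 1 1) * D' x (axis 2 1) - D x (axis 2 1) * D' x (axis 1 1)) has_integral wedge f f') (cbox 0 1)"
proof -
  let ?t = "\<lambda>n. inverse (real (Suc n))"
  define J where "J n x = (cdiff 1 (?t n) g x / (2 * ?t n)) * (cdiff 2 (?t n) g' x / (2 * ?t n))
    - (cdiff 2 (?t n) g x / (2 * ?t n)) * (cdiff 1 (?t n) g' x / (2 * ?t n))" for n x
  have cont: "continuous_on UNIV g" "continuous_on UNIV g'"
    using g(1) g'(1) by (auto intro!: continuous_at_imp_continuous_on has_derivative_continuous)
  have J_eq: "J n = (\<lambda>x. (cdiff 1 (?t n) g x * cdiff 2 (?t n) g' x - cdiff 2 (?t n) g x * cdiff 1 (?t n) g' x) * (1 / (2 * ?t n)\<^sup>2))" for n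
    by (rule ext) (simp add: J_def power2_eq_square field_simps)
  have J_int: "(J n has_integral wedge f f') (cbox 0 1)" for n
  proof -
    have t: "\<bar>?t n\<bar> \<le> 1" "?t n \<noteq> 0"
      by (auto simp: inverse_eq_divide)
    have "(\<lambda>x. cdiff 1 (?t n) g x * cdiff 2 (?t n) g' x - cdiff 2 (?t n) g x * cdiff 1 (?t n) g' x) integrable_on cbox 0 1"
      by (intro integrable_torus continuous_intros continuous_on_cdiff cont)
    from integrable_integral[OF this] have "((\<lambda>x. cdiff 1 (?t n) g x * cdiff 2 (?t n) g' x - cdiff 2 (?t n) g x * cdiff 1 (?t n) g' x) has_integral
        (2 * ?t n)\<^sup>2 * wedge f f') (cbox 0 1)"
      by (simp only: integral_cdiff_jacobian[OF cont(1) g(2) cont(2) g'(2) t(1)])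
    from has_integral_mult_left[OF this, of "1 / (2 * ?t n)\<^sup>2"] show ?thesis
      unfolding J_eq using t(2) by simp
  qed
  have bound: "\<bar>cdiff k (?t n) h x / (2 * ?t n)\<bar> \<le> L" if "\<And>x y. \<bar>h y - h x\<bar> \<le> L * norm (y - x)" for h k n x
  proof -
    have "\<bar>cdiff k (?t n) h x\<bar> \<le> L * norm ((x + ?t n *\<^sub>R axis k 1) - (x + (- ?t n) *\<^sub>R axis k 1))"
      unfolding cdiff_def by (rule that)
    also have "(x + ?t n *\<^sub>R axis k 1) - (x + (- ?t n) *\<^sub>R axis k 1) = (2 * ?t n) *\<^sub>R axis k (1::real)"
      by (simp add: vec_eq_iff)
    also have "norm \<dots> = 2 * ?t n"
      by simp
    finally have "\<bar>cdiff k (?t n) h x\<bar> \<le> L * (2 * ?t n)" .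
    moreover have "0 < 2 * ?t n"
      by simp
    ultimately show ?thesis
      by (simp only: abs_divide abs_of_pos pos_divide_le_eq)
  qed
  have L: "0 \<le> L"
    using g(3)[of "axis 1 1" 0] by simp
  show ?thesis
  proof (rule has_integral_dominated_convergence)
    show "(J n has_integral wedge f f') (cbox 0 1)" for n
      by (rule J_int)
    show "(\<lambda>_. L * L + L * L) integrable_on cbox (0::real^2) 1"
      by (rule integrable_const)
    show "\<forall>x\<in>cbox 0 1. norm (J n x) \<le> L * L + L * L" for n
    proof
      fix x :: "real^2"
      have "\<bar>J n x\<bar> \<le> \<bar>cdiff 1 (?t n) g x / (2 * ?t n)\<bar> * \<bar>cdiff 2 (?t n) g' x / (2 * ?t n)\<bar>
          + \<bar>cdiff 2 (?t n) g x / (2 * ?t n)\<bar> * \<bar>cdiff 1 (?t n) g' x / (2 * ?t n)\<bar>"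
        unfolding J_def abs_mult[symmetric] by (rule abs_triangle_ineq4)
      also have "\<dots> \<le> L * L + L * L"
        using bound[OF g(3)] bound[OF g'(3)] L by (intro add_mono mult_mono) auto
      finally show "norm (J n x) \<le> L * L + L * L"
        by simp
    qed
    show "\<forall>x\<in>cbox 0 1. (\<lambda>n. J n x) \<longlonglongrightarrow> D x (axis 1 1) * D' x (axis 2 1) - D x (axis 2 1) * D' x (axis 1 1)"
      unfolding J_def by (intro ballI tendsto_intros cdiff_limit g(1) g'(1))
  qed simp
qed

section \<open>Comparison of the areas\<close>

lemma le_of_divide_square_le:
  fixes q I :: real
  assumes "\<And>\<eta>. 0 < \<eta> \<Longrightarrow> q / (1 + \<eta>)\<^sup>2 \<le> I"
  shows "q \<le> I"
proof (rule tendsto_upperbound)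
  have "((\<lambda>\<eta>::real. q / (1 + \<eta>)\<^sup>2) \<longlongrightarrow> q / (1 + 0)\<^sup>2) (at_right 0)"
    by (intro tendsto_intros) auto
  then show "((\<lambda>\<eta>::real. q / (1 + \<eta>)\<^sup>2) \<longlongrightarrow> q) (at_right 0)"
    by simp
  show "\<forall>\<^sub>F \<eta> in at_right 0. q / (1 + \<eta>)\<^sup>2 \<le> I"
    unfolding eventually_at_right_field using assms by (intro exI[of _ 1]) auto
qed simp

lemma qform_scale: "qform (\<lambda>i. c *\<^sub>R a i) n p = c\<^sup>2 * qform a n p"
proof -
  have "wedge (c *\<^sub>R v) (c *\<^sub>R w) = c\<^sup>2 * wedge v w" for v w
    by (simp add: power2_eq_square)
  then have "p i * p j * \<bar>wedge (c *\<^sub>R a i) (c *\<^sub>R a j)\<bar> = c\<^sup>2 * (p i * p j * \<bar>wedge (a i) (a j)\<bar>)" for i j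
    by (simp only: abs_mult abs_power2) (simp add: mult_ac)
  then show ?thesis
    by (simp only: qform_def sum_distrib_left[symmetric] times_divide_eq_right)
qed

context finsler_plane
begin

text \<open>The vector \<open>p\<close> depends on the polygon alone. It is fixed before the
  accuracy \<eta> and the point \<open>x\<close>, so \<eta> can tend to 0 while
  \<open>qform a n p\<close> stays the same.\<close>

lemma polygon_area_bound:
  fixes f :: "nat \<Rightarrow> real^2"
  assumes f: "\<And>i v. i < n \<Longrightarrow> f i \<bullet> v \<le> N v"
    and nonpar: "i0 < n" "j0 < n" "wedge (f i0) (f j0) \<noteq> 0"
    and P: "{v. \<forall>i<n. \<bar>f i \<bullet> v\<bar> \<le> 1} \<in> lmeasurable"
  shows "1 \<le> integral (cbox 0 1) (\<lambda>x. 1 / measure lebesgue (unit_ball x)) * measure lebesgue {v. \<forall>i<n. \<bar>f i \<bullet> v\<bar> \<le> 1}"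
    (is "1 \<le> ?I * measure lebesgue ?P")
proof -
  \<comment> \<open>A rotation by a right angle: it turns inner products into wedge products, the
    form in which the polygon inequalities are stated, and preserves the wedge of two
    vectors.\<close>
  define J :: "real^2 \<Rightarrow> real^2" where "J v = vector [v $ 2, - v $ 1]" for v
  have J: "wedge (J v) x = v \<bullet> x" "wedge (J v) (J w) = wedge v w" for v w x
    by (simp_all add: J_def wedge_def inner_vec_def sum_2)
  define a where "a i = J (f i)" for i
  have P_eq: "?P = {x. \<forall>i<n. \<bar>wedge (a i) x\<bar> \<le> 1}"
    by (simp add: a_def J)
  have "wedge (a i0) (a j0) \<noteq> 0"
    unfolding a_def J(2) by (rule nonpar(3))
  then obtain p where p: "p \<in> simplex_weights n" and pq: "1 \<le> qform a n p * measure lebesgue ?P"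
    by (rule exists_qform_measure_ge_1[OF nonpar(1,2) _ P_eq P])
  have pnn: "0 \<le> p i" for i
    using p by (simp add: simplex_weights_def)
  have "qform a n p / (1 + \<eta>)\<^sup>2 \<le> ?I" if \<eta>: "0 < \<eta>" for \<eta>
  proof -
    have "\<forall>i. \<exists>g D. i < n \<longrightarrow> (\<forall>x. (g has_derivative D x) (at x)) \<and>
        (\<forall>x. \<forall>z\<in>int_lattice. g (x + z) = g x + f i \<bullet> z) \<and>
        (\<forall>x y. \<bar>g y - g x\<bar> \<le> M * norm (y - x)) \<and> (\<forall>x v. \<bar>D x v\<bar> \<le> (1 + \<eta>) * G x v)"
    proof
      fix i
      show "\<exists>g D. i < n \<longrightarrow> (\<forall>x. (g has_derivative D x) (at x)) \<and>
        (\<forall>x. \<forall>z\<in>int_lattice. g (x + z) = g x + f i \<bullet> z) \<and>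
        (\<forall>x y. \<bar>g y - g x\<bar> \<le> M * norm (y - x)) \<and> (\<forall>x v. \<bar>D x v\<bar> \<le> (1 + \<eta>) * G x v)"
      proof (cases "i < n")
        case True
        from smooth_calibration[OF f[OF True] \<eta>] show ?thesis
          by metis
      qed simp
    qed
    then obtain g D where gD: "\<forall>i<n. (\<forall>x. (g i has_derivative D i x) (at x)) \<and>
        (\<forall>x. \<forall>z\<in>int_lattice. g i (x + z) = g i x + f i \<bullet> z) \<and>
        (\<forall>x y. \<bar>g i y - g i x\<bar> \<le> M * norm (y - x)) \<and> (\<forall>x v. \<bar>D i x v\<bar> \<le> (1 + \<eta>) * G x v)"
      by metis
    then have g: "(g i has_derivative D i x) (at x)" "z \<in> int_lattice \<Longrightarrow> g i (x + z) = g i x + f i \<bullet> z"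
      "\<bar>g i y - g i x\<bar> \<le> M * norm (y - x)" "\<bar>D i x v\<bar> \<le> (1 + \<eta>) * G x v" if "i < n" for i x y z v
      using that by blast+
    \<comment> \<open>The rotated gradient of \<open>g i\<close> at \<open>x\<close>, so that its
      wedge with a vector is the differential.\<close>
    define w where "w x i = J (vector [D i x (axis 1 1), D i x (axis 2 1)])" for x i
    have w: "wedge (w x i) v = D i x v" if "i < n" for x i v
    proof -
      have lin: "linear (D i x)"
        using g(1)[OF that] by (rule has_derivative_linear)
      have "v = (v $ 1) *\<^sub>R axis 1 1 + (v $ 2) *\<^sub>R axis 2 1"
        by (simp add: vec_eq_iff forall_2 axis_def)
      then have "D i x v = D i x ((v $ 1) *\<^sub>R axis 1 1 + (v $ 2) *\<^sub>R axis 2 1)"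
        by (rule arg_cong)
      also have "\<dots> = v $ 1 * D i x (axis 1 1) + v $ 2 * D i x (axis 2 1)"
        by (simp only: linear_add[OF lin] linear_cmul[OF lin] real_scaleR_def)
      finally have "D i x v = v $ 1 * D i x (axis 1 1) + v $ 2 * D i x (axis 2 1)" .
      then show ?thesis
        by (simp add: w_def J_def wedge_def mult.commute)
    qed
    \<comment> \<open>These signs do not depend on \<open>x\<close>. This keeps \<open>S\<close>
      linear in the Jacobians, so that its integral is known exactly, and still below the sum with
      absolute values.\<close>
    define \<sigma> where "\<sigma> i j = sgn (wedge (f i) (f j))" for i j
    define S where "S x = (\<Sum>i<n. \<Sum>j<n. (p i * p j * \<sigma> i j) *
        (D i x (axis 1 1) * D j x (axis 2 1) - D i x (axis 2 1) * D j x (axis 1 1))) / 2" for x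
    have ww: "wedge (w x i) (w x j) = D i x (axis 1 1) * D j x (axis 2 1) - D i x (axis 2 1) * D j x (axis 1 1)" for x i j
      by (simp add: w_def J(2)) (simp add: wedge_def)
    have S_le: "S x / (1 + \<eta>)\<^sup>2 \<le> 1 / measure lebesgue (unit_ball x)" for x
    proof -
      have "S x \<le> qform (w x) n p"
        unfolding S_def qform_def ww[symmetric]
      proof (intro divide_right_mono sum_mono)
        fix i j
        have "\<sigma> i j * wedge (w x i) (w x j) \<le> \<bar>wedge (w x i) (w x j)\<bar>"
          by (auto simp: \<sigma>_def sgn_if)
        from mult_left_mono[OF this, of "p i * p j"] pnn
        show "p i * p j * \<sigma> i j * wedge (w x i) (w x j) \<le> p i * p j * \<bar>wedge (w x i) (w x j)\<bar>"
          by (simp add: mult.assoc)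
      qed simp
      \<comment> \<open>Dividing the differentials by 1 + \<eta> brings them into the dual unit ball
        at \<open>x\<close>; \<open>qform\<close> is quadratic in them, whence the square.\<close>
      then have "S x / (1 + \<eta>)\<^sup>2 \<le> (1 / (1 + \<eta>))\<^sup>2 * qform (w x) n p"
        using \<eta> by (simp add: power_divide divide_right_mono)
      also have "\<dots> = qform (\<lambda>i. (1 / (1 + \<eta>)) *\<^sub>R w x i) n p"
        by (rule qform_scale[symmetric])
      also have "\<dots> \<le> 1 / measure lebesgue (unit_ball x)"
      proof -
        have "\<bar>wedge ((1 / (1 + \<eta>)) *\<^sub>R w x i) v\<bar> \<le> 1" if "v \<in> unit_ball x" "i < n" for v i
        proof -
          have "\<bar>D i x v\<bar> \<le> (1 + \<eta>) * 1"
            using g(4)[OF that(2), of x v] that(1) \<eta> by (simp add: unit_ball_def) (smt (verit) mult_left_le)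
          then show ?thesis
            using \<eta> w[OF that(2), of x v] by (simp add: abs_mult field_simps)
        qed
        then have "qform (\<lambda>i. (1 / (1 + \<eta>)) *\<^sub>R w x i) n p * measure lebesgue (unit_ball x) \<le> 1"
          by (rule qform_measure_le_1[OF p lmeasurable_compact[OF compact_unit_ball], of x "\<lambda>i. (1 / (1 + \<eta>)) *\<^sub>R w x i"])
        then show ?thesis
          using measure_unit_ball_pos[of x] by (simp only: pos_le_divide_eq)
      qed
      finally show ?thesis .
    qed
    have "(S has_integral (\<Sum>i<n. \<Sum>j<n. (p i * p j * \<sigma> i j) * wedge (f i) (f j)) / 2) (cbox 0 1)"
      unfolding S_def
    proof (intro has_integral_divide has_integral_sum has_integral_mult_right finite_lessThan)
      fix i j assume "i \<in> {..<n}" "j \<in> {..<n}"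
      then show "((\<lambda>x. D i x (axis 1 1) * D j x (axis 2 1) - D i x (axis 2 1) * D j x (axis 1 1)) has_integral wedge (f i) (f j)) (cbox 0 1)"
        by (intro integral_jacobian[of "g i" _ _ M "g j"] g) auto
    qed
    also have "(\<Sum>i<n. \<Sum>j<n. (p i * p j * \<sigma> i j) * wedge (f i) (f j)) / 2 = qform a n p"
      unfolding qform_def by (simp add: a_def J(2) \<sigma>_def mult.assoc abs_sgn[symmetric] mult.commute[of "sgn _"])
    finally have "((\<lambda>x. S x / (1 + \<eta>)\<^sup>2) has_integral qform a n p / (1 + \<eta>)\<^sup>2) (cbox 0 1)"
      by (rule has_integral_divide)
    then show ?thesis
      by (rule has_integral_le[OF _ integrable_integral[OF integrable_inverse_measure_unit_ball]]) (rule S_le)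
  qed
  then have "qform a n p \<le> ?I"
    by (rule le_of_divide_square_le)
  then have "qform a n p * measure lebesgue ?P \<le> ?I * measure lebesgue ?P"
    by (rule mult_right_mono) simp
  then show ?thesis
    using pq by linarith
qed

section \<open>Approximation of the stable unit ball by polygons\<close>

definition stable_ball :: "(real^2) set" where
  "stable_ball = {v. N v \<le> 1}"

lemma continuous_on_N: "continuous_on UNIV N"
  using asym_norm_N by (intro convex_on_continuous) (auto simp: asym_norm_def)

lemma convex_stable_ball: "convex stable_ball"
proof (rule convexI)
  fix x y and u v :: real assume xy: "x \<in> stable_ball" "y \<in> stable_ball" and uv: "0 \<le> u" "0 \<le> v" "u + v = 1"
  have "N (u *\<^sub>R x + v *\<^sub>R y) \<le> u * N x + v * N y"
    using N_triangle[of "u *\<^sub>R x" "v *\<^sub>R y"] uv by (simp add: N_homogeneous)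
  also have "\<dots> \<le> u * 1 + v * 1"
    using xy uv by (intro add_mono mult_left_mono) (auto simp: stable_ball_def)
  finally show "u *\<^sub>R x + v *\<^sub>R y \<in> stable_ball"
    using uv by (simp add: stable_ball_def)
qed

lemma closed_stable_ball: "closed stable_ball"
  unfolding stable_ball_def by (intro closed_Collect_le continuous_on_N continuous_on_const)

text \<open>The Hahn-Banach theorem as a separation of \<open>v\<close> from the closed convex
  ball.\<close>

lemma dual_functional:
  assumes v: "v \<notin> stable_ball"
  obtains g where "\<And>u. g \<bullet> u \<le> N u" "1 < g \<bullet> v"
proof -
  obtain a b where ab: "a \<bullet> v < b" "\<And>y. y \<in> stable_ball \<Longrightarrow> b < a \<bullet> y"
    using separating_hyperplane_closed_point[OF convex_stable_ball closed_stable_ball v] by blast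
  have "0 \<in> stable_ball"
    by (simp add: stable_ball_def asym_norm_zero[OF asym_norm_N])
  then have b: "b < 0"
    using ab(2) by fastforce
  \<comment> \<open>The ball lies where a exceeds b. As it contains 0, b is negative, so dividing by
    b moves the separating line to g = 1 and reverses the inequalities.\<close>
  define g where "g = (1 / b) *\<^sub>R a"
  have le: "g \<bullet> u \<le> N u" for u
  proof (cases "u = 0")
    case False
    then have Nu: "0 < N u"
      using asym_norm_N by (simp add: asym_norm_def)
    have "(1 / N u) *\<^sub>R u \<in> stable_ball"
      using Nu by (simp add: stable_ball_def N_homogeneous)
    then have "b < a \<bullet> ((1 / N u) *\<^sub>R u)"
      by (rule ab(2))
    then show ?thesis
      using b Nu by (simp add: g_def field_simps)
  qed (simp add: asym_norm_zero[OF asym_norm_N])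
  have "1 < g \<bullet> v"
    using ab(1) b by (simp add: g_def field_simps)
  then show thesis
    using that le by blast
qed

text \<open>A countable dense set in the dual ball gives a decreasing sequence of circumscribed
  polygons whose intersection is the ball; the bound passes to the limit by continuity of measure
  from above.\<close>

theorem stable_area_bound:
  "1 \<le> integral (cbox 0 1) (\<lambda>x. 1 / measure lebesgue (unit_ball x)) * measure lebesgue stable_ball"
    (is "1 \<le> ?I * _")
proof -
  define Dual where "Dual = {f. \<forall>v. f \<bullet> v \<le> N v}"
  obtain C where C: "countable C" "C \<subseteq> Dual" "Dual \<subseteq> closure C"
    using separable by blast
  have axis_dual: "m *\<^sub>R axis k 1 \<in> Dual" for k
  proof -
    have "m * v $ k \<le> N v" for v
    proof -
      have "v $ k \<le> norm v"
        using component_le_norm_cart[of v k] by linarith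
      then have "m * v $ k \<le> m * norm v"
        using m_pos by simp
      then show ?thesis
        using N_lower[of v] by linarith
    qed
    then show ?thesis
      by (simp add: Dual_def inner_axis_axis inner_axis' )
  qed
  have "Dual \<noteq> {}"
    using axis_dual by blast
  then have "C \<noteq> {}"
    using C(3) by auto
  \<comment> \<open>Two multiples of the coordinate functionals are put in front of the enumeration.
    They lie in the dual ball by the lower bound \<open>m\<close>, are not parallel, and make every
    polygon bounded.\<close>
  define f where "f i = (if i = 0 then m *\<^sub>R axis 1 1 else if i = 1 then m *\<^sub>R axis 2 1 else from_nat_into C (i - 2))" for i
  have f_dual: "f i \<in> Dual" for i
    using axis_dual from_nat_into[OF \<open>C \<noteq> {}\<close>] C(2) by (auto simp: f_def)
  have C_f: "\<exists>i. c = f i" if c: "c \<in> C" for c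
  proof -
    obtain k where "from_nat_into C k = c"
      using from_nat_into_surj[OF C(1) c] by blast
    then have "c = f (k + 2)"
      by (simp add: f_def)
    then show ?thesis
      by blast
  qed
  \<comment> \<open>The offset 2 keeps both coordinate functionals in every polygon, even for n =
    0.\<close>
  define P where "P n = {v. \<forall>i<n + 2. \<bar>f i \<bullet> v\<bar> \<le> 1}" for n
  have P_compact: "compact (P n)" for n
  proof -
    have "norm v \<le> 2 / m" if "v \<in> P n" for v
    proof -
      have "\<bar>f 0 \<bullet> v\<bar> \<le> 1" "\<bar>f 1 \<bullet> v\<bar> \<le> 1"
        using that by (auto simp: P_def)
      then have "m * \<bar>v $ 1\<bar> \<le> 1" "m * \<bar>v $ 2\<bar> \<le> 1"
        using m_pos by (simp_all add: f_def inner_axis' abs_mult)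
      then have "m * (\<bar>v $ 1\<bar> + \<bar>v $ 2\<bar>) \<le> 2"
        by (simp add: distrib_left)
      moreover have "norm v \<le> \<bar>v $ 1\<bar> + \<bar>v $ 2\<bar>"
        using norm_le_l1_cart[of v] by (simp add: sum_2)
      then have "m * norm v \<le> m * (\<bar>v $ 1\<bar> + \<bar>v $ 2\<bar>)"
        using m_pos by (intro mult_left_mono) auto
      ultimately have "m * norm v \<le> 2"
        by linarith
      then show ?thesis
        using m_pos by (simp add: field_simps)
    qed
    then have "bounded (P n)"
      by (auto simp: bounded_iff)
    moreover have "closed (P n)"
    proof -
      have "P n = (\<Inter>i<n + 2. {v. \<bar>f i \<bullet> v\<bar> \<le> 1})"
        by (auto simp: P_def)
      then show ?thesis
        by (auto intro!: closed_INT closed_Collect_le continuous_intros)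
    qed
    ultimately show ?thesis
      by (simp add: compact_eq_bounded_closed)
  qed
  have P_bound: "1 \<le> ?I * measure lebesgue (P n)" for n
    unfolding P_def
  proof (rule polygon_area_bound)
    show "f i \<bullet> v \<le> N v" for i v
      using f_dual by (simp add: Dual_def)
    show "0 < n + 2" "1 < n + 2"
      by auto
    show "wedge (f 0) (f 1) \<noteq> 0"
      using m_pos by (simp add: f_def) (simp add: wedge_def axis_def)
    show "{v. \<forall>i<n + 2. \<bar>f i \<bullet> v\<bar> \<le> 1} \<in> lmeasurable"
      using lmeasurable_compact[OF P_compact[of n]] by (simp add: P_def)
  qed
  have "(\<Inter>n. P n) = stable_ball"
  proof (intro equalityI subsetI)
    fix v assume v: "v \<in> stable_ball"
    have "\<bar>f i \<bullet> v\<bar> \<le> 1" for i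
    proof -
      have "f i \<bullet> v \<le> N v" "f i \<bullet> (- v) \<le> N (- v)"
        using f_dual[of i] unfolding Dual_def by blast+
      then show ?thesis
        using v by (simp add: N_minus stable_ball_def abs_le_iff)
    qed
    then show "v \<in> (\<Inter>n. P n)"
      by (simp add: P_def)
  next
    fix v assume v: "v \<in> (\<Inter>n. P n)"
    show "v \<in> stable_ball"
    proof (rule ccontr)
      assume "v \<notin> stable_ball"
      then obtain g where g: "\<And>u. g \<bullet> u \<le> N u" "1 < g \<bullet> v"
        using dual_functional by blast
      then have "g \<in> closure C"
        using C(3) by (auto simp: Dual_def)
      \<comment> \<open>The strict inequality is an open condition on the functional, so some member
        of the dense set also separates \<open>v\<close>.\<close>
      moreover have "open {h. 1 < h \<bullet> v}"
        by (intro open_Collect_less continuous_intros)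
      ultimately obtain c where c: "c \<in> C" "1 < c \<bullet> v"
        using g(2) closure_iff_nhds_not_empty[of g C] by (metis (mono_tags, lifting) IntE ex_in_conv mem_Collect_eq subset_refl)
      then obtain i where "c = f i"
        using C_f by blast
      then have "\<bar>c \<bullet> v\<bar> \<le> 1"
        using v by (auto simp: P_def dest: spec[of _ i])
      then show False
        using c(2) by simp
    qed
  qed
  moreover have "(\<lambda>n. measure lebesgue (P n)) \<longlonglongrightarrow> measure lebesgue (\<Inter>n. P n)"
  proof (rule Lim_measure_decseq)
    show "range P \<subseteq> sets lebesgue"
      using lmeasurable_compact[OF P_compact] by (auto simp: fmeasurableD)
    show "decseq P"
      by (auto simp: decseq_def P_def)
    show "emeasure lebesgue (P i) \<noteq> \<infinity>" for i
      using fmeasurableD2[OF lmeasurable_compact[OF P_compact[of i]]] by simp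
  qed
  ultimately have "(\<lambda>n. ?I * measure lebesgue (P n)) \<longlonglongrightarrow> ?I * measure lebesgue stable_ball"
    by (intro tendsto_mult_left) simp
  then show ?thesis
    by (rule LIMSEQ_le_const) (use P_bound in blast)
qed

end

theorem theorem6p1:
  fixes F :: "torus \<Rightarrow> real^2 \<Rightarrow> real"
  assumes "finsler_metric F" and "reversible F"
  shows "area_BH F \<ge> area_BH (flat_metric (stable_norm F))"
proof -
  obtain m M where "finsler_plane (lift_metric F) m M"
    using finsler_plane_lift_metric[OF assms] by blast
  then interpret finsler_plane "lift_metric F" m M .
  have N: "stable_norm F = N"
    by (rule stable_norm_eq) unfold_locales
  define I where "I = integral (cbox 0 1) (\<lambda>x. 1 / measure lebesgue (unit_ball x))"
  have "area_BH F = integral (cbox 0 1) (\<lambda>x. pi * (1 / measure lebesgue (unit_ball x)))"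
    by (simp add: area_BH_def unit_ball_def)
  then have F: "area_BH F = pi * I"
    unfolding I_def by (simp only: integral_mult_right)
  have "area_BH (flat_metric (stable_norm F)) = integral (cbox (0::real^2) 1) (\<lambda>x. pi / measure lebesgue stable_ball)"
    by (simp add: area_BH_def lift_metric_def flat_metric_def N stable_ball_def)
  then have flat: "area_BH (flat_metric (stable_norm F)) = pi / measure lebesgue stable_ball"
    by (simp add: content_torus)
  have bound: "1 \<le> I * measure lebesgue stable_ball"
    using stable_area_bound by (simp add: I_def)
  \<comment> \<open>The bound itself excludes a ball of measure zero, so that dividing by the
    measure is meaningful.\<close>
  then have "0 < measure lebesgue stable_ball"
    by (metis measure_nonneg mult_zero_right not_one_le_zero order_le_less)
  then have "1 / measure lebesgue stable_ball \<le> I"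
    using bound by (simp add: field_simps)
  then have "pi * (1 / measure lebesgue stable_ball) \<le> pi * I"
    by (intro mult_left_mono) auto
  then show ?thesis
    by (simp add: F flat)
qed

end
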